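(* Let $\alpha,\beta\in\mathbb{N}$, $p\in\mathbb{N}_0$, put $\gamma=\alpha+\beta+p$, and let $h(x,y)=x^{\alpha-1}y^{\beta-1}(1-x-y)^p$ on the closed triangle $\mathbb{T}$. Let $k\in\mathbb{N}$ satisfy $$k>\max\left\{\tfrac34+\tfrac34\alpha+\tfrac p2,\ \tfrac54+\tfrac{p+\beta}{2},\ \tfrac14+\tfrac34\alpha+\tfrac{\beta}{2}\right\},$$ let $u\in H^{2k}(\mathbb{T},h)\cap C(\mathbb{T})$, and let $\sigma$ be a modal filter of order $2k-1$ which in addition satisfies $\sigma\in C^{2k-1}([0,\varepsilon))$ for some interval $[0,\varepsilon)\subset[0,1]$, $\varepsilon>0$. Let $u_N^\sigma$ denote the filtered APK partial sum of $u$. Then the following pointwise error bounds hold for all $N\ge 1$, with constants $K_1,\dots,K_6$ that do not depend on $N$ (they may depend on the point considered and on $u,\sigma,k,\alpha,\beta,p$): 1. If $(x,y)$ lies in the interior $\mathring{\mathbb{T}}$, then $|u(x,y)-u_N^\sigma(x,y)|\le K_1 N^{-(2k-\frac74)}$. 2. On the left edge, for $y\in[0,1]$: $|u(0,y)-u_N^\sigma(0,y)|\le K_2 N^{-(2k-\frac32\alpha-p-\frac12)}$ if $p>\beta-1$, and $|u(0,y)-u_N^\sigma(0,y)|\le K_3 N^{-(2k-\frac32\alpha-\beta+\frac12)}$ if $p\le\beta-1$. 3. On the lower edge, for $x\in(0,1)$: $|u(x,0)-u_N^\sigma(x,0)|\le K_4 N^{-(2k-\frac34-\beta)}$. 4.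 On the hypotenuse, for $x\in(0,1)$: $|u(x,1-x)-u_N^\sigma(x,1-x)|\le K_5 N^{-(2k-\frac74-p)}$. 5. At the vertex $(1,0)$: $|u(1,0)-u_N^\sigma(1,0)|\le K_6 N^{-(2k+\alpha-\gamma-\frac32)}$.
   Context: $\mathbb{N}=\{1,2,\dots\}$, $\mathbb{N}_0=\mathbb{N}\cup\{0\}$. $\mathbb{T}=\{(x,y)\in\mathbb{R}^2: x\ge0,\ y\ge0,\ x+y\le1\}$. $L^2(\mathbb{T},h)$ is the Hilbert space with inner product $(u,v)=\int_{\mathbb{T}}h\,u\,v\,dx\,dy$. For $m\in\mathbb{N}_0$, the weighted Sobolev space $H^m(\mathbb{T},h)$ consists of all $v\in L^2(\mathbb{T},h)$ such that for each multi-index $\tau$ with $|\tau|\le m$ the distributional derivative $D^\tau v$ belongs to $L^2(\mathbb{T},h)$. Let $P_n^{a,b}$ be the $n$-th Jacobi polynomial (standard normalization, orthogonal on $[-1,1]$ with weight $(1-z)^a(1+z)^b$). With $a_l=p+\beta+2l$, the Appell-Proriol-Koornwinder (APK) polynomials are, for $m,l\in\mathbb{N}_0$, $$A_{m,l}(x,y)=P_m^{\alpha-1,a_l}(1-2x)\,P_l^{p,\beta-1}\!\left(\frac{2y}{1-x}-1\right)(1-x)^l ,$$ which are polynomials in $(x,y)$ of degree $m+l$ (at $x=1$ the expression is understood as the value of this polynomial). They are orthogonal in $L^2(\mathbb{T},h)$. Modal filter of order $r$ ($r\ge1$ an integer): a real function $\sigma\in C^{r-1}([0,1])$ with $\sigma(0)=1$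 and $\sigma^{(j)}(0)=0$ for $1\le j\le r-1$. Filtered APK partial sum: for $N\ge1$, $$u_N^\sigma(x,y)=\sum_{l,m\in\mathbb{N}_0,\ l+m\le N}\sigma\!\left(\frac{l+m}{N}\right)\tilde u_{m,l}A_{m,l}(x,y),\qquad \tilde u_{m,l}=\frac{(u,A_{m,l})}{(A_{m,l},A_{m,l})}.$$ *)

theory Defs
  imports "HOL-Analysis.Analysis"
begin

definition triangle :: "(real \<times> real) set" where
  "triangle = {(x, y). 0 \<le> x \<and> 0 \<le> y \<and> x + y \<le> 1}"

definition tri_weight :: "nat \<Rightarrow> nat \<Rightarrow> nat \<Rightarrow> real \<times> real \<Rightarrow> real" where
  "tri_weight \<alpha> \<beta> p = (\<lambda>(x, y). x ^ (\<alpha> - 1) * y ^ (\<beta> - 1) * (1 - x - y) ^ p)"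


subsection \<open>Weighted Lebesgue and Sobolev spaces\<close>

text \<open>Elements of the function spaces are represented by functions on the plane; values outside
  the triangle are irrelevant, and no quotient by almost-everywhere equality is taken.\<close>

definition wL2 :: "(real \<times> real \<Rightarrow> real) \<Rightarrow> (real \<times> real \<Rightarrow> real) set" where
  "wL2 h = {v. set_borel_measurable lebesgue triangle v \<and>
               set_integrable lebesgue triangle (\<lambda>z. h z * (v z)\<^sup>2)}"

definition w_inner ::
    "(real \<times> real \<Rightarrow> real) \<Rightarrow> (real \<times> real \<Rightarrow> real) \<Rightarrow> (real \<times> real \<Rightarrow> real) \<Rightarrow> real" where
  "w_inner h u v = (LINT z:triangle|lebesgue. h z * u z * v z)"

primrec Ck :: "nat \<Rightarrow> ('a::real_normed_vector \<Rightarrow> 'b::real_normed_vector) \<Rightarrow> bool" where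
  "Ck 0 f \<longleftrightarrow> continuous_on UNIV f"
| "Ck (Suc n) f \<longleftrightarrow> f differentiable_on UNIV \<and> (\<forall>v. Ck n (\<lambda>x. frechet_derivative f (at x) v))"

definition test_function :: "(real \<times> real) set \<Rightarrow> (real \<times> real \<Rightarrow> real) \<Rightarrow> bool" where
  "test_function \<Omega> \<phi> \<longleftrightarrow>
     (\<forall>n. Ck n \<phi>) \<and> compact (closure {z. \<phi> z \<noteq> 0}) \<and> closure {z. \<phi> z \<noteq> 0} \<subseteq> \<Omega>"

definition partial_x :: "(real \<times> real \<Rightarrow> real) \<Rightarrow> real \<times> real \<Rightarrow> real" where
  "partial_x f z = frechet_derivative f (at z) (1, 0)"

definition partial_y :: "(real \<times> real \<Rightarrow> real) \<Rightarrow> real \<times> real \<Rightarrow> real" where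
  "partial_y f z = frechet_derivative f (at z) (0, 1)"

definition locally_integrable_on :: "(real \<times> real \<Rightarrow> real) \<Rightarrow> (real \<times> real) set \<Rightarrow> bool" where
  "locally_integrable_on v \<Omega> \<longleftrightarrow> (\<forall>K. compact K \<and> K \<subseteq> \<Omega> \<longrightarrow> set_integrable lebesgue K v)"

text \<open>\<open>g\<close> is the distributional derivative of \<open>v\<close> on the open set \<open>\<Omega>\<close> for the multi-index
  \<open>(i, j)\<close>.\<close>

definition is_distr_deriv ::
    "(real \<times> real) set \<Rightarrow> nat \<Rightarrow> nat \<Rightarrow> (real \<times> real \<Rightarrow> real) \<Rightarrow> (real \<times> real \<Rightarrow> real) \<Rightarrow> bool" where
  "is_distr_deriv \<Omega> i j v g \<longleftrightarrow>
     locally_integrable_on v \<Omega> \<and> locally_integrable_on g \<Omega> \<and>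
     (\<forall>\<phi>. test_function \<Omega> \<phi> \<longrightarrow>
        (LINT z:\<Omega>|lebesgue. v z * (partial_x ^^ i) ((partial_y ^^ j) \<phi>) z) =
        (- 1) ^ (i + j) * (LINT z:\<Omega>|lebesgue. g z * \<phi> z))"

definition wSobolev :: "nat \<Rightarrow> (real \<times> real \<Rightarrow> real) \<Rightarrow> (real \<times> real \<Rightarrow> real) set" where
  "wSobolev m h = {v \<in> wL2 h.
     \<forall>i j. i + j \<le> m \<longrightarrow> (\<exists>g \<in> wL2 h. is_distr_deriv (interior triangle) i j v g)}"


subsection \<open>Modal filters\<close>

text \<open>Derivatives relative to \<open>S\<close>, hence one-sided at end points of an interval.\<close>

primrec nderiv_within :: "real set \<Rightarrow> nat \<Rightarrow> (real \<Rightarrow> real) \<Rightarrow> real \<Rightarrow> real" where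
  "nderiv_within S 0 f = f"
| "nderiv_within S (Suc n) f = (\<lambda>x. vector_derivative (nderiv_within S n f) (at x within S))"

definition Ck_on :: "nat \<Rightarrow> real set \<Rightarrow> (real \<Rightarrow> real) \<Rightarrow> bool" where
  "Ck_on n S f \<longleftrightarrow> (\<forall>j<n. nderiv_within S j f differentiable_on S) \<and>
                  (\<forall>j\<le>n. continuous_on S (nderiv_within S j f))"

definition modal_filter :: "nat \<Rightarrow> (real \<Rightarrow> real) \<Rightarrow> bool" where
  "modal_filter r \<sigma> \<longleftrightarrow> 1 \<le> r \<and> Ck_on (r - 1) {0..1} \<sigma> \<and> \<sigma> 0 = 1 \<and>
     (\<forall>j. 1 \<le> j \<and> j \<le> r - 1 \<longrightarrow> nderiv_within {0..1} j \<sigma> 0 = 0)"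


subsection \<open>Jacobi and Appell-Proriol-Koornwinder polynomials\<close>

text \<open>Szegoe's explicit form of the Jacobi polynomial, with the standard normalization
  \<open>jacobi n a b 1 = (n + a gchoose n)\<close>.\<close>

definition jacobi :: "nat \<Rightarrow> real \<Rightarrow> real \<Rightarrow> real \<Rightarrow> real" where
  "jacobi n a b z = (\<Sum>s\<le>n. ((real n + a) gchoose (n - s)) * ((real n + b) gchoose s) *
                            ((z - 1) / 2) ^ s * ((z + 1) / 2) ^ (n - s))"

lemma jacobi_1: "jacobi n a b 1 = (real n + a) gchoose n"
proof -
  have "jacobi n a b 1 = (\<Sum>s\<le>n. if s = 0 then (real n + a) gchoose n else 0)"
    unfolding jacobi_def by (intro sum.cong) auto
  then show ?thesis by simp
qed

text \<open>The second factor is a polynomial in \<open>(x, y)\<close>; its value on the line \<open>x = 1\<close>, where the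
  quotient is not defined, is recovered as a limit. Lemma \<open>apk_eq_polynomial\<close> gives the resulting
  polynomial.\<close>

definition apk_factor :: "nat \<Rightarrow> nat \<Rightarrow> nat \<Rightarrow> real \<Rightarrow> real \<Rightarrow> real" where
  "apk_factor \<beta> p l x y = jacobi l (real p) (real \<beta> - 1) (2 * y / (1 - x) - 1) * (1 - x) ^ l"

definition apk :: "nat \<Rightarrow> nat \<Rightarrow> nat \<Rightarrow> nat \<Rightarrow> nat \<Rightarrow> real \<times> real \<Rightarrow> real" where
  "apk \<alpha> \<beta> p m l = (\<lambda>(x, y).
     jacobi m (real \<alpha> - 1) (real (p + \<beta> + 2 * l)) (1 - 2 * x) *
     (if x = 1 then Lim (at 1) (\<lambda>t. apk_factor \<beta> p l t y) else apk_factor \<beta> p l x y))"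

lemma apk_factor_eq_polynomial:
  assumes "x \<noteq> 1"
  shows "apk_factor \<beta> p l x y =
    (\<Sum>s\<le>l. ((real l + real p) gchoose (l - s)) * ((real l + (real \<beta> - 1)) gchoose s) *
            (x + y - 1) ^ s * y ^ (l - s))"
proof -
  have "(((2 * y / (1 - x) - 1) - 1) / 2) ^ s * (((2 * y / (1 - x) - 1) + 1) / 2) ^ (l - s) * (1 - x) ^ l
      = (x + y - 1) ^ s * y ^ (l - s)" if "s \<le> l" for s
  proof -
    have 1: "((2 * y / (1 - x) - 1) - 1) / 2 = (x + y - 1) / (1 - x)"
      and 2: "((2 * y / (1 - x) - 1) + 1) / 2 = y / (1 - x)"
      using assms by (simp_all add: field_simps)
    have 3: "(1 - x) ^ l = (1 - x) ^ s * (1 - x) ^ (l - s)"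
      using that by (simp flip: power_add)
    show ?thesis
      unfolding 1 2 3 using assms by (simp add: power_divide)
  qed
  then show ?thesis
    unfolding apk_factor_def jacobi_def sum_distrib_right
    by (intro sum.cong) (auto simp: mult.assoc)
qed

lemma apk_eq_polynomial:
  "apk \<alpha> \<beta> p m l (x, y) =
     jacobi m (real \<alpha> - 1) (real (p + \<beta> + 2 * l)) (1 - 2 * x) *
     (\<Sum>s\<le>l. ((real l + real p) gchoose (l - s)) * ((real l + (real \<beta> - 1)) gchoose s) *
            (x + y - 1) ^ s * y ^ (l - s))"
proof (cases "x = 1")
  case True
  let ?q = "\<lambda>x. \<Sum>s\<le>l. ((real l + real p) gchoose (l - s)) * ((real l + (real \<beta> - 1)) gchoose s) *
            (x + y - 1) ^ s * y ^ (l - s)"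
  have "(?q \<longlongrightarrow> ?q 1) (at 1)"
    by (intro tendsto_intros)
  then have "((\<lambda>t. apk_factor \<beta> p l t y) \<longlongrightarrow> ?q 1) (at 1)"
    by (rule Lim_transform_eventually)
       (auto simp: eventually_at_filter apk_factor_eq_polynomial)
  then have "Lim (at 1) (\<lambda>t. apk_factor \<beta> p l t y) = ?q 1"
    by (intro tendsto_Lim) auto
  then show ?thesis using True by (simp add: apk_def)
next
  case False
  then show ?thesis by (simp add: apk_def apk_factor_eq_polynomial)
qed


subsection \<open>Filtered partial sums\<close>

definition apk_coeff ::
    "nat \<Rightarrow> nat \<Rightarrow> nat \<Rightarrow> (real \<times> real \<Rightarrow> real) \<Rightarrow> nat \<Rightarrow> nat \<Rightarrow> real" where
  "apk_coeff \<alpha> \<beta> p u m l =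
     w_inner (tri_weight \<alpha> \<beta> p) u (apk \<alpha> \<beta> p m l) /
     w_inner (tri_weight \<alpha> \<beta> p) (apk \<alpha> \<beta> p m l) (apk \<alpha> \<beta> p m l)"

definition filtered_sum ::
    "nat \<Rightarrow> nat \<Rightarrow> nat \<Rightarrow> (real \<Rightarrow> real) \<Rightarrow> (real \<times> real \<Rightarrow> real) \<Rightarrow> nat \<Rightarrow> real \<times> real \<Rightarrow> real" where
  "filtered_sum \<alpha> \<beta> p \<sigma> u N z =
     (\<Sum>(l, m) \<in> {(l, m). l + m \<le> N}.
        \<sigma> (real (l + m) / real N) * apk_coeff \<alpha> \<beta> p u m l * apk \<alpha> \<beta> p m l z)"

end

theory Submission
  imports Defs "HOL-Computational_Algebra.Polynomial"
begin

text \<open>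
  The APK polynomials of degree \<open>n\<close> are eigenfunctions, with eigenvalue \<open>- n (n + \<gamma>)\<close>, of a second
  order operator that is symmetric for the weight \<open>h\<close>. The operator is written as a sum over the
  three edge directions \<open>e\<close> of \<open>h\<^sup>-\<^sup>1 \<partial>\<^sub>e (h \<rho>\<^sub>e \<partial>\<^sub>e)\<close>, where \<open>\<rho>\<^sub>e\<close> is the product of the two barycentric
  coordinates that vary along \<open>e\<close>; since \<open>\<rho>\<^sub>e\<close> vanishes on the edges crossed by \<open>e\<close>, integration by
  parts has no boundary terms even for weak derivatives. Hence the \<open>k\<close>-th power of the operator moves
  onto \<open>u\<close>, and the part of the expansion of \<open>u\<close> in degrees at least \<open>a\<close> has norm \<open>O(a\<^sup>-\<^sup>2\<^sup>k)\<close>.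

  No asymptotics of Jacobi polynomials are needed. A polynomial \<open>P\<close> of degree \<open>n\<close> satisfies
  \<open>P(z)\<^sup>2 \<le> K n\<^sup>2\<^sup>s \<integral> h P\<^sup>2\<close> with an exponent \<open>s\<close> that depends on the position of \<open>z\<close>: on a parallelogram
  at \<open>z\<close> inside the triangle this reduces to two one-dimensional inequalities, which follow from explicit
  reproducing polynomials. Applied to the dyadic blocks \<open>2\<^sup>j \<le> n < 2\<^sup>j\<^sup>+\<^sup>1\<close> of
  the expansion of \<open>u - u\<^sub>N\<close>, on which the filter contributes a factor \<open>O(min 1 (2\<^sup>j / N)\<^sup>2\<^sup>k\<^sup>-\<^sup>1)\<close>, it gives
  a two-sided geometric sum peaked at \<open>2\<^sup>j = N\<close>, of size \<open>N\<^sup>s\<^sup>-\<^sup>2\<^sup>k\<close>.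
\<close>

section \<open>Point values of univariate polynomials\<close>

text \<open>The weight degenerates on the edges and \<open>u\<close> has only weak derivatives
  there, so no boundary values of derivatives are available. Identities for the operator are
  therefore tested against polynomials only, and point values of \<open>u\<close> enter through
  continuity alone: the expansion converges uniformly once the worst exponent \<open>M\<close> on
  the closed triangle is below \<open>2 * k\<close>, which the lower bound on \<open>k\<close>
  guarantees. The exponents stem from dimension one: for the squared value, an endpoint with weight
  t^a costs n^(2a+2), an interior point without weight costs n. Two directions add up, so a vertex
  costs two endpoint exponents, an open edge one of them plus 1, an interior point 2. The claimed
  rates lie slightly above half of these sums. The filter is of order 2k-1, one less than the decay
  2k of the coefficients. A block below N thus contributes 2^(j(s-1)) N^(1-2k), which is summed by
  its last term only if s > 1; the blocks above N need s < 2k. An interior point would sit at the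
  borderline s = 1, and the slack in its rate 7/4 avoids it.\<close>

text \<open>Pascal's rule: a difference of order n+1 is the difference of order n of a first
  difference. Both closed forms that follow are inductions on this.\<close>

lemma alternating_binomial_sum_Suc:
  fixes f :: "nat \<Rightarrow> real"
  shows "(\<Sum>s\<le>Suc n. (-1) ^ s * real (Suc n choose s) * f s) =
         (\<Sum>s\<le>n. (-1) ^ s * real (n choose s) * (f s - f (Suc s)))"
proof -
  have "(\<Sum>s\<le>Suc n. (-1) ^ s * real (Suc n choose s) * f s)
      = f 0 + (\<Sum>s\<le>n. (-1) ^ Suc s * real (n choose s) * f (Suc s))
            + (\<Sum>s\<le>n. (-1) ^ Suc s * real (n choose Suc s) * f (Suc s))"
    by (subst sum.atMost_Suc_shift) (simp add: algebra_simps sum.distrib sum_subtractf sum_negf)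
  also have "f 0 + (\<Sum>s\<le>n. (-1) ^ Suc s * real (n choose Suc s) * f (Suc s))
      = (\<Sum>s\<le>Suc n. (-1) ^ s * real (n choose s) * f s)"
    by (subst sum.atMost_Suc_shift) simp
  hence "f 0 + (\<Sum>s\<le>n. (-1) ^ Suc s * real (n choose s) * f (Suc s))
            + (\<Sum>s\<le>n. (-1) ^ Suc s * real (n choose Suc s) * f (Suc s))
      = (\<Sum>s\<le>n. (-1) ^ s * real (n choose s) * f s) + (\<Sum>s\<le>n. (-1) ^ Suc s * real (n choose s) * f (Suc s))"
    by simp
  finally show ?thesis by (simp add: algebra_simps sum.distrib sum_negf sum_subtractf)
qed

text \<open>Each difference lowers the degree by one, so \<open>n\<close> of them annihilate degrees
  below \<open>n\<close>. The alternative \<open>q = 0\<close> is what remains at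
  \<open>n = 0\<close>.\<close>

lemma alternating_binomial_sum_poly:
  fixes q :: "real poly"
  assumes "degree q < n \<or> q = 0"
  shows "(\<Sum>s\<le>n. (-1) ^ s * real (n choose s) * poly q (real s)) = 0"
  using assms
proof (induction n arbitrary: q)
  case 0
  then show ?case by simp
next
  case (Suc n)
  let ?c = "pcompose q [:1, 1:]"
  define g where "g = q - ?c"
  have g: "degree g < n \<or> g = 0"
  proof (cases "degree q = 0")
    case True
    then obtain c where "q = [:c:]" by (meson degree_eq_zeroE)
    then show ?thesis by (simp add: g_def pcompose_const)
  next
    case False
    have d: "degree ?c = degree q" by (simp add: degree_pcompose)
    have l: "coeff ?c (degree q) = coeff q (degree q)"
      using lead_coeff_comp[of "[:1, 1:]" q] d by simp
    have "coeff g i = 0" if "i \<ge> degree q" for i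
      using that l d by (cases "i = degree q") (auto simp: g_def coeff_eq_0)
    hence "degree g \<le> degree q - 1"
      by (intro degree_le allI impI) (use False in auto)
    then show ?thesis using False Suc.prems by auto
  qed
  show ?case
    using Suc.IH[OF g] unfolding alternating_binomial_sum_Suc
    by (simp add: g_def poly_pcompose add.commute)
qed

text \<open>The partial fraction expansion of n! / (c (c+1) ... (c+n)). The first difference of 1 /
  (s + c) splits the sum into the same sums at \<open>c\<close> and \<open>c + 1\<close>.\<close>

lemma alternating_binomial_sum_inverse:
  fixes c :: real
  assumes "c > 0"
  shows "(\<Sum>s\<le>n. (-1) ^ s * real (n choose s) / (real s + c)) = fact n / (\<Prod>s\<le>n. c + real s)"
  using assms
proof (induction n arbitrary: c)
  case 0
  then show ?case by simp
next
  case (Suc n)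
  have pos: "(\<Prod>s\<le>n. c + real s) > 0" "(\<Prod>s\<le>n. c + 1 + real s) > 0"
    using Suc.prems by (auto intro!: prod_pos)
  have shift: "(\<Prod>s\<le>Suc n. c + real s) = c * (\<Prod>s\<le>n. c + 1 + real s)"
    by (subst prod.atMost_Suc_shift) (simp add: add_ac)
  have shift2: "(\<Prod>s\<le>Suc n. c + real s) = (\<Prod>s\<le>n. c + real s) * (c + real (Suc n))"
    by simp
  have "(\<Sum>s\<le>Suc n. (-1) ^ s * real (Suc n choose s) / (real s + c))
      = (\<Sum>s\<le>n. (-1) ^ s * real (n choose s) / (real s + c))
        - (\<Sum>s\<le>n. (-1) ^ s * real (n choose s) / (real s + (c + 1)))"
    using alternating_binomial_sum_Suc[of n "\<lambda>s. 1 / (real s + c)"]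
    by (simp add: right_diff_distrib sum_subtractf add_ac)
  also have "\<dots> = fact n / (\<Prod>s\<le>n. c + real s) - fact n / (\<Prod>s\<le>n. c + 1 + real s)"
    using Suc.IH[of c] Suc.IH[of "c + 1"] Suc.prems by simp
  also have "fact n / (\<Prod>s\<le>n. c + real s) = fact n * (c + real (Suc n)) / (\<Prod>s\<le>Suc n. c + real s)"
    using Suc.prems pos unfolding shift2 by simp
  also have "fact n / (\<Prod>s\<le>n. c + 1 + real s) = fact n * c / (\<Prod>s\<le>Suc n. c + real s)"
    using Suc.prems pos unfolding shift by simp
  finally show ?case by (simp add: diff_divide_distrib[symmetric] algebra_simps)
qed

text \<open>Each factor is at most exp (c / j), and 1 / (m + 1) \<le> ln (m + 1) - ln m makes the
  exponents telescope. The constant \<open>1 + c\<close> is the factor with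
  \<open>j = 1\<close>.\<close>

lemma prod_one_plus_le_powr:
  fixes c :: real
  assumes "c > 0" and "m \<ge> 1"
  shows "(\<Prod>j=1..m. 1 + c / real j) \<le> (1 + c) * real m powr c"
  using assms(2)
proof (induction m rule: nat_induct_at_least)
  case base
  then show ?case by simp
next
  case (Suc m)
  have "1 / real (Suc m) \<le> ln (real (Suc m)) - ln (real m)"
  proof -
    have "ln (real m / real (Suc m)) \<le> real m / real (Suc m) - 1"
      using Suc.hyps by (intro ln_le_minus_one) auto
    thus ?thesis using Suc.hyps by (simp add: ln_div field_simps)
  qed
  hence "c / real (Suc m) \<le> c * (ln (real (Suc m)) - ln (real m))"
    using mult_left_mono[of "1 / real (Suc m)" _ c] assms(1) by simp
  hence "exp (c / real (Suc m)) \<le> exp (c * ln (real (Suc m))) / exp (c * ln (real m))"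
    by (simp add: exp_diff[symmetric] right_diff_distrib)
  hence "1 + c / real (Suc m) \<le> real (Suc m) powr c / real m powr c"
    using Suc.hyps order.trans[OF exp_ge_add_one_self[of "c / real (Suc m)"]] by (simp add: powr_def)
  hence "(\<Prod>j=1..m. 1 + c / real j) * (1 + c / real (Suc m))
      \<le> ((1 + c) * real m powr c) * (real (Suc m) powr c / real m powr c)"
    using assms(1) Suc.IH by (intro mult_mono) (auto intro!: prod_nonneg)
  then show ?case using Suc.hyps by simp
qed

text \<open>The moments of \<open>J\<close> are those of \<open>t powr a\<close> on the unit interval. The polynomial \<open>Q\<close> below
  reproduces the value at \<open>0\<close> up to a factor: \<open>J (Q * p) = \<kappa> * p 0\<close> for \<open>degree p \<le> m\<close>.\<close>

lemma point_value_le_moment_functional: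
  fixes J :: "real poly \<Rightarrow> real" and a :: real
  assumes a: "a > -1"
    and add: "\<And>p q. J (p + q) = J p + J q"
    and smult: "\<And>c p. J (smult c p) = c * J p"
    and mon: "\<And>i. J (monom 1 i) = 1 / (real i + a + 1)"
    and pos: "\<And>p. J (p * p) \<ge> 0"
    and deg: "degree p \<le> m" and m: "m \<ge> 1"
  shows "(poly p 0)\<^sup>2 \<le> (a + 1) * (a + 2)\<^sup>2 * real m powr (2 * a + 2) * J (p * p)"
proof -
  \<comment> \<open>Up to scaling, \<open>Q\<close> is the Jacobi polynomial shifted to the unit
    interval for the weight t^(a+1): vanishing of \<open>J (Q * t * f)\<close> for lower degrees is
    orthogonality with respect to that weight.\<close>
  define w where "w s = (\<Prod>j<m. real s + real j + a + 2)" for s :: nat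
  define q where "q s = (-1) ^ s * real (m choose s) * w s" for s :: nat
  define Q where "Q = (\<Sum>s\<le>m. monom (q s) s)"
  define \<kappa> where "\<kappa> = (fact m)\<^sup>2 / (\<Prod>s\<le>m. a + 1 + real s)"
  have J0: "J 0 = 0" using smult[of 0 0] by simp
  have Jsum: "J (\<Sum>i\<in>A. F i) = (\<Sum>i\<in>A. J (F i))" for A and F :: "nat \<Rightarrow> real poly"
    by (induction A rule: infinite_finite_induct) (auto simp: J0 add)
  have Jmon: "J (monom c i) = c / (real i + a + 1)" for c i
    using smult[of c "monom 1 i"] mon[of i] by (simp add: smult_monom)
  have JQmon: "J (Q * monom 1 i) = (\<Sum>s\<le>m. q s / (real s + real i + a + 1))" for i
    unfolding Q_def by (simp add: sum_distrib_right Jsum mult_monom Jmon)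
  \<comment> \<open>The factor \<open>s + j + a + 2\<close> of \<open>w s\<close> is the denominator
    of the moment of order \<open>j + 1\<close>. What remains after cancelling has degree below
    \<open>m\<close> in \<open>s\<close>.\<close>
  have vanish: "J (Q * monom 1 (Suc j)) = 0" if "j < m" for j
  proof -
    let ?r = "\<Prod>i\<in>{..<m} - {j}. [:real i + a + 2, 1:]"
    have "degree ?r \<le> (\<Sum>i\<in>{..<m} - {j}. 1)"
      by (rule order.trans[OF degree_prod_sum_le]) (auto intro: sum_mono)
    also have "\<dots> < m" using that by simp
    finally have d: "degree ?r < m" .
    have "q s / (real s + real (Suc j) + a + 1) = (-1) ^ s * real (m choose s) * poly ?r (real s)" for s
    proof -
      have "w s = (real s + real j + a + 2) * poly ?r (real s)"
        unfolding w_def using that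
        by (subst prod.remove[of _ j]) (auto simp: poly_prod add_ac intro!: prod.cong)
      moreover have "real s + real j + a + 2 > 0" using a by linarith
      ultimately show ?thesis by (simp add: q_def field_simps)
    qed
    thus ?thesis unfolding JQmon using alternating_binomial_sum_poly[of ?r m] d by simp
  qed
  have at0: "J (Q * monom 1 0) = \<kappa>"
  proof -
    let ?F = "\<Prod>j<m. [:real j + a + 2, 1:]"
    have dF: "degree ?F \<le> m"
      by (rule order.trans[OF degree_prod_sum_le]) (auto intro: order.trans[OF sum_mono[of _ _ "\<lambda>_. 1"]])
    \<comment> \<open>At \<open>s = - (a + 1)\<close>, the pole of the moment of order 0, the
      product \<open>w\<close> equals m!. Division with remainder leaves m! / (s + a + 1), which the
      partial fraction identity sums.\<close>
    have F0: "poly ?F (-(a + 1)) = fact m"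
    proof -
      have "poly ?F (-(a+1)) = (\<Prod>j<m. real (Suc j))"
        by (auto simp: poly_prod intro!: prod.cong)
      also have "\<dots> = fact m" 
        by (induction m) (auto simp: algebra_simps)
      finally show ?thesis .
    qed
    have "poly (?F - [:fact m:]) (-(a + 1)) = 0" using F0 by simp
    hence "[:a + 1, 1:] dvd ?F - [:fact m:]"
      unfolding poly_eq_0_iff_dvd by (simp add: add.commute)
    then obtain r where r: "?F - [:fact m:] = [:a + 1, 1:] * r"
      by (rule dvdE)
    have dr: "degree r < m \<or> r = 0"
    proof (rule ccontr)
      assume "\<not> ?thesis"
      hence "r \<noteq> 0" "degree r \<ge> m" by auto
      hence "degree ([:a + 1, 1:] * r) \<ge> Suc m" by (subst degree_mult_eq) auto
      moreover have "degree (?F - [:fact m:]) \<le> m" using dF by (intro degree_diff_le) auto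
      ultimately show False using r by simp
    qed
    have F: "w s = (real s + a + 1) * poly r (real s) + fact m" for s
    proof -
      have "w s = poly ?F (real s)" by (auto simp: w_def poly_prod add_ac intro!: prod.cong)
      also have "?F = [:a + 1, 1:] * r + [:fact m:]" using r by (simp add: algebra_simps)
      finally show ?thesis by (simp add: algebra_simps)
    qed
    have "q s / (real s + real 0 + a + 1)
        = (-1) ^ s * real (m choose s) * poly r (real s)
          + fact m * ((-1) ^ s * real (m choose s) / (real s + (a + 1)))" for s
    proof -
      have "real s + a + 1 > 0" using a by linarith
      thus ?thesis unfolding q_def F by (simp add: field_simps)
    qed
    hence "J (Q * monom 1 0) = (\<Sum>s\<le>m. (-1) ^ s * real (m choose s) * poly r (real s))
          + fact m * (\<Sum>s\<le>m. (-1) ^ s * real (m choose s) / (real s + (a + 1)))"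
      unfolding JQmon by (simp add: sum.distrib sum_distrib_left)
    also have "\<dots> = \<kappa>"
      using alternating_binomial_sum_poly[OF dr] alternating_binomial_sum_inverse[of "a + 1" m] a
      by (simp add: \<kappa>_def power2_eq_square)
    finally show ?thesis .
  qed
  have repr: "J (Q * f) = \<kappa> * poly f 0" if "degree f \<le> m" for f
  proof -
    have f: "f = (\<Sum>i\<le>m. smult (coeff f i) (monom 1 i))"
      using poly_as_sum_of_monoms'[OF that] by (simp add: smult_monom)
    have "J (Q * f) = (\<Sum>i\<le>m. coeff f i * J (Q * monom 1 i))"
      by (subst f) (simp add: sum_distrib_left Jsum smult)
    also have "\<dots> = (\<Sum>i\<le>m. if i = 0 then coeff f 0 * \<kappa> else 0)"
    proof (rule sum.cong, goal_cases)
      case (2 i)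
      thus ?case using at0 vanish[of "i - 1"] by (cases i) auto
    qed auto
    finally show ?thesis by (simp add: poly_0_coeff_0 mult.commute)
  qed
  have dQ: "degree Q \<le> m" unfolding Q_def
    by (intro degree_sum_le) (auto intro: order.trans[OF degree_monom_le])
  have Q0: "poly Q 0 = w 0"
  proof -
    have "poly Q 0 = (\<Sum>s\<le>m. if s = 0 then q 0 else 0)"
      unfolding Q_def by (auto simp: poly_sum poly_monom intro!: sum.cong)
    thus ?thesis by (simp add: q_def)
  qed
  have w0: "w 0 > 0" unfolding w_def using a by (intro prod_pos) auto
  have P: "(\<Prod>s\<le>m. a + 1 + real s) > 0" using a by (intro prod_pos) auto
  have \<kappa>: "\<kappa> > 0" unfolding \<kappa>_def using P by simp
  \<comment> \<open>The minimiser of \<open>J ((p - t Q)^2)\<close>: the estimate is the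
    Cauchy-Schwarz inequality for the form \<open>J\<close>, with \<open>Q\<close> in the second
    slot.\<close>
  define t where "t = poly p 0 / w 0"
  have Jneg: "J (- f) = - J f" for f using smult[of "-1" f] by simp
  have Jdiff: "J (f - g) = J f - J g" for f g using add[of f "- g"] Jneg[of g] by simp
  have "0 \<le> J ((p - smult t Q) * (p - smult t Q))" by (rule pos)
  also have "(p - smult t Q) * (p - smult t Q) = p * p + (smult (-2 * t) (Q * p) + smult (t\<^sup>2) (Q * Q))"
    by (simp add: algebra_simps power2_eq_square smult_add_left[symmetric] flip: smult_smult)
  also have "J \<dots> = J (p * p) - 2 * t * (\<kappa> * poly p 0) + t\<^sup>2 * (\<kappa> * w 0)"
    by (simp add: add smult Jdiff repr deg dQ Q0)
  also have "\<dots> = J (p * p) - (poly p 0)\<^sup>2 * (\<kappa> / w 0)"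
    using w0 by (simp add: t_def field_simps power2_eq_square)
  finally have "(poly p 0)\<^sup>2 \<le> (w 0 / \<kappa>) * J (p * p)"
    using w0 \<kappa> by (simp add: field_simps)
  also have "w 0 / \<kappa> = (a + 1) * (\<Prod>j=1..m. 1 + (a + 1) / real j)\<^sup>2"
  proof -
    have A: "(\<Prod>j=1..m. 1 + (a + 1) / real j) = w 0 / fact m"
    proof -
      have "(\<Prod>j=1..m. 1 + (a + 1) / real j) = (\<Prod>j<m. 1 + (a + 1) / real (Suc j))"
        by (rule prod.reindex_bij_witness[of _ Suc "\<lambda>j. j - 1"]) auto
      also have "\<dots> = (\<Prod>j<m. (real 0 + real j + a + 2) / real (Suc j))"
        by (intro prod.cong) (auto simp: field_simps)
      also have "\<dots> = w 0 / (\<Prod>j<m. real (Suc j))" by (simp add: w_def prod_dividef)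
      also have "(\<Prod>j<m. real (Suc j)) = fact m"
        by (induction m) (auto simp: algebra_simps)
      finally show ?thesis .
    qed
    have B: "(\<Prod>s\<le>m. a + 1 + real s) = (a + 1) * w 0"
    proof -
      have "(\<Prod>s\<le>m. a + 1 + real s) = (a + 1) * (\<Prod>s<m. a + 1 + real (Suc s))"
        unfolding lessThan_Suc_atMost[symmetric] by (subst prod.lessThan_Suc_shift) simp
      thus ?thesis by (simp add: w_def add_ac)
    qed
    show ?thesis unfolding A \<kappa>_def B by (simp add: power2_eq_square)
  qed
  also have "\<dots> \<le> (a + 1) * ((1 + (a + 1)) * real m powr (a + 1))\<^sup>2"
    using a m by (intro mult_left_mono power_mono prod_one_plus_le_powr prod_nonneg) auto
  also have "\<dots> = (a + 1) * (a + 2)\<^sup>2 * real m powr (2 * a + 2)"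
    by (simp add: power_mult_distrib power2_eq_square powr_add[symmetric] algebra_simps)
  finally show ?thesis using pos[of p] by (simp add: mult_right_mono)
qed


section \<open>One-dimensional bounds for the value at 0\<close>

lemma borel_measurable_poly [measurable]:
  fixes p :: "real poly"
  shows "poly p \<in> borel_measurable borel"
  by (intro borel_measurable_continuous_onI continuous_intros)

text \<open>Nonnegative extended integrals allow bounds to be compared and iterated without
  integrability conditions. \<open>r\<close> is the exponent for the squared value, and the constant
  is uniform in the degree and the polynomial.\<close>

definition point_bound :: "(real \<Rightarrow> real) \<Rightarrow> real \<Rightarrow> bool" where
  "point_bound w r \<longleftrightarrow> w \<in> borel_measurable borel \<and> (\<exists>C\<ge>0. \<forall>m\<ge>1. \<forall>p. degree p \<le> m \<longrightarrow>
     ennreal ((poly p 0)\<^sup>2) \<le>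
       ennreal (C * real m powr r) * (\<integral>\<^sup>+t. ennreal (w t * (poly p t)\<^sup>2) \<partial>lborel))"

lemma point_bound_mono:
  assumes "point_bound w r" and "w' \<in> borel_measurable borel"
    and "c \<ge> 0" and "\<And>t. w t \<le> c * w' t"
  shows "point_bound w' r"
proof -
  obtain C where C: "C \<ge> 0" "\<And>m p. m \<ge> 1 \<Longrightarrow> degree p \<le> m \<Longrightarrow>
     ennreal ((poly p 0)\<^sup>2) \<le> ennreal (C * real m powr r) * (\<integral>\<^sup>+t. ennreal (w t * (poly p t)\<^sup>2) \<partial>lborel)"
    using assms(1) unfolding point_bound_def by blast
  have "ennreal ((poly p 0)\<^sup>2) \<le>
      ennreal (C * c * real m powr r) * (\<integral>\<^sup>+t. ennreal (w' t * (poly p t)\<^sup>2) \<partial>lborel)"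
    if "m \<ge> 1" "degree p \<le> m" for m p
  proof -
    have "(\<integral>\<^sup>+t. ennreal (w t * (poly p t)\<^sup>2) \<partial>lborel)
        \<le> (\<integral>\<^sup>+t. ennreal c * ennreal (w' t * (poly p t)\<^sup>2) \<partial>lborel)"
    proof (rule nn_integral_mono)
      fix t
      have "w t * (poly p t)\<^sup>2 \<le> c * (w' t * (poly p t)\<^sup>2)"
        using mult_right_mono[OF assms(4)[of t], of "(poly p t)\<^sup>2"] by (simp add: mult.assoc)
      thus "ennreal (w t * (poly p t)\<^sup>2) \<le> ennreal c * ennreal (w' t * (poly p t)\<^sup>2)"
        using assms(3) by (simp add: ennreal_mult'[symmetric] ennreal_leI)
    qed
    also have "\<dots> = ennreal c * (\<integral>\<^sup>+t. ennreal (w' t * (poly p t)\<^sup>2) \<partial>lborel)"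
      using assms(2) by (intro nn_integral_cmult) auto
    finally have "ennreal ((poly p 0)\<^sup>2) \<le> ennreal (C * real m powr r) *
        (ennreal c * (\<integral>\<^sup>+t. ennreal (w' t * (poly p t)\<^sup>2) \<partial>lborel))"
      using C(2)[OF that] by (meson mult_left_mono order.trans zero_le)
    also have "\<dots> = ennreal (C * c * real m powr r) * (\<integral>\<^sup>+t. ennreal (w' t * (poly p t)\<^sup>2) \<partial>lborel)"
      using C(1) assms(3) by (simp add: ennreal_mult' mult_ac)
    finally show ?thesis .
  qed
  thus ?thesis unfolding point_bound_def using assms(2,3) C(1)
    by (intro conjI exI[of _ "C * c"]) auto
qed

text \<open>A dilation fixes 0 and does not raise the degree; its Jacobian goes into the
  constant.\<close>

lemma point_bound_scale:
  assumes "point_bound w r" and d: "d > 0"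
  shows "point_bound (\<lambda>t. w (t / d)) r"
proof -
  obtain C where C: "C \<ge> 0" "\<And>m p. m \<ge> 1 \<Longrightarrow> degree p \<le> m \<Longrightarrow>
     ennreal ((poly p 0)\<^sup>2) \<le> ennreal (C * real m powr r) * (\<integral>\<^sup>+t. ennreal (w t * (poly p t)\<^sup>2) \<partial>lborel)"
    and w [measurable]: "w \<in> borel_measurable borel"
    using assms(1) unfolding point_bound_def by blast
  have "ennreal ((poly p 0)\<^sup>2) \<le>
      ennreal (C * (1 / d) * real m powr r) * (\<integral>\<^sup>+t. ennreal (w (t / d) * (poly p t)\<^sup>2) \<partial>lborel)"
    if "m \<ge> 1" "degree p \<le> m" for m p
  proof -
    let ?q = "pcompose p [:0, d:]"
    have "degree ?q \<le> m" using that by (simp add: degree_pcompose)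
    from C(2)[OF that(1) this]
    have "ennreal ((poly p 0)\<^sup>2) \<le> ennreal (C * real m powr r) *
        (\<integral>\<^sup>+t. ennreal (w t * (poly p (d * t))\<^sup>2) \<partial>lborel)"
      by (simp add: poly_pcompose mult.commute)
    moreover have "(\<integral>\<^sup>+t. ennreal (w (t / d) * (poly p t)\<^sup>2) \<partial>lborel) =
        ennreal d * (\<integral>\<^sup>+t. ennreal (w t * (poly p (d * t))\<^sup>2) \<partial>lborel)"
      using d by (subst nn_integral_real_affine[where c = d and t = 0]) auto
    moreover have "ennreal (C * (1 / d) * real m powr r) * (ennreal d * X) = ennreal (C * real m powr r) * X" for X
      using d C(1) by (simp add: mult.assoc[symmetric] ennreal_mult'[symmetric])
    ultimately show ?thesis by simp
  qed
  thus ?thesis unfolding point_bound_def using d C(1)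
    by (intro conjI exI[of _ "C * (1 / d)"]) auto
qed

lemma nn_integral_Icc_eq_integral:
  fixes f :: "real \<Rightarrow> real"
  assumes "continuous_on UNIV f" and "\<And>x. x \<in> {a..b} \<Longrightarrow> f x \<ge> 0"
  shows "(\<integral>\<^sup>+x. ennreal (indicator {a..b} x * f x) \<partial>lborel) = ennreal (integral {a..b} f)"
proof -
  have "continuous_on {a..b} f" using assms(1) continuous_on_subset by blast
  hence i: "f integrable_on {a..b}" by (rule integrable_continuous_real)
  have "((\<lambda>x. indicator {a..b} x * f x) has_integral integral {a..b} f) UNIV"
    using integrable_integral[OF i] has_integral_restrict_UNIV[of "{a..b}" f]
    by (simp add: indicator_times_eq_if)
  moreover have [measurable]: "f \<in> borel_measurable borel"
    using assms(1) by (rule borel_measurable_continuous_onI)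
  ultimately show ?thesis
    using assms(2) by (intro nn_integral_has_integral_lborel) (auto simp: indicator_def)
qed

text \<open>On the unit interval the moments of t^a are exactly those required of \<open>J\<close>.
  The passage to length \<open>d\<close> costs a factor (1 / d)^a.\<close>

lemma point_bound_power_weight:
  assumes d: "d > 0"
  shows "point_bound (\<lambda>t. indicator {0..d} t * t ^ a) (2 * real a + 2)"
proof -
  define J :: "real poly \<Rightarrow> real" where "J p = integral {0..1} (\<lambda>t. t ^ a * poly p t)" for p
  have cont: "continuous_on A (\<lambda>t. t ^ a * poly p t)" for A and p :: "real poly"
    by (intro continuous_intros)
  have int: "(\<lambda>t. t ^ a * poly p t) integrable_on {0..1}" for p :: "real poly"
    by (intro integrable_continuous_real cont)
  have mon: "J (monom 1 i) = 1 / (real i + real a + 1)" for i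
  proof -
    have "((\<lambda>t::real. t ^ (a + i)) has_integral (1 ^ Suc (a + i) / real (Suc (a + i)) - 0 ^ Suc (a + i) / real (Suc (a + i)))) {0..1}"
      by (intro fundamental_theorem_of_calculus)
         (auto intro!: derivative_eq_intros simp: has_real_derivative_iff_has_vector_derivative[symmetric] simp del: power_Suc of_nat_Suc)
    thus ?thesis by (simp add: J_def poly_monom power_add[symmetric] integral_unique add_ac)
  qed
  have J_ev: "ennreal ((poly p 0)\<^sup>2) \<le> ennreal (((real a + 1) * (real a + 2)\<^sup>2) * real m powr (2 * real a + 2)) *
      (\<integral>\<^sup>+t. ennreal (indicator {0..1} t * t ^ a * (poly p t)\<^sup>2) \<partial>lborel)" if "m \<ge> 1" "degree p \<le> m" for m p
  proof -
    have pos: "J (p * p) \<ge> 0" for p unfolding J_def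
      by (intro integral_nonneg int) auto
    have "(poly p 0)\<^sup>2 \<le> (real a + 1) * (real a + 2)\<^sup>2 * real m powr (2 * real a + 2) * J (p * p)"
    proof (rule point_value_le_moment_functional)
      show "J (p + q) = J p + J q" for p q
        using int by (simp add: J_def distrib_left integral_add)
      show "J (smult c p) = c * J p" for c p
        unfolding J_def integral_mult_right[symmetric] by (simp add: mult_ac)
    qed (use that mon pos in auto)
    hence "ennreal ((poly p 0)\<^sup>2) \<le> ennreal ((real a + 1) * (real a + 2)\<^sup>2 * real m powr (2 * real a + 2)) * ennreal (J (p * p))"
      using pos by (simp add: ennreal_mult'[symmetric] ennreal_leI)
    also have "ennreal (J (p * p)) = (\<integral>\<^sup>+t. ennreal (indicator {0..1} t * (t ^ a * poly (p * p) t)) \<partial>lborel)"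
      unfolding J_def by (subst nn_integral_Icc_eq_integral[OF cont]) auto
    finally show ?thesis by (simp add: power2_eq_square mult.assoc)
  qed
  have "point_bound (\<lambda>t. indicator {0..1} t * t ^ a) (2 * real a + 2)"
    unfolding point_bound_def using J_ev
    by (intro conjI exI[of _ "(real a + 1) * (real a + 2)\<^sup>2"]) auto
  from point_bound_scale[OF this d] show ?thesis
  proof (rule point_bound_mono)
    show "(1 / d) ^ a \<ge> 0" using d by simp
    show "indicator {0..1} (t / d) * (t / d) ^ a \<le> (1 / d) ^ a * (indicator {0..d} t * t ^ a)" for t
      using d by (auto simp: indicator_def power_divide divide_simps split: if_splits)
  qed auto
qed

text \<open>For c + x p the roles are exchanged: the even part of p becomes the odd part, and the
  odd part of p, multiplied by x^2 and shifted by c, becomes the even part. The degree bound is an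
  implication inside the existential so that the induction hypothesis applies before any degree is
  known.\<close>

lemma poly_even_odd_parts:
  fixes p :: "real poly"
  shows "\<exists>g h. (degree p \<le> n \<longrightarrow> degree g \<le> n \<and> degree h \<le> n) \<and> (\<forall>x. poly p x = poly g (x\<^sup>2) + x * poly h (x\<^sup>2))"
proof (induction p arbitrary: n)
  case 0
  show ?case by (intro exI[of _ 0]) auto
next
  case (pCons c p)
  obtain g h where gh: "degree p \<le> n - 1 \<longrightarrow> degree g \<le> n - 1 \<and> degree h \<le> n - 1"
    "\<And>x. poly p x = poly g (x\<^sup>2) + x * poly h (x\<^sup>2)"
    using pCons.IH[of "n - 1"] by blast
  show ?case
  proof (cases "p = 0")
    case True
    thus ?thesis by (intro exI[of _ "[:c:]"] exI[of _ 0]) auto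
  next
    case False
    show ?thesis
    proof (intro exI conjI allI impI)
      assume "degree (pCons c p) \<le> n"
      hence "degree p \<le> n - 1" "n \<ge> 1" using False by auto
      thus "degree (pCons c h) \<le> n" "degree g \<le> n"
        using gh(1) degree_pCons_le[of c h] by auto
    next
      fix x
      show "poly (pCons c p) x = poly (pCons c h) (x\<^sup>2) + x * poly g (x\<^sup>2)"
        by (simp add: gh(2) algebra_simps power2_eq_square)
    qed
  qed
qed

text \<open>The even part \<open>g (x\<^sup>2)\<close> of a polynomial reduces the unweighted two-sided bound to the moment
  functional with \<open>a = -1/2\<close>.\<close>

lemma point_bound_two_sided:
  assumes d: "d > 0"
  shows "point_bound (\<lambda>t. indicator {-d..d} t * 1) 1"
proof -
  define J :: "real poly \<Rightarrow> real" where "J p = 2 * integral {0..1} (\<lambda>t. poly p (t\<^sup>2))" for p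
  have cont: "continuous_on A (\<lambda>t. poly p (t\<^sup>2))" for A and p :: "real poly"
    by (intro continuous_intros)
  have int: "(\<lambda>t. poly p (t\<^sup>2)) integrable_on {0..1}" for p :: "real poly"
    by (intro integrable_continuous_real cont)
  have mon: "J (monom 1 i) = 1 / (real i + (- 1/2) + 1)" for i
  proof -
    have "((\<lambda>t::real. t ^ (2 * i)) has_integral (1 ^ Suc (2 * i) / real (Suc (2 * i)) - 0 ^ Suc (2 * i) / real (Suc (2 * i)))) {0..1}"
      by (intro fundamental_theorem_of_calculus)
         (auto intro!: derivative_eq_intros simp: has_real_derivative_iff_has_vector_derivative[symmetric] simp del: power_Suc of_nat_Suc)
    thus ?thesis by (simp add: J_def poly_monom power_mult[symmetric] integral_unique field_simps)
  qed
  have pos: "J (p * p) \<ge> 0" for p unfolding J_def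
    by (intro mult_nonneg_nonneg integral_nonneg int) auto
  have "ennreal ((poly p 0)\<^sup>2) \<le> ennreal (9 / 4 * real m powr 1) *
      (\<integral>\<^sup>+t. ennreal (indicator {-1..1} t * (poly p t)\<^sup>2) \<partial>lborel)" if m: "m \<ge> 1" "degree p \<le> m" for m p
  proof -
    obtain g h where gh: "degree g \<le> m" "\<And>x. poly p x = poly g (x\<^sup>2) + x * poly h (x\<^sup>2)"
      using poly_even_odd_parts[of p m] m by blast
    have "(poly g 0)\<^sup>2 \<le> (- 1/2 + 1) * (- 1/2 + 2)\<^sup>2 * real m powr (2 * (- 1/2) + 2) * J (g * g)"
    proof (rule point_value_le_moment_functional)
      show "J (p + q) = J p + J q" for p q
        using int by (simp add: J_def distrib_left integral_add)
      show "J (smult c p) = c * J p" for c p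
        unfolding J_def by (simp add: mult_ac)
    qed (use gh m mon pos in auto)
    \<comment> \<open>At a = -1/2 the constant (a + 1) (a + 2)^2 is 9/8; the factor 2 in the
      definition of \<open>J\<close> turns it into 9/4.\<close>
    hence "(poly p 0)\<^sup>2 \<le> 9 / 4 * real m powr 1 * (J (g * g) / 2)"
      using gh(2)[of 0] by (simp add: power2_eq_square)
    hence "ennreal ((poly p 0)\<^sup>2) \<le> ennreal (9 / 4 * real m powr 1 * (J (g * g) / 2))"
      by (rule ennreal_leI)
    also have "\<dots> = ennreal (9 / 4 * real m powr 1) * ennreal (J (g * g) / 2)"
      using pos[of g] by (intro ennreal_mult) auto
    also have "ennreal (J (g * g) / 2) \<le> (\<integral>\<^sup>+t. ennreal (indicator {-1..1} t * (poly p t)\<^sup>2) \<partial>lborel)" (is "_ \<le> ?I")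
    proof -
      have "ennreal (J (g * g) / 2) = (\<integral>\<^sup>+t. ennreal (indicator {0..1} t * poly (g * g) (t\<^sup>2)) \<partial>lborel)"
        unfolding J_def by (subst nn_integral_Icc_eq_integral[OF cont]) auto
      hence "ennreal 2 * ennreal (J (g * g) / 2) = (\<integral>\<^sup>+t. ennreal 2 * ennreal (indicator {0..1} t * poly (g * g) (t\<^sup>2)) \<partial>lborel)"
        by (subst nn_integral_cmult) auto
      also have "\<dots> \<le> (\<integral>\<^sup>+t. ennreal (indicator {-1..1} t * (poly p t)\<^sup>2) + ennreal (indicator {-1..1} t * (poly p (- t))\<^sup>2) \<partial>lborel)"
      proof (rule nn_integral_mono)
        fix t :: real
        \<comment> \<open>Adding the values at t and -t removes the cross term between even and odd
          part; the square of the odd part is then dropped.\<close>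
        have "2 * (indicator {0..1} t * poly (g * g) (t\<^sup>2)) \<le> indicator {-1..1} t * (poly p t)\<^sup>2 + indicator {-1..1} t * (poly p (- t))\<^sup>2"
        proof (cases "t \<in> {0..1}")
          case True
          have "(poly p t)\<^sup>2 + (poly p (- t))\<^sup>2 = 2 * (poly g (t\<^sup>2))\<^sup>2 + 2 * (t * poly h (t\<^sup>2))\<^sup>2"
            by (simp add: gh(2) algebra_simps power2_eq_square)
          thus ?thesis using True by (simp add: power2_eq_square)
        qed (auto simp: indicator_def)
        thus "ennreal 2 * ennreal (indicator {0..1} t * poly (g * g) (t\<^sup>2)) \<le>
            ennreal (indicator {-1..1} t * (poly p t)\<^sup>2) + ennreal (indicator {-1..1} t * (poly p (- t))\<^sup>2)"
          by (subst ennreal_mult'[symmetric], simp)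
             (simp add: ennreal_plus[symmetric] ennreal_leI del: ennreal_plus poly_mult ennreal_mult'')
      qed
      also have "\<dots> = ?I + (\<integral>\<^sup>+t. ennreal (indicator {-1..1} t * (poly p (- t))\<^sup>2) \<partial>lborel)"
        by (intro nn_integral_add) auto
      also have "(\<integral>\<^sup>+t. ennreal (indicator {-1..1} t * (poly p (- t))\<^sup>2) \<partial>lborel) = ?I"
        by (subst (2) nn_integral_real_affine[where c = "-1" and t = 0]) (auto simp: indicator_def intro!: nn_integral_cong)
      finally have *: "ennreal 2 * ennreal (J (g * g) / 2) \<le> ennreal 2 * ?I"
        by (simp add: mult_2[symmetric])
      thus ?thesis by (subst (asm) ennreal_mult_le_mult_iff) auto
    qed
    finally show ?thesis by (simp add: mult_left_mono)
  qed
  hence "point_bound (\<lambda>t. indicator {-1..1} t) 1"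
    unfolding point_bound_def by (intro conjI exI[of _ "9 / 4"]) auto
  from point_bound_scale[OF this d] show ?thesis
  proof (rule point_bound_mono)
    show "(indicator {-1..1} (t / d) :: real) \<le> 1 * (indicator {-d..d} t * 1)" for t
      using d by (auto simp: indicator_def field_simps split: if_splits)
  qed auto
qed

text \<open>Turns uniform approximation of every accuracy \<open>e\<close> into an exact identity;
  \<open>x\<close> will be a squared inner product.\<close>

lemma nonpos_if_le_small_squares:
  fixes x D :: real
  assumes "\<And>e. e > 0 \<Longrightarrow> x \<le> e\<^sup>2 * D" shows "x \<le> 0"
proof -
  have "((\<lambda>e. e\<^sup>2 * D) \<longlongrightarrow> 0\<^sup>2 * D) (at_right 0)" by (intro tendsto_intros)
  moreover have "eventually (\<lambda>e. x \<le> e\<^sup>2 * D) (at_right 0)"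
    by (rule eventually_mono[OF eventually_at_right_real[of 0 1]]) (auto intro: assms)
  ultimately have "x \<le> 0\<^sup>2 * D" by (rule tendsto_lowerbound) simp
  thus ?thesis by simp
qed

section \<open>Polynomials and weighted spaces on the triangle\<close>

text \<open>Polynomials of degree less than \<open>n\<close>; in particular \<open>deg_less 0\<close> contains only the zero function.\<close>

inductive deg_less :: "nat \<Rightarrow> (real \<times> real \<Rightarrow> real) \<Rightarrow> bool" where
  deg_less_zero: "deg_less n (\<lambda>_. 0)"
| deg_less_const: "deg_less (Suc n) (\<lambda>_. c)"
| deg_less_fst: "deg_less n f \<Longrightarrow> deg_less (Suc n) (\<lambda>z. fst z * f z)"
| deg_less_snd: "deg_less n f \<Longrightarrow> deg_less (Suc n) (\<lambda>z. snd z * f z)"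
| deg_less_add: "deg_less n f \<Longrightarrow> deg_less n g \<Longrightarrow> deg_less n (\<lambda>z. f z + g z)"

lemma deg_less_0: "deg_less 0 f \<Longrightarrow> f = (\<lambda>_. 0)"
  by (induction "0::nat" f rule: deg_less.induct) auto

lemma deg_less_Suc: "deg_less n f \<Longrightarrow> deg_less (Suc n) f"
  by (induction n f rule: deg_less.induct) (auto intro: deg_less.intros)

lemma deg_less_mono: "deg_less n f \<Longrightarrow> n \<le> m \<Longrightarrow> deg_less m f"
proof (rotate_tac, induction m rule: dec_induct)
qed (auto intro: deg_less_Suc)

lemma deg_less_cmult: "deg_less n f \<Longrightarrow> deg_less n (\<lambda>z. c * f z)"
proof (induction n f rule: deg_less.induct)
  case (deg_less_const n d)
  show ?case by (rule deg_less.deg_less_const)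
next
  case (deg_less_fst n f)
  then show ?case using deg_less.deg_less_fst[of n "\<lambda>z. c * f z"] by (simp add: mult_ac)
next
  case (deg_less_snd n f)
  then show ?case using deg_less.deg_less_snd[of n "\<lambda>z. c * f z"] by (simp add: mult_ac)
next
  case (deg_less_add n f g)
  then show ?case using deg_less.deg_less_add[of n "\<lambda>z. c * f z" "\<lambda>z. c * g z"] by (simp add: distrib_left)
qed (auto intro: deg_less_zero)

lemma deg_less_uminus: "deg_less n f \<Longrightarrow> deg_less n (\<lambda>z. - f z)"
  using deg_less_cmult[of n f "-1"] by simp

lemma deg_less_diff: "deg_less n f \<Longrightarrow> deg_less n g \<Longrightarrow> deg_less n (\<lambda>z. f z - g z)"
  using deg_less_add[of n f "\<lambda>z. - g z"] deg_less_uminus by simp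

lemma deg_less_sum: "(\<And>i. i \<in> A \<Longrightarrow> deg_less n (f i)) \<Longrightarrow> deg_less n (\<lambda>z. \<Sum>i\<in>A. f i z)"
  by (induction A rule: infinite_finite_induct) (auto intro: deg_less_zero deg_less_add)

text \<open>A strict bound on one factor and a weak one on the other: at \<open>n = 0\<close> the
  first factor is zero, so \<open>n + m\<close> is correct without truncated subtraction.\<close>

lemma deg_less_mult: "deg_less n f \<Longrightarrow> deg_less (Suc m) g \<Longrightarrow> deg_less (n + m) (\<lambda>z. f z * g z)"
proof (induction n f rule: deg_less.induct)
  case (deg_less_const n c)
  then show ?case using deg_less_cmult deg_less_mono[of "Suc m" _ "Suc n + m"] by simp
next
  case (deg_less_fst n f)
  then show ?case using deg_less.deg_less_fst[of "n + m" "\<lambda>z. f z * g z"] by (simp add: mult_ac)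
next
  case (deg_less_snd n f)
  then show ?case using deg_less.deg_less_snd[of "n + m" "\<lambda>z. f z * g z"] by (simp add: mult_ac)
next
  case (deg_less_add n f h)
  then show ?case using deg_less.deg_less_add[of "n + m" "\<lambda>z. f z * g z" "\<lambda>z. h z * g z"] by (simp add: distrib_right)
qed (auto intro: deg_less_zero)

lemma deg_less_coord: "deg_less (Suc (Suc 0)) fst" "deg_less (Suc (Suc 0)) snd"
  using deg_less_fst[OF deg_less_const[of 0 1]] deg_less_snd[OF deg_less_const[of 0 1]] by simp_all

lemma deg_less_mult': "deg_less (Suc n) f \<Longrightarrow> deg_less (Suc m) g \<Longrightarrow> deg_less (Suc (n + m)) (\<lambda>z. f z * g z)"
  using deg_less_mult[of "Suc n" f m g] by simp

lemma deg_less_power: "deg_less (Suc n) f \<Longrightarrow> deg_less (Suc (n * k)) (\<lambda>z. f z ^ k)"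
  by (induction k) (auto intro: deg_less_const deg_less_mult')

definition poly_fun :: "(real \<times> real \<Rightarrow> real) \<Rightarrow> bool" where "poly_fun f \<longleftrightarrow> (\<exists>n. deg_less n f)"

lemma deg_less_poly_fun: "deg_less n f \<Longrightarrow> poly_fun f" by (auto simp: poly_fun_def)

lemma poly_fun_const [intro, simp]: "poly_fun (\<lambda>_. c)"
  by (rule deg_less_poly_fun[OF deg_less_const[of 0]])

lemma poly_fun_coord [intro, simp]: "poly_fun fst" "poly_fun snd"
  by (rule deg_less_poly_fun[OF deg_less_coord(1)], rule deg_less_poly_fun[OF deg_less_coord(2)])

lemma poly_fun_add [intro]: assumes "poly_fun f" "poly_fun g" shows "poly_fun (\<lambda>z. f z + g z)"
proof -
  obtain n m where "deg_less n f" "deg_less m g" using assms by (auto simp: poly_fun_def)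
  thus ?thesis using deg_less_add[of "max n m" f g] deg_less_mono[of _ _ "max n m"] by (auto intro!: deg_less_poly_fun)
qed

lemma poly_fun_mult [intro]: assumes "poly_fun f" "poly_fun g" shows "poly_fun (\<lambda>z. f z * g z)"
proof -
  obtain n m where "deg_less n f" "deg_less m g" using assms by (auto simp: poly_fun_def)
  thus ?thesis using deg_less_mult[OF _ deg_less_Suc] deg_less_poly_fun by blast
qed

lemma poly_fun_uminus [intro]: "poly_fun f \<Longrightarrow> poly_fun (\<lambda>z. - f z)"
  using poly_fun_mult[OF poly_fun_const[of "-1"]] by simp

lemma poly_fun_diff [intro]: "poly_fun f \<Longrightarrow> poly_fun g \<Longrightarrow> poly_fun (\<lambda>z. f z - g z)"
  using poly_fun_add[OF _ poly_fun_uminus, of f g] by simp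

lemma poly_fun_power [intro]: "poly_fun f \<Longrightarrow> poly_fun (\<lambda>z. f z ^ k)"
  by (induction k) auto

lemma poly_fun_sum [intro]: "(\<And>i. i \<in> A \<Longrightarrow> poly_fun (f i)) \<Longrightarrow> poly_fun (\<lambda>z. \<Sum>i\<in>A. f i z)"
  by (induction A rule: infinite_finite_induct) auto

lemma poly_fun_induct [consumes 1, case_names const fst snd add]:
  assumes "poly_fun f"
    and "\<And>c. P (\<lambda>_. c)"
    and "\<And>f. poly_fun f \<Longrightarrow> P f \<Longrightarrow> P (\<lambda>z. fst z * f z)"
    and "\<And>f. poly_fun f \<Longrightarrow> P f \<Longrightarrow> P (\<lambda>z. snd z * f z)"
    and "\<And>f g. poly_fun f \<Longrightarrow> poly_fun g \<Longrightarrow> P f \<Longrightarrow> P g \<Longrightarrow> P (\<lambda>z. f z + g z)"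
  shows "P f"
proof -
  obtain n where "deg_less n f" using assms(1) by (auto simp: poly_fun_def)
  thus ?thesis by (induction n f rule: deg_less.induct) (auto intro: assms deg_less_poly_fun)
qed

lemma continuous_on_poly_fun: "poly_fun f \<Longrightarrow> continuous_on A f"
  by (induction f rule: poly_fun_induct) (auto intro!: continuous_intros)

lemma differentiable_poly_fun: "poly_fun f \<Longrightarrow> f differentiable (at z)"
  by (induction f rule: poly_fun_induct)
     (auto intro!: differentiable_mult differentiable_add
        bounded_linear_imp_differentiable[OF bounded_linear_fst] bounded_linear_imp_differentiable[OF bounded_linear_snd])

section \<open>Geometry of the triangle\<close>

lemma triangle_iff: "z \<in> triangle \<longleftrightarrow> 0 \<le> fst z \<and> 0 \<le> snd z \<and> fst z + snd z \<le> 1"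
  by (cases z) (auto simp: triangle_def)

lemma compact_triangle: "compact triangle"
proof -
  have "closed {z::real\<times>real. 0 \<le> fst z \<and> 0 \<le> snd z \<and> fst z + snd z \<le> 1}"
    by (intro closed_Collect_conj closed_Collect_le continuous_intros)
  hence "closed triangle" by (simp add: triangle_iff[symmetric])
  moreover have "triangle \<subseteq> cbox (0, 0) (1, 1)"
    by (auto simp: triangle_def cbox_Pair_eq)
  hence "bounded triangle" by (meson bounded_cbox bounded_subset)
  ultimately show ?thesis by (simp add: compact_eq_bounded_closed)
qed

lemma interior_triangle: "interior triangle = {z. 0 < fst z \<and> 0 < snd z \<and> fst z + snd z < 1}"
proof (rule interior_unique)
  show "open {z::real\<times>real. 0 < fst z \<and> 0 < snd z \<and> fst z + snd z < 1}"
    by (intro open_Collect_conj open_Collect_less continuous_intros)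
  fix S :: "(real \<times> real) set" assume S: "S \<subseteq> triangle" "open S"
  show "S \<subseteq> {z. 0 < fst z \<and> 0 < snd z \<and> fst z + snd z < 1}"
  proof
    fix z assume z: "z \<in> S"
    obtain e where e: "e > 0" "ball z e \<subseteq> S" using S z openE by blast
    have d: "dist z (z + v) = norm v" for v by (simp add: dist_norm)
    have in_tri: "z + v \<in> triangle" if "norm v < e" for v
      using that e S d by (metis in_mono mem_ball)
    have "z + (- (e/2), 0) \<in> triangle" "z + (0, - (e/2)) \<in> triangle" "z + (e/2, 0) \<in> triangle"
      using e(1) by (auto intro!: in_tri simp: norm_Pair)
    thus "z \<in> {z. 0 < fst z \<and> 0 < snd z \<and> fst z + snd z < 1}"
      using e(1) by (auto simp: triangle_iff)
  qed
qed (auto simp: triangle_iff)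

lemma convex_triangle: "convex triangle"
proof -
  have "triangle = {z. - fst z \<le> 0} \<inter> {z. - snd z \<le> 0} \<inter> {z. fst z + snd z \<le> 1}"
    by (auto simp: triangle_iff)
  moreover have "convex {z::real\<times>real. a * fst z + b * snd z \<le> c}" for a b c
    using convex_halfspace_le[of "(a, b)" c] by (simp add: inner_prod_def)
  from this[of "-1" 0 0] this[of 0 "-1" 0] this[of 1 1 1]
  have "convex ({z::real\<times>real. - fst z \<le> 0} \<inter> {z. - snd z \<le> 0} \<inter> {z. fst z + snd z \<le> 1})"
    by (intro convex_Int) auto
  ultimately show ?thesis by simp
qed

lemma closure_interior_triangle: "closure (interior triangle) = triangle"
proof -
  have "(1/4, 1/4) \<in> interior triangle" by (simp add: interior_triangle)
  thus ?thesis using convex_closure_interior[OF convex_triangle] compact_triangle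
    by (metis closure_closed compact_imp_closed empty_iff)
qed

lemma triangle_borel [measurable]: "triangle \<in> sets borel"
  using compact_triangle by (simp add: borel_closed compact_imp_closed)

lemma triangle_interior_null: "triangle - interior triangle \<in> null_sets lebesgue"
proof -
  have "negligible (frontier triangle)" by (rule negligible_convex_frontier[OF convex_triangle])
  hence "negligible (triangle - interior triangle)"
    using compact_triangle by (simp add: frontier_def closure_closed compact_imp_closed)
  thus ?thesis by (simp add: negligible_iff_null_sets)
qed

text \<open>The two domains differ by part of the frontier of a convex set, which is null. The
  integrands agree almost everywhere, so measurability alone yields equality of the
  integrals.\<close>

lemma set_integral_interior_triangle:
  "(LINT z:interior triangle|lebesgue. f z) = (LINT z:triangle|lebesgue. (f z :: real))"
  if "set_borel_measurable lebesgue triangle f"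
proof -
  have [measurable]: "(\<lambda>z. indicator triangle z *\<^sub>R f z) \<in> borel_measurable lebesgue"
    using that by (simp add: set_borel_measurable_def)
  have "AE z in lebesgue. z \<notin> triangle - interior triangle"
    by (rule AE_not_in[OF triangle_interior_null])
  hence ae: "AE z in lebesgue. indicator (interior triangle) z *\<^sub>R f z = indicator triangle z *\<^sub>R f z"
    by eventually_elim (use interior_subset[of triangle] in \<open>auto simp: indicator_def\<close>)
  have eq: "(\<lambda>z. indicator (interior triangle) z *\<^sub>R f z)
      = (\<lambda>z. indicator (interior triangle) z *\<^sub>R (indicator triangle z *\<^sub>R f z))"
    using interior_subset[of triangle] by (auto simp: indicator_def fun_eq_iff)
  have [measurable]: "interior triangle \<in> sets lebesgue" by simp
  have "(\<lambda>z. indicator (interior triangle) z *\<^sub>R f z) \<in> borel_measurable lebesgue"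
    unfolding eq by measurable
  thus ?thesis unfolding set_lebesgue_integral_def
    using ae that by (intro integral_cong_AE) (auto simp: set_borel_measurable_def)
qed

section \<open>The weighted space and its inner product\<close>

locale apk_weight =
  fixes \<alpha> \<beta> p :: nat
  assumes \<alpha>: "\<alpha> \<ge> 1" and \<beta>: "\<beta> \<ge> 1"
begin

abbreviation h where "h \<equiv> tri_weight \<alpha> \<beta> p"
abbreviation ip where "ip \<equiv> w_inner h"

lemma h_eq: "h z = fst z ^ (\<alpha> - 1) * snd z ^ (\<beta> - 1) * (1 - fst z - snd z) ^ p"
  by (simp add: tri_weight_def case_prod_unfold)

lemma poly_fun_h: "poly_fun h"
  unfolding tri_weight_def case_prod_unfold by (intro poly_fun_mult poly_fun_power poly_fun_diff) auto

lemma h_nonneg: "z \<in> triangle \<Longrightarrow> h z \<ge> 0"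
  by (auto simp: h_eq triangle_iff)

lemma h_pos: "z \<in> interior triangle \<Longrightarrow> h z > 0"
  by (auto simp: h_eq interior_triangle)

lemma wL2_measurable:
  "v \<in> wL2 h \<Longrightarrow> (\<lambda>z. indicator triangle z * v z) \<in> borel_measurable lebesgue"
  by (simp add: wL2_def set_borel_measurable_def)

lemma poly_fun_measurable: "poly_fun f \<Longrightarrow> f \<in> borel_measurable lebesgue"
  using borel_measurable_continuous_onI[OF continuous_on_poly_fun] by (simp add: measurable_completion)

lemma h_measurable [measurable]: "h \<in> borel_measurable lebesgue"
  by (rule poly_fun_measurable[OF poly_fun_h])

lemma wL2_prod_measurable:
  assumes "f \<in> wL2 h" "g \<in> wL2 h" "c \<in> borel_measurable lebesgue"
  shows "(\<lambda>z. indicator triangle z * (c z * f z * g z)) \<in> borel_measurable lebesgue"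
proof -
  note [measurable] = wL2_measurable[OF assms(1)] wL2_measurable[OF assms(2)] assms(3)
  have "(\<lambda>z. indicator triangle z * (c z * f z * g z)) =
     (\<lambda>z. c z * (indicator triangle z * f z) * (indicator triangle z * g z))"
    by (auto simp: indicator_def fun_eq_iff)
  also have "\<dots> \<in> borel_measurable lebesgue" by measurable
  finally show ?thesis .
qed

lemma wL2_integrable:
  assumes "f \<in> wL2 h" "g \<in> wL2 h"
  shows "set_integrable lebesgue triangle (\<lambda>z. h z * f z * g z)"
proof -
  have i: "integrable lebesgue (\<lambda>z. indicator triangle z * (h z * (v z)\<^sup>2))" if "v \<in> wL2 h" for v
    using that by (simp add: wL2_def set_integrable_def)
  show ?thesis unfolding set_integrable_def real_scaleR_def
  proof (rule Bochner_Integration.integrable_bound[OF Bochner_Integration.integrable_add[OF i[OF assms(1)] i[OF assms(2)]]])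
    show "AE z in lebesgue. norm (indicator triangle z * (h z * f z * g z))
        \<le> norm (indicator triangle z * (h z * (f z)\<^sup>2) + indicator triangle z * (h z * (g z)\<^sup>2))"
    proof (rule AE_I2)
      fix z
      have "\<bar>f z * g z\<bar> \<le> (f z)\<^sup>2 + (g z)\<^sup>2"
        using sum_squares_bound[of "\<bar>f z\<bar>" "\<bar>g z\<bar>"] mult_nonneg_nonneg[of "\<bar>f z\<bar>" "\<bar>g z\<bar>"]
        unfolding abs_mult power2_abs by linarith
      hence "h z * \<bar>f z * g z\<bar> \<le> h z * ((f z)\<^sup>2 + (g z)\<^sup>2)" if "z \<in> triangle"
        using h_nonneg[OF that] by (intro mult_left_mono)
      thus "norm (indicator triangle z * (h z * f z * g z))
        \<le> norm (indicator triangle z * (h z * (f z)\<^sup>2) + indicator triangle z * (h z * (g z)\<^sup>2))"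
        using h_nonneg[of z] by (auto simp: indicator_def abs_mult algebra_simps)
    qed
  qed (use wL2_prod_measurable[OF assms h_measurable] in \<open>simp add: mult.assoc\<close>)
qed

lemma wL2_I:
  assumes "(\<lambda>z. indicator triangle z * v z) \<in> borel_measurable lebesgue"
    and "integrable lebesgue g" "\<And>z. z \<in> triangle \<Longrightarrow> h z * (v z)\<^sup>2 \<le> g z"
  shows "v \<in> wL2 h"
proof -
  note [measurable] = assms(1)
  have "integrable lebesgue (\<lambda>z. indicator triangle z * (h z * (v z)\<^sup>2))"
  proof (rule Bochner_Integration.integrable_bound[OF assms(2)])
    have "(\<lambda>z. indicator triangle z * (h z * (v z)\<^sup>2)) = (\<lambda>z. h z * (indicator triangle z * v z)\<^sup>2)"
      by (auto simp: indicator_def fun_eq_iff)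
    also have "\<dots> \<in> borel_measurable lebesgue" by measurable
    finally show "(\<lambda>z. indicator triangle z * (h z * (v z)\<^sup>2)) \<in> borel_measurable lebesgue" .
    show "AE z in lebesgue. norm (indicator triangle z * (h z * (v z)\<^sup>2)) \<le> norm (g z)"
      using assms(3) h_nonneg by (intro AE_I2) (fastforce simp: indicator_def abs_mult intro: order.trans[OF _ abs_ge_self])
  qed
  thus ?thesis using assms(1) by (simp add: wL2_def set_borel_measurable_def set_integrable_def)
qed

lemma wL2_sq_integrable:
  "v \<in> wL2 h \<Longrightarrow> integrable lebesgue (\<lambda>z. indicator triangle z * (h z * (v z)\<^sup>2))"
  by (simp add: wL2_def set_integrable_def)

lemma wL2_add:
  assumes "f \<in> wL2 h" "g \<in> wL2 h" shows "(\<lambda>z. f z + g z) \<in> wL2 h"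
proof (rule wL2_I)
  note [measurable] = wL2_measurable[OF assms(1)] wL2_measurable[OF assms(2)]
  show "(\<lambda>z. indicator triangle z * (f z + g z)) \<in> borel_measurable lebesgue"
    unfolding distrib_left by measurable
  show "integrable lebesgue (\<lambda>z. 2 * (indicator triangle z * (h z * (f z)\<^sup>2)) + 2 * (indicator triangle z * (h z * (g z)\<^sup>2)))"
    using assms by (intro Bochner_Integration.integrable_add integrable_mult_right wL2_sq_integrable)
  fix z :: "real \<times> real" assume z: "z \<in> triangle"
  have "(f z + g z)\<^sup>2 \<le> 2 * (f z)\<^sup>2 + 2 * (g z)\<^sup>2"
    using sum_squares_bound[of "f z" "g z"] by (simp add: power2_sum)
  from mult_left_mono[OF this h_nonneg[OF z]]
  show "h z * (f z + g z)\<^sup>2 \<le> 2 * (indicator triangle z * (h z * (f z)\<^sup>2)) + 2 * (indicator triangle z * (h z * (g z)\<^sup>2))"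
    using z by (simp add: algebra_simps)
qed

lemma continuous_bounded_on_triangle:
  fixes c :: "real \<times> real \<Rightarrow> real"
  assumes "continuous_on triangle c"
  obtains B where "B \<ge> 0" "\<And>z. z \<in> triangle \<Longrightarrow> \<bar>c z\<bar> \<le> B"
proof -
  have "bounded (c ` triangle)"
    using assms compact_triangle by (intro compact_imp_bounded compact_continuous_image)
  then obtain B where "\<forall>x \<in> c ` triangle. norm x \<le> B" by (auto simp: bounded_iff)
  thus ?thesis using that[of "max B 0"] by fastforce
qed

lemma indicator_cont_measurable:
  fixes c :: "real \<times> real \<Rightarrow> real"
  assumes "continuous_on triangle c"
  shows "(\<lambda>z. indicator triangle z * c z) \<in> borel_measurable lebesgue"
proof -
  have "(\<lambda>z. indicator triangle z *\<^sub>R c z) \<in> borel_measurable borel"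
    by (rule borel_measurable_continuous_on_indicator[OF triangle_borel assms])
  thus ?thesis by (simp add: measurable_completion)
qed

lemma wL2_cont_mult:
  assumes v: "v \<in> wL2 h" and c: "continuous_on triangle c" shows "(\<lambda>z. c z * v z) \<in> wL2 h"
proof -
  obtain B where B: "B \<ge> 0" "\<And>z. z \<in> triangle \<Longrightarrow> \<bar>c z\<bar> \<le> B"
    using continuous_bounded_on_triangle[OF c] by blast
  note [measurable] = wL2_measurable[OF v] indicator_cont_measurable[OF c]
  show ?thesis
  proof (rule wL2_I)
    have "(\<lambda>z. indicator triangle z * (c z * v z)) = (\<lambda>z. (indicator triangle z * c z) * (indicator triangle z * v z))"
      by (auto simp: indicator_def fun_eq_iff)
    also have "\<dots> \<in> borel_measurable lebesgue" by measurable
    finally show "(\<lambda>z. indicator triangle z * (c z * v z)) \<in> borel_measurable lebesgue" .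
    show "integrable lebesgue (\<lambda>z. B\<^sup>2 * (indicator triangle z * (h z * (v z)\<^sup>2)))"
      using v by (intro integrable_mult_right wL2_sq_integrable)
    fix z :: "real \<times> real" assume z: "z \<in> triangle"
    have "(c z)\<^sup>2 \<le> B\<^sup>2" using power_mono[OF B(2)[OF z], of 2] by simp
    hence "(c z)\<^sup>2 * (h z * (v z)\<^sup>2) \<le> B\<^sup>2 * (h z * (v z)\<^sup>2)"
      using h_nonneg[OF z] by (intro mult_right_mono) auto
    thus "h z * (c z * v z)\<^sup>2 \<le> B\<^sup>2 * (indicator triangle z * (h z * (v z)\<^sup>2))"
      using z by (simp add: power_mult_distrib mult_ac)
  qed
qed

lemma integrable_indicator_triangle: "integrable lebesgue (\<lambda>z. c * indicator triangle z :: real)"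
proof -
  have "emeasure lebesgue triangle < \<infinity>"
    using emeasure_bounded_finite[OF compact_imp_bounded[OF compact_triangle]] by simp
  thus ?thesis by (intro integrable_mult_right integrable_real_indicator) auto
qed

lemma wL2_const: "(\<lambda>_. c) \<in> wL2 h"
proof -
  obtain B where B: "B \<ge> 0" "\<And>z. z \<in> triangle \<Longrightarrow> \<bar>h z\<bar> \<le> B"
    using continuous_bounded_on_triangle[OF continuous_on_poly_fun[OF poly_fun_h]] by blast
  show ?thesis
  proof (rule wL2_I)
    show "integrable lebesgue (\<lambda>z. B * c\<^sup>2 * indicator triangle z)"
      by (rule integrable_indicator_triangle)
    show "h z * c\<^sup>2 \<le> B * c\<^sup>2 * indicator triangle z" if "z \<in> triangle" for z
      using B(2)[OF that] that by (auto intro!: mult_right_mono)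
  qed (rule indicator_cont_measurable, simp)
qed

lemma wL2_cont: "continuous_on triangle c \<Longrightarrow> c \<in> wL2 h"
  using wL2_cont_mult[OF wL2_const[of 1]] by simp

lemma wL2_poly_fun: "poly_fun f \<Longrightarrow> f \<in> wL2 h"
  by (intro wL2_cont continuous_on_poly_fun)

lemma wL2_cmult: "v \<in> wL2 h \<Longrightarrow> (\<lambda>z. c * v z) \<in> wL2 h"
  by (intro wL2_cont_mult) auto

lemma wL2_uminus: "v \<in> wL2 h \<Longrightarrow> (\<lambda>z. - v z) \<in> wL2 h"
  using wL2_cmult[of v "-1"] by simp

lemma wL2_diff: "f \<in> wL2 h \<Longrightarrow> g \<in> wL2 h \<Longrightarrow> (\<lambda>z. f z - g z) \<in> wL2 h"
  using wL2_add[OF _ wL2_uminus] by fastforce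

lemma wL2_sum: "(\<And>i. i \<in> A \<Longrightarrow> f i \<in> wL2 h) \<Longrightarrow> (\<lambda>z. \<Sum>i\<in>A. f i z) \<in> wL2 h"
  by (induction A rule: infinite_finite_induct) (auto intro: wL2_add wL2_const)

lemma ip_commute: "ip f g = ip g f"
  unfolding w_inner_def by (simp add: mult_ac)

lemma ip_add_left:
  assumes "f \<in> wL2 h" "g \<in> wL2 h" "k \<in> wL2 h"
  shows "ip (\<lambda>z. f z + g z) k = ip f k + ip g k"
  using set_integral_add(2)[OF wL2_integrable[OF assms(1,3)] wL2_integrable[OF assms(2,3)]]
  by (simp add: w_inner_def algebra_simps)

lemma ip_cmult_left: "ip (\<lambda>z. c * f z) k = c * ip f k"
proof -
  have "(\<lambda>z. h z * (c * f z) * k z) = (\<lambda>z. c * (h z * f z * k z))" by (auto simp: mult_ac)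
  thus ?thesis unfolding w_inner_def by simp
qed

lemma ip_uminus_left: "ip (\<lambda>z. - f z) k = - ip f k"
  using ip_cmult_left[of "-1" f k] by simp

lemma ip_diff_left:
  assumes "f \<in> wL2 h" "g \<in> wL2 h" "k \<in> wL2 h"
  shows "ip (\<lambda>z. f z - g z) k = ip f k - ip g k"
  using ip_add_left[OF assms(1) wL2_uminus[OF assms(2)] assms(3)] by (simp add: ip_uminus_left)

lemma ip_zero_left: "ip (\<lambda>_. 0) k = 0"
  by (simp add: w_inner_def)

lemma ip_sum_left:
  assumes "\<And>i. i \<in> A \<Longrightarrow> f i \<in> wL2 h" "k \<in> wL2 h"
  shows "ip (\<lambda>z. \<Sum>i\<in>A. f i z) k = (\<Sum>i\<in>A. ip (f i) k)"
  using assms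
  by (induction A rule: infinite_finite_induct) (auto simp: ip_zero_left ip_add_left wL2_sum)

lemma ip_cmult_right: "ip k (\<lambda>z. c * f z) = c * ip k f"
  using ip_cmult_left[of c f k] by (simp add: ip_commute)

lemma ip_add_right:
  assumes "f \<in> wL2 h" "g \<in> wL2 h" "k \<in> wL2 h"
  shows "ip k (\<lambda>z. f z + g z) = ip k f + ip k g"
  using ip_add_left[OF assms] by (simp add: ip_commute)

lemma ip_diff_right:
  assumes "f \<in> wL2 h" "g \<in> wL2 h" "k \<in> wL2 h"
  shows "ip k (\<lambda>z. f z - g z) = ip k f - ip k g"
  using ip_diff_left[OF assms] by (simp add: ip_commute)

lemma ip_sum_right:
  assumes "\<And>i. i \<in> A \<Longrightarrow> f i \<in> wL2 h" "k \<in> wL2 h"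
  shows "ip k (\<lambda>z. \<Sum>i\<in>A. f i z) = (\<Sum>i\<in>A. ip k (f i))"
  using ip_sum_left[OF assms] by (simp add: ip_commute)

lemma ip_mult_assoc: "ip (\<lambda>z. c z * f z) g = ip f (\<lambda>z. c z * g z)"
  unfolding w_inner_def by (simp add: mult_ac)

lemma ip_nonneg: "ip f f \<ge> 0"
  unfolding w_inner_def set_lebesgue_integral_def
  by (intro Bochner_Integration.integral_nonneg) (auto simp: indicator_def mult.assoc h_nonneg)

text \<open>Functions equal almost everywhere are not identified, so the form may degenerate. If
  \<open>ip g g = 0\<close>, the quadratic in \<open>t\<close> is affine, and the chosen
  \<open>t\<close> would give it the value -1 unless \<open>ip f g = 0\<close>.\<close>

lemma ip_Cauchy_Schwarz:
  assumes "f \<in> wL2 h" "g \<in> wL2 h"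
  shows "(ip f g)\<^sup>2 \<le> ip f f * ip g g"
proof -
  have q: "0 \<le> ip f f - 2 * t * ip f g + t\<^sup>2 * ip g g" for t
  proof -
    have m: "(\<lambda>z. t * g z) \<in> wL2 h" using assms by (intro wL2_cmult)
    have "0 \<le> ip (\<lambda>z. f z - t * g z) (\<lambda>z. f z - t * g z)" by (rule ip_nonneg)
    also have "\<dots> = ip f f - 2 * t * ip f g + t\<^sup>2 * ip g g"
      using assms m by (simp add: ip_diff_left ip_diff_right wL2_diff ip_cmult_left ip_cmult_right
          ip_commute[of g f] power2_eq_square algebra_simps)
    finally show ?thesis .
  qed
  show ?thesis
  proof (cases "ip g g = 0")
    case True
    have "ip f g = 0"
    proof (rule ccontr)
      assume "ip f g \<noteq> 0"
      with q[of "(ip f f + 1) / (2 * ip f g)"] True show False by simp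
    qed
    thus ?thesis by (simp add: True)
  next
    case False
    hence "ip g g > 0" using ip_nonneg[of g] by simp
    thus ?thesis using q[of "ip f g / ip g g"] by (simp add: field_simps power2_eq_square)
  qed
qed

text \<open>Lets a function of norm zero be discarded inside inner products, without a statement
  about vanishing almost everywhere.\<close>

lemma ip_eq_0_if_null: "ip g g = 0 \<Longrightarrow> f \<in> wL2 h \<Longrightarrow> g \<in> wL2 h \<Longrightarrow> ip f g = 0"
  using ip_Cauchy_Schwarz[of f g] by simp

lemma ip_le_sup_norm:
  assumes "w \<in> wL2 h" and "e \<ge> 0" and "\<And>z. z \<in> triangle \<Longrightarrow> \<bar>w z\<bar> \<le> e"
  shows "ip w w \<le> e\<^sup>2 * ip (\<lambda>_. 1) (\<lambda>_. 1)"
proof -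
  have "ip w w \<le> ip (\<lambda>_. e) (\<lambda>_. e)" unfolding w_inner_def
  proof (rule set_integral_mono)
    show "set_integrable lebesgue triangle (\<lambda>z. h z * w z * w z)" "set_integrable lebesgue triangle (\<lambda>z. h z * e * e)"
      using assms wL2_integrable[OF wL2_const wL2_const] by (auto intro: wL2_integrable)
    fix y assume y: "y \<in> triangle"
    have "(w y)\<^sup>2 \<le> e\<^sup>2" using assms(2) assms(3)[OF y] by (simp add: abs_le_square_iff[symmetric])
    from mult_left_mono[OF this h_nonneg[OF y]]
    show "h y * w y * w y \<le> h y * e * e" by (simp add: power2_eq_square mult.assoc)
  qed
  also have "ip (\<lambda>_. e) (\<lambda>_. e) = e\<^sup>2 * ip (\<lambda>_. 1) (\<lambda>_. 1)"
    using ip_cmult_left[of e "\<lambda>_. 1" "\<lambda>_. e"] ip_cmult_right[of "\<lambda>_. 1" e "\<lambda>_. 1"] by (simp add: power2_eq_square)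
  finally show ?thesis .
qed

end

section \<open>Smooth cutoffs\<close>

declare split_paired_All [simp del] split_paired_Ex [simp del]

section \<open>Directional derivatives and smoothness\<close>

text \<open>With the direction as an argument, the oblique edge (1, -1) is treated like the two
  axes.\<close>

definition dir_deriv :: "real \<times> real \<Rightarrow> (real \<times> real \<Rightarrow> real) \<Rightarrow> real \<times> real \<Rightarrow> real" where
  "dir_deriv e f z = frechet_derivative f (at z) e"

abbreviation smooth :: "(real \<times> real \<Rightarrow> real) \<Rightarrow> bool" where "smooth f \<equiv> \<forall>n. Ck n f"

lemma dir_deriv_eqI: "(f has_derivative f') (at z) \<Longrightarrow> dir_deriv e f z = f' e"
  unfolding dir_deriv_def using frechet_derivative_at by metis

lemma has_derivative_dir_deriv: "f differentiable (at z) \<Longrightarrow> (f has_derivative (\<lambda>e. dir_deriv e f z)) (at z)"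
  unfolding dir_deriv_def using frechet_derivative_works by blast

lemma dir_deriv_const: "dir_deriv e (\<lambda>_. c) = (\<lambda>_. 0)"
  by (rule ext, rule dir_deriv_eqI) (auto intro: derivative_eq_intros)

lemma dir_deriv_fst: "dir_deriv e fst = (\<lambda>_. fst e)" and dir_deriv_snd: "dir_deriv e snd = (\<lambda>_. snd e)"
  by (auto intro!: ext dir_deriv_eqI[where f' = fst] dir_deriv_eqI[where f' = snd] bounded_linear_imp_has_derivative bounded_linear_fst bounded_linear_snd)

lemma dir_deriv_add: "f differentiable (at z) \<Longrightarrow> g differentiable (at z) \<Longrightarrow>
    dir_deriv e (\<lambda>z. f z + g z) z = dir_deriv e f z + dir_deriv e g z"
  by (rule dir_deriv_eqI[OF has_derivative_add[OF has_derivative_dir_deriv has_derivative_dir_deriv]])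

lemma dir_deriv_mult: "f differentiable (at z) \<Longrightarrow> g differentiable (at z) \<Longrightarrow>
    dir_deriv e (\<lambda>z. f z * g z) z = f z * dir_deriv e g z + dir_deriv e f z * g z"
  by (rule dir_deriv_eqI[OF has_derivative_mult[OF has_derivative_dir_deriv has_derivative_dir_deriv]])

lemma dir_deriv_linear: "f differentiable (at z) \<Longrightarrow> dir_deriv (a *\<^sub>R e + b *\<^sub>R e') f z = a * dir_deriv e f z + b * dir_deriv e' f z"
  using linear_frechet_derivative[of f "at z"] by (simp add: dir_deriv_def linear_add linear_scale)

lemma Ck_Suc_dir_deriv: "Ck (Suc n) f \<longleftrightarrow> (\<forall>z. f differentiable (at z)) \<and> (\<forall>v. Ck n (dir_deriv v f))"
  unfolding dir_deriv_def by (simp add: differentiable_on_def)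

lemma Ck_lower: "Ck (Suc n) f \<Longrightarrow> Ck n f" for f :: "real \<times> real \<Rightarrow> real"
proof (induction n arbitrary: f)
  case 0
  thus ?case by (auto simp: differentiable_imp_continuous_on)
next
  case (Suc n)
  thus ?case by (metis Ck_Suc_dir_deriv)
qed

lemma Ck_continuous: "Ck n f \<Longrightarrow> continuous_on UNIV f" for f :: "real \<times> real \<Rightarrow> real"
  by (cases n) (auto simp: differentiable_imp_continuous_on)

lemma smooth_continuous: "smooth f \<Longrightarrow> continuous_on A f"
  using Ck_continuous continuous_on_subset by blast

lemma smooth_differentiable: "smooth f \<Longrightarrow> f differentiable (at z)"
  using Ck_Suc_dir_deriv by blast

lemma smooth_dir_deriv: "smooth f \<Longrightarrow> smooth (dir_deriv e f)"
  using Ck_Suc_dir_deriv by blast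

lemma Ck_const: "Ck n (\<lambda>_::real\<times>real. c::real)"
proof (induction n arbitrary: c)
  case (Suc n)
  thus ?case unfolding Ck_Suc_dir_deriv dir_deriv_const by auto
qed auto

lemma Ck_coord: "Ck n (fst :: real \<times> real \<Rightarrow> real)" "Ck n (snd :: real \<times> real \<Rightarrow> real)"
  by (induction n) (auto intro: continuous_intros bounded_linear_imp_differentiable[OF bounded_linear_fst]
      bounded_linear_imp_differentiable[OF bounded_linear_snd] simp: Ck_Suc_dir_deriv dir_deriv_fst dir_deriv_snd Ck_const simp del: Ck.simps(2))

lemma Ck_add: "Ck n f \<Longrightarrow> Ck n g \<Longrightarrow> Ck n (\<lambda>z. f z + g z)" for f g :: "real \<times> real \<Rightarrow> real"
proof (induction n arbitrary: f g)
  case (Suc n)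
  hence "dir_deriv v (\<lambda>z. f z + g z) = (\<lambda>z. dir_deriv v f z + dir_deriv v g z)" for v
    by (auto simp: Ck_Suc_dir_deriv dir_deriv_add fun_eq_iff simp del: Ck.simps(2))
  thus ?case using Suc by (auto simp: Ck_Suc_dir_deriv simp del: Ck.simps(2))
qed (auto intro: continuous_intros)

lemma Ck_mult: "Ck n f \<Longrightarrow> Ck n g \<Longrightarrow> Ck n (\<lambda>z. f z * g z)" for f g :: "real \<times> real \<Rightarrow> real"
proof (induction n arbitrary: f g)
  case (Suc n)
  hence "dir_deriv v (\<lambda>z. f z * g z) = (\<lambda>z. f z * dir_deriv v g z + dir_deriv v f z * g z)" for v
    by (auto simp: Ck_Suc_dir_deriv dir_deriv_mult fun_eq_iff simp del: Ck.simps(2))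
  moreover have "Ck n (\<lambda>z. f z * dir_deriv v g z + dir_deriv v f z * g z)" for v
    using Suc.prems Ck_lower[of n] by (intro Ck_add Suc.IH) (auto simp: Ck_Suc_dir_deriv simp del: Ck.simps(2))
  ultimately show ?case using Suc.prems by (auto simp: Ck_Suc_dir_deriv simp del: Ck.simps(2))
qed (auto intro: continuous_intros)

lemma smooth_poly_fun: "poly_fun f \<Longrightarrow> smooth f"
  by (induction f rule: poly_fun_induct) (auto intro: Ck_const Ck_add Ck_mult Ck_coord)

text \<open>\<open>G\<close> lists the successive derivatives of a function of one variable.
  Carrying the whole list makes the class of compositions stable under \<open>dir_deriv\<close>, up
  to constant factors, which is what the induction on \<open>n\<close> uses.\<close>

lemma Ck_compose_affine:
  fixes G :: "nat \<Rightarrow> real \<Rightarrow> real"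
  assumes G: "\<And>i t. (G i has_real_derivative G (Suc i) t) (at t)"
  shows "Ck n (\<lambda>z. G i (a * fst z + b * snd z + c))"
    and "dir_deriv e (\<lambda>z. G i (a * fst z + b * snd z + c)) = (\<lambda>z. G (Suc i) (a * fst z + b * snd z + c) * (a * fst e + b * snd e))"
proof -
  have der: "((\<lambda>z. G i (a * fst z + b * snd z + c)) has_derivative
      (\<lambda>e. G (Suc i) (a * fst z + b * snd z + c) * (a * fst e + b * snd e))) (at z)" for z i
  proof -
    have "((\<lambda>z. a * fst z + b * snd z + c) has_derivative (\<lambda>e. a * fst e + b * snd e)) (at z)"
      by (auto intro!: derivative_eq_intros)
    from has_derivative_compose[OF this G[unfolded has_field_derivative_def]]
    show ?thesis by simp
  qed
  have dir_deriv: "dir_deriv e (\<lambda>z. G i (a * fst z + b * snd z + c)) = (\<lambda>z. G (Suc i) (a * fst z + b * snd z + c) * (a * fst e + b * snd e))" for i e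
    by (rule ext, rule dir_deriv_eqI, rule der)
  thus "dir_deriv e (\<lambda>z. G i (a * fst z + b * snd z + c)) = (\<lambda>z. G (Suc i) (a * fst z + b * snd z + c) * (a * fst e + b * snd e))" .
  have cont: "continuous_on UNIV (\<lambda>z. G i (a * fst z + b * snd z + c))" for i
    using der has_derivative_continuous by (fastforce simp: continuous_on_eq_continuous_at)
  show "Ck n (\<lambda>z. G i (a * fst z + b * snd z + c))"
  proof (induction n arbitrary: i)
    case (Suc n)
    show ?case unfolding Ck_Suc_dir_deriv dir_deriv
      using der by (intro conjI allI Ck_mult Ck_const Suc) (auto simp: differentiable_def)
  qed (use cont in auto)
qed

lemma poly_fun_dir_deriv_deg_less: "deg_less n f \<Longrightarrow> deg_less (n - 1) (dir_deriv e f)"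
proof (induction n f rule: deg_less.induct)
  case (deg_less_fst n f)
  have d: "f differentiable (at z)" for z using deg_less_fst.hyps by (intro differentiable_poly_fun deg_less_poly_fun)
  have "dir_deriv e (\<lambda>z. fst z * f z) = (\<lambda>z. fst z * dir_deriv e f z + fst e * f z)"
    using d by (auto simp: fun_eq_iff dir_deriv_mult dir_deriv_fst bounded_linear_imp_differentiable[OF bounded_linear_fst])
  moreover have "deg_less n (\<lambda>z. fst z * dir_deriv e f z)"
  proof (cases n)
    case 0
    hence f: "f = (\<lambda>_. 0)" using deg_less_0 deg_less_fst.hyps by blast
    show ?thesis unfolding f dir_deriv_const by (simp add: deg_less_zero)
  next
    case (Suc m)
    thus ?thesis using deg_less.deg_less_fst[OF deg_less_fst.IH] by simp
  qed
  ultimately show ?case using deg_less_fst.hyps by (auto intro: deg_less_add deg_less_cmult)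
next
  case (deg_less_snd n f)
  have d: "f differentiable (at z)" for z using deg_less_snd.hyps by (intro differentiable_poly_fun deg_less_poly_fun)
  have "dir_deriv e (\<lambda>z. snd z * f z) = (\<lambda>z. snd z * dir_deriv e f z + snd e * f z)"
    using d by (auto simp: fun_eq_iff dir_deriv_mult dir_deriv_snd bounded_linear_imp_differentiable[OF bounded_linear_snd])
  moreover have "deg_less n (\<lambda>z. snd z * dir_deriv e f z)"
  proof (cases n)
    case 0
    hence f: "f = (\<lambda>_. 0)" using deg_less_0 deg_less_snd.hyps by blast
    show ?thesis unfolding f dir_deriv_const by (simp add: deg_less_zero)
  next
    case (Suc m)
    thus ?thesis using deg_less.deg_less_snd[OF deg_less_snd.IH] by simp
  qed
  ultimately show ?case using deg_less_snd.hyps by (auto intro: deg_less_add deg_less_cmult)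
next
  case (deg_less_add n f g)
  hence "dir_deriv e (\<lambda>z. f z + g z) = (\<lambda>z. dir_deriv e f z + dir_deriv e g z)"
    by (auto simp: fun_eq_iff intro!: dir_deriv_add differentiable_poly_fun deg_less_poly_fun)
  thus ?case using deg_less_add by (auto intro: deg_less.deg_less_add)
qed (auto simp: dir_deriv_const intro: deg_less_zero)

lemma poly_fun_dir_deriv [intro]: "poly_fun f \<Longrightarrow> poly_fun (dir_deriv e f)"
  using poly_fun_dir_deriv_deg_less unfolding poly_fun_def by blast

lemma line_deriv:
  assumes "\<And>z. f differentiable (at z)"
  shows "((\<lambda>s. f (w + s *\<^sub>R e)) has_real_derivative dir_deriv e f (w + s *\<^sub>R e)) (at s)"
proof -
  have "((\<lambda>s. f (w + s *\<^sub>R e)) has_derivative (\<lambda>t. dir_deriv (t *\<^sub>R e) f (w + s *\<^sub>R e))) (at s)"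
    by (rule has_derivative_compose[OF _ has_derivative_dir_deriv[OF assms]]) (auto intro!: derivative_eq_intros)
  moreover have "dir_deriv (t *\<^sub>R e) f (w + s *\<^sub>R e) = dir_deriv e f (w + s *\<^sub>R e) * t" for t
    using dir_deriv_linear[OF assms, of t e 0 e] by simp
  ultimately show ?thesis by (simp add: has_field_derivative_def)
qed

text \<open>The mean value theorem along \<open>e\<close>, applied to the increment in
  \<open>e'\<close>, and then along \<open>e'\<close>.\<close>

lemma second_difference_mean_value:
  fixes f :: "real \<times> real \<Rightarrow> real"
  assumes f: "smooth f" and r: "r > 0"
  shows "\<exists>q. dist z q \<le> r * (norm e + norm e') \<and>
     f (z + r *\<^sub>R e + r *\<^sub>R e') - f (z + r *\<^sub>R e) - f (z + r *\<^sub>R e') + f z = r\<^sup>2 * dir_deriv e' (dir_deriv e f) q"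
proof -
  have df: "\<And>z. f differentiable (at z)" "\<And>z. dir_deriv e f differentiable (at z)"
    using f smooth_dir_deriv smooth_differentiable by blast+
  let ?F = "\<lambda>s. f ((z + r *\<^sub>R e') + s *\<^sub>R e) - f (z + s *\<^sub>R e)"
  have "\<exists>s. 0 < s \<and> s < r \<and> ?F r - ?F 0 = (r - 0) * (dir_deriv e f ((z + r *\<^sub>R e') + s *\<^sub>R e) - dir_deriv e f (z + s *\<^sub>R e))"
    by (rule MVT2[OF r]) (auto intro!: derivative_intros line_deriv df)
  then obtain s where s: "0 < s" "s < r"
    "?F r - ?F 0 = r * (dir_deriv e f ((z + r *\<^sub>R e') + s *\<^sub>R e) - dir_deriv e f (z + s *\<^sub>R e))" by auto
  let ?G = "\<lambda>t. dir_deriv e f ((z + s *\<^sub>R e) + t *\<^sub>R e')"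
  have "\<exists>t. 0 < t \<and> t < r \<and> ?G r - ?G 0 = (r - 0) * dir_deriv e' (dir_deriv e f) ((z + s *\<^sub>R e) + t *\<^sub>R e')"
    by (rule MVT2[OF r]) (auto intro!: line_deriv df)
  then obtain t where t: "0 < t" "t < r" "?G r - ?G 0 = r * dir_deriv e' (dir_deriv e f) ((z + s *\<^sub>R e) + t *\<^sub>R e')"
    by auto
  have "norm (s *\<^sub>R e + t *\<^sub>R e') \<le> \<bar>s\<bar> * norm e + \<bar>t\<bar> * norm e'"
    using norm_triangle_ineq[of "s *\<^sub>R e" "t *\<^sub>R e'"] by simp
  also have "\<dots> \<le> r * norm e + r * norm e'"
    using s t by (intro add_mono mult_right_mono) auto
  finally have "dist z ((z + s *\<^sub>R e) + t *\<^sub>R e') \<le> r * (norm e + norm e')"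
    by (metis add.assoc add_diff_cancel_left' dist_commute dist_norm distrib_left)
  thus ?thesis using s t
    by (intro exI[of _ "(z + s *\<^sub>R e) + t *\<^sub>R e'"]) (simp add: algebra_simps power2_eq_square)
qed

text \<open>Schwarz's theorem: the second difference is symmetric in the directions, so the two
  mixed derivatives share a value at points arbitrarily close to \<open>z\<close>, and continuity at
  \<open>z\<close> excludes a gap.\<close>

lemma dir_deriv_commute:
  assumes f: "smooth f"
  shows "dir_deriv e (dir_deriv e' f) = dir_deriv e' (dir_deriv e f)"
proof
  fix z
  let ?A = "dir_deriv e (dir_deriv e' f)" and ?B = "dir_deriv e' (dir_deriv e f)"
  show "?A z = ?B z"
  proof (rule ccontr)
    assume ne: "?A z \<noteq> ?B z"
    define \<epsilon> where "\<epsilon> = \<bar>?A z - ?B z\<bar> / 2"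
    have \<epsilon>: "\<epsilon> > 0" using ne by (simp add: \<epsilon>_def)
    have "isCont ?A z" "isCont ?B z"
      using smooth_continuous[of ?A UNIV] smooth_continuous[of ?B UNIV] f smooth_dir_deriv
      by (auto simp: continuous_on_eq_continuous_at)
    hence c: "\<exists>d>0. \<forall>q. dist q z < d \<longrightarrow> dist (?A q) (?A z) < \<epsilon>" "\<exists>d>0. \<forall>q. dist q z < d \<longrightarrow> dist (?B q) (?B z) < \<epsilon>"
      using \<epsilon> unfolding continuous_at_eps_delta by blast+
    obtain d1 where d1: "d1 > 0" "\<And>q. dist q z < d1 \<Longrightarrow> dist (?A q) (?A z) < \<epsilon>" using c(1) by blast
    obtain d2 where d2: "d2 > 0" "\<And>q. dist q z < d2 \<Longrightarrow> dist (?B q) (?B z) < \<epsilon>" using c(2) by blast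
    note d = d1 d2
    define r where "r = min d1 d2 / (2 * (norm e + norm e' + 1))"
    have den: "norm e + norm e' + 1 > 0" by (smt (verit) norm_ge_zero)
    have r: "r > 0" using d den by (simp add: r_def)
    have "r * (norm e + norm e') \<le> r * (norm e + norm e' + 1)" using r by simp
    also have "\<dots> = min d1 d2 / 2" using den by (simp add: r_def field_simps)
    also have "\<dots> < min d1 d2" using d1(1) d2(1) by (simp add: min_def)
    finally have small: "r * (norm e + norm e') < min d1 d2" .
    obtain q1 where q1: "dist z q1 \<le> r * (norm e' + norm e)"
      "f (z + r *\<^sub>R e' + r *\<^sub>R e) - f (z + r *\<^sub>R e') - f (z + r *\<^sub>R e) + f z = r\<^sup>2 * ?A q1"
      using second_difference_mean_value[OF f r, of z e' e] by blast
    obtain q2 where q2: "dist z q2 \<le> r * (norm e + norm e')"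
      "f (z + r *\<^sub>R e + r *\<^sub>R e') - f (z + r *\<^sub>R e) - f (z + r *\<^sub>R e') + f z = r\<^sup>2 * ?B q2"
      using second_difference_mean_value[OF f r, of z e e'] by blast
    have "r\<^sup>2 * ?A q1 = r\<^sup>2 * ?B q2" proof -
      have sw: "z + r *\<^sub>R e' + r *\<^sub>R e = z + r *\<^sub>R e + r *\<^sub>R e'" by (simp add: add_ac)
      show ?thesis using q1(2)[unfolded sw] q2(2) by linarith
    qed
    hence "?A q1 = ?B q2" using r by simp
    moreover have "dist (?A q1) (?A z) < \<epsilon>" "dist (?B q2) (?B z) < \<epsilon>"
      using q1(1) q2(1) small by (auto intro!: d simp: dist_commute add.commute)
    ultimately show False by (auto simp: \<epsilon>_def dist_real_def abs_if split: if_splits)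
  qed
qed

section \<open>Test functions\<close>

lemma test_function_mult:
  assumes "test_function \<Omega> \<phi>" and "smooth q"
  shows "test_function \<Omega> (\<lambda>z. q z * \<phi> z)"
proof -
  have "closure {z. q z * \<phi> z \<noteq> 0} \<subseteq> closure {z. \<phi> z \<noteq> 0}"
    by (intro closure_mono) auto
  moreover from this have "compact (closure {z. q z * \<phi> z \<noteq> 0})"
    using assms compact_Int_closed[OF _ closed_closure, of "closure {z. \<phi> z \<noteq> 0}" "{z. q z * \<phi> z \<noteq> 0}"]
    by (simp add: test_function_def Int_absorb1)
  ultimately show ?thesis using assms unfolding test_function_def by (blast intro: Ck_mult)
qed

lemma test_function_dir_deriv:
  assumes "test_function \<Omega> \<phi>"
  shows "test_function \<Omega> (dir_deriv e \<phi>)"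
proof -
  have "{z. dir_deriv e \<phi> z \<noteq> 0} \<subseteq> closure {z. \<phi> z \<noteq> 0}"
  proof (rule subsetI, rule ccontr)
    fix z assume z: "z \<in> {z. dir_deriv e \<phi> z \<noteq> 0}" "z \<notin> closure {z. \<phi> z \<noteq> 0}"
    have "((\<lambda>_. 0) has_derivative (\<lambda>_. 0)) (at z)" by (rule has_derivative_const)
    hence "(\<phi> has_derivative (\<lambda>_. 0)) (at z)"
    proof (rule has_derivative_transform_within_open)
      show "open (- closure {z. \<phi> z \<noteq> 0})" by auto
      show "0 = \<phi> x" if "x \<in> - closure {z. \<phi> z \<noteq> 0}" for x
        using that closure_subset[of "{z. \<phi> z \<noteq> 0}"] by auto
    qed (use z in auto)
    from dir_deriv_eqI[OF this, of e] show False using z(1) by simp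
  qed
  hence sub: "closure {z. dir_deriv e \<phi> z \<noteq> 0} \<subseteq> closure {z. \<phi> z \<noteq> 0}"
    by (simp add: closure_minimal)
  have "compact (closure {z. dir_deriv e \<phi> z \<noteq> 0})"
    using sub assms compact_Int_closed[OF _ closed_closure, of "closure {z. \<phi> z \<noteq> 0}" "{z. dir_deriv e \<phi> z \<noteq> 0}"]
    by (simp add: test_function_def Int_absorb1)
  moreover have "smooth (dir_deriv e \<phi>)" using assms by (intro smooth_dir_deriv) (simp add: test_function_def)
  ultimately show ?thesis using sub assms unfolding test_function_def by auto
qed

lemma test_function_bounds:
  assumes "test_function \<Omega> \<phi>"
  obtains K B where "compact K" "K \<subseteq> \<Omega>" "\<And>z. z \<notin> K \<Longrightarrow> \<phi> z = 0" "B \<ge> 0" "\<And>z. \<bar>\<phi> z\<bar> \<le> B"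
proof -
  let ?K = "closure {z. \<phi> z \<noteq> 0}"
  have K: "compact ?K" "?K \<subseteq> \<Omega>" "\<And>z. z \<notin> ?K \<Longrightarrow> \<phi> z = 0"
    using assms closure_subset[of "{z. \<phi> z \<noteq> 0}"] by (auto simp: test_function_def)
  have "continuous_on ?K \<phi>" using assms smooth_continuous by (auto simp: test_function_def)
  hence "bounded (\<phi> ` ?K)" using K by (intro compact_imp_bounded compact_continuous_image)
  then obtain B where B: "\<forall>x \<in> \<phi> ` ?K. norm x \<le> B" by (auto simp: bounded_iff)
  have "\<bar>\<phi> z\<bar> \<le> max B 0" for z using B K(3)[of z] by (cases "z \<in> ?K") (auto simp: max_def)
  thus ?thesis using that[OF K, of "max B 0"] by auto
qed

text \<open>Difference quotients have integral 0 by translation invariance, and dominated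
  convergence passes to the derivative. Every direction is covered at once, without iterated
  integrals.\<close>

lemma integral_dir_deriv_test_function:
  assumes t: "test_function \<Omega> \<phi>"
  shows "(LINT z|lborel. dir_deriv e \<phi> z) = 0"
proof -
  obtain K B0 where K: "compact K" "\<And>z. z \<notin> K \<Longrightarrow> \<phi> z = 0" "\<And>z. \<bar>\<phi> z\<bar> \<le> B0"
    using test_function_bounds[OF t] by metis
  obtain B where B: "B \<ge> 0" "\<And>z. \<bar>dir_deriv e \<phi> z\<bar> \<le> B"
    using test_function_bounds[OF test_function_dir_deriv[OF t]] by metis
  have sm: "smooth \<phi>" using t by (simp add: test_function_def)
  have df: "\<And>z. \<phi> differentiable (at z)" using smooth_differentiable[OF sm] .
  have [measurable]: "\<phi> \<in> borel_measurable borel" "dir_deriv e \<phi> \<in> borel_measurable borel"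
    by (rule borel_measurable_continuous_onI[OF smooth_continuous[OF sm]],
        rule borel_measurable_continuous_onI[OF smooth_continuous[OF smooth_dir_deriv[OF sm]]])
  obtain R where R: "\<And>z. z \<in> K \<Longrightarrow> norm z \<le> R"
    using compact_imp_bounded[OF K(1)] by (auto simp: bounded_iff)
  define f where "f n z = real (Suc n) * (\<phi> (z + (1 / real (Suc n)) *\<^sub>R e) - \<phi> z)" for n z
  \<comment> \<open>Translates of the support by at most \<open>e\<close> stay in this ball, so one
    function dominates all the quotients.\<close>
  let ?D = "cball 0 (R + norm e) :: (real \<times> real) set"
  have int\<phi>: "integrable lborel \<phi>"
  proof (rule Bochner_Integration.integrable_bound[where f = "\<lambda>z. B0 * indicator ?D z"])
    show "integrable lborel (\<lambda>z. B0 * indicator ?D z)"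
      using emeasure_bounded_finite[of ?D] by (intro integrable_mult_right integrable_real_indicator) auto
    show "AE z in lborel. norm (\<phi> z) \<le> norm (B0 * indicator ?D z)"
    proof (rule AE_I2)
      fix z show "norm (\<phi> z) \<le> norm (B0 * indicator ?D z)"
      proof (cases "z \<in> K")
        case True
        hence "z \<in> ?D" using R[OF True] by (simp add: add_increasing2)
        thus ?thesis using K(3)[of z] by simp
      qed (use K(2) in simp)
    qed
  qed auto
  have fint: "(LINT z|lborel. f n z) = 0" for n
  proof -
    have shift: "integrable lborel (\<lambda>z. \<phi> (z + v))" "(LINT z|lborel. \<phi> (z + v)) = (LINT z|lborel. \<phi> z)" for v
    proof -
      have d: "lborel = distr lborel borel (\<lambda>z::real\<times>real. v + z)" by (rule lborel_distr_plus[symmetric])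
      show "integrable lborel (\<lambda>z. \<phi> (z + v))"
        using int\<phi> by (subst (asm) d, subst (asm) integrable_distr_eq) (auto simp: add.commute)
      show "(LINT z|lborel. \<phi> (z + v)) = (LINT z|lborel. \<phi> z)"
        by (subst (2) d, subst integral_distr) (auto simp: add.commute)
    qed
    show ?thesis unfolding f_def using shift int\<phi> by simp
  qed
  have "(\<lambda>n. LINT z|lborel. f n z) \<longlonglongrightarrow> (LINT z|lborel. dir_deriv e \<phi> z)"
  proof (rule integral_dominated_convergence[where w = "\<lambda>z. B * indicator ?D z"])
    show "integrable lborel (\<lambda>z. B * indicator ?D z)"
      using emeasure_bounded_finite[of ?D] by (intro integrable_mult_right integrable_real_indicator) auto
    show "f n \<in> borel_measurable lborel" for n unfolding f_def by measurable
    show "AE z in lborel. (\<lambda>n. f n z) \<longlonglongrightarrow> dir_deriv e \<phi> z"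
    proof (rule AE_I2)
      fix z
      have "((\<lambda>h. (\<phi> (z + h *\<^sub>R e) - \<phi> z) / h) \<longlongrightarrow> dir_deriv e \<phi> z) (at 0)"
        using line_deriv[OF df, of z e 0] by (simp add: has_field_derivative_iff)
      moreover have "filterlim (\<lambda>n. 1 / real (Suc n)) (at 0) sequentially"
        using LIMSEQ_inverse_real_of_nat by (auto simp: filterlim_at inverse_eq_divide)
      ultimately have "(\<lambda>n. (\<phi> (z + (1 / real (Suc n)) *\<^sub>R e) - \<phi> z) / (1 / real (Suc n))) \<longlonglongrightarrow> dir_deriv e \<phi> z"
        by (rule filterlim_compose)
      thus "(\<lambda>n. f n z) \<longlonglongrightarrow> dir_deriv e \<phi> z" by (simp add: f_def field_simps)
    qed
    show "AE z in lborel. norm (f n z) \<le> B * indicator ?D z" for n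
    proof (rule AE_I2)
      fix z
      let ?r = "1 / real (Suc n)"
      have r: "0 < ?r" "?r \<le> 1" by auto
      show "norm (f n z) \<le> B * indicator ?D z"
      proof (cases "z \<in> ?D")
        case True
        have "\<exists>s. 0 < s \<and> s < ?r \<and> \<phi> (z + ?r *\<^sub>R e) - \<phi> (z + 0 *\<^sub>R e) = (?r - 0) * dir_deriv e \<phi> (z + s *\<^sub>R e)"
          by (rule MVT2[OF r(1)]) (auto intro!: line_deriv df)
        then obtain s where "\<phi> (z + ?r *\<^sub>R e) - \<phi> z = ?r * dir_deriv e \<phi> (z + s *\<^sub>R e)" by auto
        hence "f n z = dir_deriv e \<phi> (z + s *\<^sub>R e)" by (simp add: f_def)
        thus ?thesis using B(2) True by simp
      next
        case False
        hence n: "norm z > R + norm e" by simp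
        hence "z \<notin> K" using R[of z] norm_ge_zero[of e] by fastforce
        moreover have "z + ?r *\<^sub>R e \<notin> K"
        proof
          assume "z + ?r *\<^sub>R e \<in> K"
          hence "norm (z + ?r *\<^sub>R e) \<le> R" by (rule R)
          moreover have "norm z \<le> norm (z + ?r *\<^sub>R e) + norm (?r *\<^sub>R e)"
            using norm_triangle_ineq4[of "z + ?r *\<^sub>R e" "?r *\<^sub>R e"] by simp
          moreover have "norm (?r *\<^sub>R e) \<le> norm e" using r mult_right_mono[of ?r 1 "norm e"] by simp
          ultimately show False using n by simp
        qed
        ultimately show ?thesis using K(2) False by (simp add: f_def)
      qed
    qed
  qed auto
  thus ?thesis using fint by (simp add: LIMSEQ_const_iff)
qed

section \<open>The function exp (-1/t) and cutoffs exhausting the triangle\<close>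

text \<open>The functions q(1/t) exp (-1/t), extended by 0, form a class closed under
  differentiation that contains all derivatives of exp (-1/t).\<close>

definition flat :: "real poly \<Rightarrow> real \<Rightarrow> real" where
  "flat q t = (if t > 0 then poly q (1 / t) * exp (- (1 / t)) else 0)"

lemma poly_times_exp_neg_tendsto_0:
  fixes q :: "real poly"
  shows "((\<lambda>x. poly q x * exp (- x)) \<longlongrightarrow> 0) at_top"
proof -
  have "((\<lambda>x. \<Sum>i\<le>degree q. coeff q i * (x ^ i / exp x)) \<longlongrightarrow> (\<Sum>i\<le>degree q. coeff q i * 0)) at_top"
    by (intro tendsto_intros tendsto_power_div_exp_0)
  moreover have "poly q x * exp (- x) = (\<Sum>i\<le>degree q. coeff q i * (x ^ i / exp x))" for x
    by (simp add: poly_altdef exp_minus sum_distrib_right divide_inverse mult.assoc)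
  ultimately show ?thesis by simp
qed

text \<open>Only t = 0 needs a limit: with x = 1/h the right difference quotient is x q(x) exp (-x),
  which tends to 0.\<close>

lemma flat_deriv: "(flat q has_real_derivative flat (monom 1 2 * (q - pderiv q)) t) (at t)"
proof -
  consider "t > 0" | "t < 0" | "t = 0" by linarith
  thus ?thesis
  proof cases
    case 1
    have "((\<lambda>t. poly q (1 / t) * exp (- (1 / t))) has_real_derivative flat (monom 1 2 * (q - pderiv q)) t) (at t)"
      using 1 by (auto intro!: derivative_eq_intros DERIV_chain2[OF poly_DERIV] simp: flat_def poly_monom field_simps power2_eq_square)
    thus ?thesis
      by (rule has_field_derivative_transform_within_open[where S = "{0<..}"]) (use 1 in \<open>auto simp: flat_def\<close>)
  next
    case 2
    have "((\<lambda>t. 0) has_real_derivative flat (monom 1 2 * (q - pderiv q)) t) (at t)"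
      using 2 by (auto simp: flat_def)
    thus ?thesis
      by (rule has_field_derivative_transform_within_open[where S = "{..<0}"]) (use 2 in \<open>auto simp: flat_def\<close>)
  next
    case 3
    have "((\<lambda>h. flat q h / h) \<longlongrightarrow> 0) (at 0)"
      unfolding filterlim_split_at_real
    proof (intro filterlim_split_at)
      show "((\<lambda>h. flat q h / h) \<longlongrightarrow> 0) (at_left 0)"
        by (rule tendsto_eventually, rule eventually_mono[OF eventually_at_left_real[of "-1" 0]]) (auto simp: flat_def)
      have "((\<lambda>x. poly (pCons 0 q) x * exp (- x)) \<longlongrightarrow> 0) at_top" by (rule poly_times_exp_neg_tendsto_0)
      hence "((\<lambda>h. poly (pCons 0 q) (inverse h) * exp (- inverse h)) \<longlongrightarrow> 0) (at_right 0)"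
        by (rule filterlim_compose[OF _ filterlim_inverse_at_top_right])
      thus "((\<lambda>h. flat q h / h) \<longlongrightarrow> 0) (at_right 0)"
        by (rule Lim_transform_eventually) (rule eventually_mono[OF eventually_at_right_real[of 0 1]], auto simp: flat_def field_simps)
    qed
    thus ?thesis using 3 by (simp add: has_field_derivative_iff flat_def)
  qed
qed

primrec flat_poly :: "nat \<Rightarrow> real poly" where
  "flat_poly 0 = 1"
| "flat_poly (Suc n) = monom 1 2 * (flat_poly n - pderiv (flat_poly n))"

lemma flat_poly_deriv: "(flat (flat_poly i) has_real_derivative flat (flat_poly (Suc i)) t) (at t)"
  using flat_deriv by simp

text \<open>Not compactly supported: it is 0 for t \<le> 0 and increases to 1 at infinity. Hence
  bump (t / \<delta> - 1) vanishes for t \<le> \<delta> and tends to 1 for each t > 0 as \<delta>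
  tends to 0.\<close>

abbreviation bump :: "real \<Rightarrow> real" where "bump \<equiv> flat (flat_poly 0)"
abbreviation bump' :: "real \<Rightarrow> real" where "bump' \<equiv> flat (flat_poly (Suc 0))"

lemma bump_bounds: "0 \<le> bump t" "bump t \<le> 1"
  by (auto simp: flat_def)

text \<open>The derivative of t |-> bump (t / \<delta> - 1) is at most 3 / t uniformly in \<delta>,
  so a factor that vanishes linearly compensates it. With w = 1 / (t / \<delta> - 1) the product is
  (w + w^2) exp (-w), and 1 + w + w^2 / 2 \<le> exp w gives 3.\<close>

lemma bump'_bound:
  assumes "\<delta> > 0" "t \<ge> 0" shows "\<bar>t / \<delta> * bump' (t / \<delta> - 1)\<bar> \<le> 3"
proof (cases "t / \<delta> - 1 > 0")
  case True
  define w where "w = 1 / (t / \<delta> - 1)"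
  have w: "w > 0" using True by (simp add: w_def)
  have r: "t / \<delta> = 1 / w + 1" using True by (simp add: w_def)
  have "t / \<delta> * bump' (t / \<delta> - 1) = (1 / w + 1) * (w\<^sup>2 * exp (- w))"
    using True by (simp add: flat_def w_def[symmetric] r[symmetric] poly_monom)
  also have "\<dots> = (w + w\<^sup>2) / exp w" using w by (simp add: field_simps power2_eq_square exp_minus)
  finally have eq: "t / \<delta> * bump' (t / \<delta> - 1) = (w + w\<^sup>2) / exp w" .
  have "1 + w + w\<^sup>2 / 2 \<le> exp w" using w by (intro exp_lower_Taylor_quadratic) auto
  hence "w + w\<^sup>2 \<le> 3 * exp w" using w zero_le_power2[of w] by linarith
  hence "(w + w\<^sup>2) / exp w \<le> 3" by (simp add: divide_le_eq)
  thus ?thesis unfolding eq using w by simp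
qed (auto simp: flat_def)

lemma cutoff_limits:
  assumes "t > 0"
  shows "(\<lambda>n. bump (t * real (Suc n) - 1)) \<longlonglongrightarrow> 1"
    and "(\<lambda>n. real (Suc n) * bump' (t * real (Suc n) - 1)) \<longlonglongrightarrow> 0"
proof -
  have top: "filterlim (\<lambda>n. t * real (Suc n) - 1) at_top sequentially"
    using filterlim_tendsto_add_at_top[OF tendsto_const[of "- 1"] filterlim_tendsto_pos_mult_at_top[OF tendsto_const[of t] assms
      filterlim_compose[OF filterlim_real_sequentially filterlim_Suc]]] by simp
  have lim1: "(bump \<longlongrightarrow> exp (- 0)) at_top"
  proof (rule Lim_transform_eventually)
    show "((\<lambda>t::real. exp (- inverse t)) \<longlongrightarrow> exp (- 0)) at_top"
      by (intro tendsto_intros tendsto_inverse_0_at_top filterlim_ident)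
    show "\<forall>\<^sub>F t in at_top. exp (- inverse t) = bump t"
      using eventually_gt_at_top[of 0] by eventually_elim (auto simp: flat_def inverse_eq_divide)
  qed
  show "(\<lambda>n. bump (t * real (Suc n) - 1)) \<longlonglongrightarrow> 1"
    using filterlim_compose[OF lim1 top] by simp
  have lim2: "((\<lambda>r. (r + 1) * bump' r) \<longlongrightarrow> (0 + 0\<^sup>2) * exp (- 0)) at_top"
  proof (rule Lim_transform_eventually)
    show "((\<lambda>t::real. (inverse t + (inverse t)\<^sup>2) * exp (- inverse t)) \<longlongrightarrow> (0 + 0\<^sup>2) * exp (- 0)) at_top"
      by (intro tendsto_intros tendsto_inverse_0_at_top filterlim_ident)
    show "\<forall>\<^sub>F t in at_top. (inverse t + (inverse t)\<^sup>2) * exp (- inverse t) = (t + 1) * bump' t"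
      using eventually_gt_at_top[of 0]
      by eventually_elim (auto simp: flat_def poly_monom field_simps power2_eq_square)
  qed
  have "(\<lambda>n. (1 / t) * ((t * real (Suc n) - 1 + 1) * bump' (t * real (Suc n) - 1))) \<longlonglongrightarrow> (1 / t) * 0"
    using filterlim_compose[OF lim2 top] by (intro tendsto_intros) simp
  thus "(\<lambda>n. real (Suc n) * bump' (t * real (Suc n) - 1)) \<longlonglongrightarrow> 0"
    using assms by simp
qed

text \<open>One factor per barycentric coordinate, at scale \<delta> = 1 / (n + 1); the support lies
  where all three coordinates are at least \<delta>.\<close>

definition cutoff :: "nat \<Rightarrow> real \<times> real \<Rightarrow> real" where
  "cutoff n z = bump (fst z * real (Suc n) - 1) * bump (snd z * real (Suc n) - 1) *
                bump ((1 - fst z - snd z) * real (Suc n) - 1)"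

lemma smooth_cutoff: "smooth (cutoff n)"
  and dir_deriv_cutoff: "dir_deriv e (cutoff n) z = real (Suc n) *
    (fst e * bump' (fst z * real (Suc n) - 1) * bump (snd z * real (Suc n) - 1) * bump ((1 - fst z - snd z) * real (Suc n) - 1)
   + snd e * bump (fst z * real (Suc n) - 1) * bump' (snd z * real (Suc n) - 1) * bump ((1 - fst z - snd z) * real (Suc n) - 1)
   - (fst e + snd e) * bump (fst z * real (Suc n) - 1) * bump (snd z * real (Suc n) - 1) * bump' ((1 - fst z - snd z) * real (Suc n) - 1))"
proof -
  let ?G = "\<lambda>i. flat (flat_poly i)" and ?r = "real (Suc n)"
  note C = Ck_compose_affine[where G = ?G, OF flat_poly_deriv]
  let ?f = "\<lambda>z. ?G 0 (?r * fst z + 0 * snd z + (-1))"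
  let ?g = "\<lambda>z. ?G 0 (0 * fst z + ?r * snd z + (-1))"
  let ?k = "\<lambda>z. ?G 0 ((- ?r) * fst z + (- ?r) * snd z + (?r - 1))"
  have eq: "cutoff n = (\<lambda>z. ?f z * ?g z * ?k z)"
    unfolding cutoff_def fun_eq_iff by (simp add: algebra_simps del: flat_poly.simps)
  have s: "smooth ?f" "smooth ?g" "smooth ?k" using C(1) by blast+
  show "smooth (cutoff n)" unfolding eq using s by (intro allI Ck_mult) auto
  have "dir_deriv e (cutoff n) z = ?f z * ?g z * dir_deriv e ?k z + (?f z * dir_deriv e ?g z + dir_deriv e ?f z * ?g z) * ?k z"
  proof -
    have fg: "smooth (\<lambda>z. ?f z * ?g z)" using s by (intro allI Ck_mult) auto
    show ?thesis unfolding eq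
      unfolding dir_deriv_mult[OF smooth_differentiable[OF fg] smooth_differentiable[OF s(3)]]
        dir_deriv_mult[OF smooth_differentiable[OF s(1)] smooth_differentiable[OF s(2)]] ..
  qed
  thus "dir_deriv e (cutoff n) z = real (Suc n) *
    (fst e * bump' (fst z * real (Suc n) - 1) * bump (snd z * real (Suc n) - 1) * bump ((1 - fst z - snd z) * real (Suc n) - 1)
   + snd e * bump (fst z * real (Suc n) - 1) * bump' (snd z * real (Suc n) - 1) * bump ((1 - fst z - snd z) * real (Suc n) - 1)
   - (fst e + snd e) * bump (fst z * real (Suc n) - 1) * bump (snd z * real (Suc n) - 1) * bump' ((1 - fst z - snd z) * real (Suc n) - 1))"
    unfolding C(2) by (simp add: algebra_simps del: flat_poly.simps of_nat_Suc)
qed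

lemma cutoff_bounds: "\<bar>cutoff n z\<bar> \<le> 1"
  using bump_bounds by (auto simp: cutoff_def abs_mult intro!: mult_le_one simp del: flat_poly.simps)

lemma test_function_cutoff: "test_function (interior triangle) (cutoff n)"
proof -
  let ?K = "{z::real\<times>real. 1 \<le> fst z * real (Suc n) \<and> 1 \<le> snd z * real (Suc n) \<and> 1 \<le> (1 - fst z - snd z) * real (Suc n)}"
  have "{z. cutoff n z \<noteq> 0} \<subseteq> ?K"
    by (auto simp: cutoff_def flat_def split: if_splits)
  moreover have clK: "closed ?K"
    by (intro closed_Collect_conj closed_Collect_le continuous_intros)
  ultimately have c: "closure {z. cutoff n z \<noteq> 0} \<subseteq> ?K" by (rule closure_minimal)
  have "?K \<subseteq> interior triangle"
  proof
    fix z assume z: "z \<in> ?K"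
    have "t > 0" if "1 \<le> t * real (Suc n)" for t
      using that by (metis less_le_trans mult_pos_pos not_le of_nat_0_le_iff zero_less_one zero_less_mult_pos2 of_nat_0_less_iff zero_less_Suc)
    thus "z \<in> interior triangle" using z by (fastforce simp: interior_triangle)
  qed
  hence sub: "closure {z. cutoff n z \<noteq> 0} \<subseteq> interior triangle" using c by blast
  hence "bounded (closure {z. cutoff n z \<noteq> 0})"
    using compact_imp_bounded[OF compact_triangle] interior_subset bounded_subset by blast
  thus ?thesis unfolding test_function_def using sub smooth_cutoff by (simp add: compact_eq_bounded_closed)
qed

section \<open>Weak derivatives and the differential operator\<close>

context apk_weight
begin

section \<open>Weak derivatives in a fixed direction\<close>

text \<open>Integrability is not built in; for members of \<open>wL2 h\<close> it comes from
  \<open>wL2_test_integrable\<close>.\<close>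

definition weak_deriv :: "real \<times> real \<Rightarrow> (real \<times> real \<Rightarrow> real) \<Rightarrow> (real \<times> real \<Rightarrow> real) \<Rightarrow> bool" where
  "weak_deriv e v g \<longleftrightarrow> (\<forall>\<phi>. test_function (interior triangle) \<phi> \<longrightarrow>
     (LINT z:interior triangle|lebesgue. v z * dir_deriv e \<phi> z) = - (LINT z:interior triangle|lebesgue. g z * \<phi> z))"

lemma wdD: "weak_deriv e v g \<Longrightarrow> test_function (interior triangle) \<phi> \<Longrightarrow>
     (LINT z:interior triangle|lebesgue. v z * dir_deriv e \<phi> z) = - (LINT z:interior triangle|lebesgue. g z * \<phi> z)"
  by (simp add: weak_deriv_def)

lemma test_function_smooth: "test_function \<Omega> \<phi> \<Longrightarrow> smooth \<phi>"
  by (simp add: test_function_def)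

lemma continuous_lebesgue_measurable:
  fixes f :: "real \<times> real \<Rightarrow> real"
  assumes "continuous_on UNIV f" shows "f \<in> borel_measurable lebesgue"
  using borel_measurable_continuous_onI[OF assms] by (simp add: measurable_completion)

text \<open>On the compact support of \<phi> the weight has a lower bound c > 0, so |v| \<le> 1 +
  v^2 \<le> 1 + h v^2 / c there.\<close>

lemma wL2_test_integrable:
  assumes v: "v \<in> wL2 h" and t: "test_function (interior triangle) \<phi>"
  shows "set_integrable lebesgue (interior triangle) (\<lambda>z. v z * \<phi> z)"
proof -
  obtain K B where K: "compact K" "K \<subseteq> interior triangle" "\<And>z. z \<notin> K \<Longrightarrow> \<phi> z = 0"
    and B: "B \<ge> 0" "\<And>z. \<bar>\<phi> z\<bar> \<le> B"
    using test_function_bounds[OF t] by metis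
  obtain c where c: "c > 0" "\<And>z. z \<in> K \<Longrightarrow> h z \<ge> c"
  proof (cases "K = {}")
    case False
    obtain x where x: "x \<in> K" "\<forall>y\<in>K. h x \<le> h y"
      using continuous_attains_inf[OF K(1) False continuous_on_poly_fun[OF poly_fun_h]] by blast
    thus ?thesis using that[of "h x"] h_pos[of x] K(2) by auto
  qed (use that[of 1] in auto)
  have [measurable]: "\<phi> \<in> borel_measurable lebesgue"
    by (rule continuous_lebesgue_measurable[OF smooth_continuous[OF test_function_smooth[OF t]]])
  note [measurable] = wL2_measurable[OF v]
  have [measurable]: "interior triangle \<in> sets lebesgue" by simp
  show ?thesis unfolding set_integrable_def
  proof (rule Bochner_Integration.integrable_bound)
    show "integrable lebesgue (\<lambda>z. B * indicator triangle z + B / c * (indicator triangle z * (h z * (v z)\<^sup>2)))"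
      by (intro Bochner_Integration.integrable_add integrable_indicator_triangle integrable_mult_right wL2_sq_integrable v)
    have "(\<lambda>z. indicator (interior triangle) z *\<^sub>R (v z * \<phi> z)) =
        (\<lambda>z. (indicator triangle z * v z) * \<phi> z * indicator (interior triangle) z)"
      using interior_subset[of triangle] by (auto simp: indicator_def fun_eq_iff)
    also have "\<dots> \<in> borel_measurable lebesgue" by measurable
    finally show "(\<lambda>z. indicator (interior triangle) z *\<^sub>R (v z * \<phi> z)) \<in> borel_measurable lebesgue" .
    show "AE z in lebesgue. norm (indicator (interior triangle) z *\<^sub>R (v z * \<phi> z)) \<le>
       norm (B * indicator triangle z + B / c * (indicator triangle z * (h z * (v z)\<^sup>2)))"
    proof (rule AE_I2)
      fix z
      show "norm (indicator (interior triangle) z *\<^sub>R (v z * \<phi> z)) \<le>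
       norm (B * indicator triangle z + B / c * (indicator triangle z * (h z * (v z)\<^sup>2)))"
      proof (cases "z \<in> K")
        case True
        hence z: "z \<in> interior triangle" "z \<in> triangle" using K(2) interior_subset by auto
        have "\<bar>v z\<bar> \<le> 1 + (v z)\<^sup>2"
          using sum_squares_bound[of "\<bar>v z\<bar>" 1] by simp
        hence "\<bar>v z\<bar> * \<bar>\<phi> z\<bar> \<le> (1 + (v z)\<^sup>2) * B" using B by (intro mult_mono) auto
        also have "\<dots> \<le> (1 + h z * (v z)\<^sup>2 / c) * B"
          using c(1) c(2)[OF True] B(1) mult_right_mono[OF c(2)[OF True], of "(v z)\<^sup>2"]
          by (intro mult_right_mono add_left_mono) (auto simp: field_simps)
        finally show ?thesis using z h_nonneg[OF z(2)] B(1) c(1)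
          by (simp add: abs_mult algebra_simps)
      qed (use K(3) in simp)
    qed
  qed
qed

lemma weak_deriv_add:
  assumes "weak_deriv e v g" "weak_deriv e w k" and L: "v \<in> wL2 h" "g \<in> wL2 h" "w \<in> wL2 h" "k \<in> wL2 h"
  shows "weak_deriv e (\<lambda>z. v z + w z) (\<lambda>z. g z + k z)"
  unfolding weak_deriv_def
proof (intro allI impI)
  fix \<phi> assume t: "test_function (interior triangle) \<phi>"
  note i = wL2_test_integrable[OF _ test_function_dir_deriv[OF t]] wL2_test_integrable[OF _ t]
  show "(LINT z:interior triangle|lebesgue. (v z + w z) * dir_deriv e \<phi> z) = - (LINT z:interior triangle|lebesgue. (g z + k z) * \<phi> z)"
    using wdD[OF assms(1) t] wdD[OF assms(2) t] i L by (simp add: distrib_right set_integral_add)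
qed

lemma weak_deriv_direction:
  assumes "weak_deriv e v g" "weak_deriv e' v g'" and L: "v \<in> wL2 h" "g \<in> wL2 h" "g' \<in> wL2 h"
  shows "weak_deriv (a *\<^sub>R e + b *\<^sub>R e') v (\<lambda>z. a * g z + b * g' z)"
  unfolding weak_deriv_def
proof (intro allI impI)
  fix \<phi> assume t: "test_function (interior triangle) \<phi>"
  note i = wL2_test_integrable[OF _ test_function_dir_deriv[OF t]] wL2_test_integrable[OF _ t]
  have "(\<lambda>z. v z * dir_deriv (a *\<^sub>R e + b *\<^sub>R e') \<phi> z) = (\<lambda>z. a * (v z * dir_deriv e \<phi> z) + b * (v z * dir_deriv e' \<phi> z))"
    using smooth_differentiable[OF test_function_smooth[OF t]] by (simp add: dir_deriv_linear algebra_simps)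
  moreover have "(\<lambda>z. (a * g z + b * g' z) * \<phi> z) = (\<lambda>z. a * (g z * \<phi> z) + b * (g' z * \<phi> z))"
    by (simp add: algebra_simps)
  ultimately show "(LINT z:interior triangle|lebesgue. v z * dir_deriv (a *\<^sub>R e + b *\<^sub>R e') \<phi> z)
      = - (LINT z:interior triangle|lebesgue. (a * g z + b * g' z) * \<phi> z)"
    using wdD[OF assms(1) t] wdD[OF assms(2) t] i L by (simp add: set_integral_add)
qed

text \<open>The polynomial is moved onto the test function: \<open>v\<close> is tested against q
  \<phi>.\<close>

lemma weak_deriv_mult:
  assumes "weak_deriv e v g" and q: "poly_fun q" and L: "v \<in> wL2 h" "g \<in> wL2 h"
  shows "weak_deriv e (\<lambda>z. q z * v z) (\<lambda>z. q z * g z + dir_deriv e q z * v z)"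
  unfolding weak_deriv_def
proof (intro allI impI)
  fix \<phi> assume t: "test_function (interior triangle) \<phi>"
  have tq: "test_function (interior triangle) (\<lambda>z. q z * \<phi> z)" "test_function (interior triangle) (\<lambda>z. dir_deriv e q z * \<phi> z)"
      "test_function (interior triangle) (\<lambda>z. q z * dir_deriv e \<phi> z)"
    using t q by (auto intro!: test_function_mult test_function_dir_deriv smooth_poly_fun)
  note i = wL2_test_integrable[OF L(1)] wL2_test_integrable[OF L(2)]
  have "(\<lambda>z. v z * dir_deriv e (\<lambda>z. q z * \<phi> z) z) = (\<lambda>z. v z * (q z * dir_deriv e \<phi> z) + v z * (dir_deriv e q z * \<phi> z))"
    using smooth_differentiable[OF test_function_smooth[OF t]] differentiable_poly_fun[OF q]
    by (simp add: dir_deriv_mult distrib_left)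
  hence "(LINT z:interior triangle|lebesgue. v z * (q z * dir_deriv e \<phi> z)) + (LINT z:interior triangle|lebesgue. v z * (dir_deriv e q z * \<phi> z))
     = - (LINT z:interior triangle|lebesgue. g z * (q z * \<phi> z))"
    using wdD[OF assms(1) tq(1)] i tq by (simp add: set_integral_add)
  moreover have "(\<lambda>z. (q z * g z + dir_deriv e q z * v z) * \<phi> z) = (\<lambda>z. g z * (q z * \<phi> z) + v z * (dir_deriv e q z * \<phi> z))"
    by (simp add: algebra_simps)
  moreover have "(\<lambda>z. q z * v z * dir_deriv e \<phi> z) = (\<lambda>z. v z * (q z * dir_deriv e \<phi> z))" by (simp add: mult_ac)
  ultimately show "(LINT z:interior triangle|lebesgue. q z * v z * dir_deriv e \<phi> z)
      = - (LINT z:interior triangle|lebesgue. (q z * g z + dir_deriv e q z * v z) * \<phi> z)"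
    using i tq by (simp add: set_integral_add)
qed

text \<open>The product q \<phi> is a test function, so its derivative has integral 0.\<close>

lemma weak_deriv_poly_fun:
  assumes q: "poly_fun q" shows "weak_deriv e q (dir_deriv e q)"
  unfolding weak_deriv_def
proof (intro allI impI)
  fix \<phi> assume t: "test_function (interior triangle) \<phi>"
  have tq: "test_function (interior triangle) (\<lambda>z. q z * \<phi> z)"
    using t q by (auto intro!: test_function_mult smooth_poly_fun)
  note tdq = test_function_dir_deriv[OF tq, of e]
  have i: "set_integrable lebesgue (interior triangle) (\<lambda>z. q z * dir_deriv e \<phi> z)"
     "set_integrable lebesgue (interior triangle) (\<lambda>z. dir_deriv e q z * \<phi> z)"
    using q by (auto intro!: wL2_test_integrable wL2_poly_fun test_function_dir_deriv t)
  have "(LINT z:interior triangle|lebesgue. dir_deriv e (\<lambda>z. q z * \<phi> z) z) = (LINT z|lebesgue. dir_deriv e (\<lambda>z. q z * \<phi> z) z)"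
  proof -
    obtain K where "K \<subseteq> interior triangle" "\<And>z. z \<notin> K \<Longrightarrow> dir_deriv e (\<lambda>z. q z * \<phi> z) z = 0"
      using test_function_bounds[OF tdq] by metis
    hence "(\<lambda>z. indicator (interior triangle) z *\<^sub>R dir_deriv e (\<lambda>z. q z * \<phi> z) z) = dir_deriv e (\<lambda>z. q z * \<phi> z)"
      by (force simp: indicator_def fun_eq_iff)
    thus ?thesis by (simp add: set_lebesgue_integral_def)
  qed
  also have "\<dots> = (LINT z|lborel. dir_deriv e (\<lambda>z. q z * \<phi> z) z)"
    by (intro integral_completion) (auto intro!: borel_measurable_continuous_onI smooth_continuous test_function_smooth[OF tdq])
  also have "\<dots> = 0" by (rule integral_dir_deriv_test_function[OF tq])
  finally have "(LINT z:interior triangle|lebesgue. dir_deriv e (\<lambda>z. q z * \<phi> z) z) = 0" .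
  moreover have "dir_deriv e (\<lambda>z. q z * \<phi> z) = (\<lambda>z. q z * dir_deriv e \<phi> z + dir_deriv e q z * \<phi> z)"
    using smooth_differentiable[OF test_function_smooth[OF t]] differentiable_poly_fun[OF q]
    by (simp add: dir_deriv_mult fun_eq_iff)
  ultimately show "(LINT z:interior triangle|lebesgue. q z * dir_deriv e \<phi> z) = - (LINT z:interior triangle|lebesgue. dir_deriv e q z * \<phi> z)"
    using i by (simp add: set_integral_add)
qed

section \<open>Iterated weak differentiability\<close>

text \<open>Here a derivative lies again in a space of the same kind, which suits induction on the
  order and multiplication by polynomials. In \<open>wSobolev\<close> every derivative refers back
  to the original function.\<close>

primrec sobolev :: "nat \<Rightarrow> (real \<times> real \<Rightarrow> real) \<Rightarrow> bool" where
  "sobolev 0 v \<longleftrightarrow> v \<in> wL2 h"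
| "sobolev (Suc m) v \<longleftrightarrow> v \<in> wL2 h \<and> (\<forall>e. \<exists>g. weak_deriv e v g \<and> sobolev m g)"

lemma sobolev_wL2: "sobolev m v \<Longrightarrow> v \<in> wL2 h"
  by (cases m) auto

lemma sobolev_lower: "sobolev (Suc m) v \<Longrightarrow> sobolev m v"
proof (induction m arbitrary: v)
  case (Suc m)
  show ?case unfolding sobolev.simps(2)[of m]
  proof (intro conjI allI)
    show "v \<in> wL2 h" using Suc.prems by simp
    fix e
    obtain g where "weak_deriv e v g" "sobolev (Suc m) g" using Suc.prems unfolding sobolev.simps(2)[of "Suc m"] by blast
    thus "\<exists>g. weak_deriv e v g \<and> sobolev m g" using Suc.IH by blast
  qed
qed auto

lemma sobolev_add: "sobolev m v \<Longrightarrow> sobolev m w \<Longrightarrow> sobolev m (\<lambda>z. v z + w z)"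
proof (induction m arbitrary: v w)
  case (Suc m)
  show ?case unfolding sobolev.simps
  proof (intro conjI allI)
    show "(\<lambda>z. v z + w z) \<in> wL2 h" using Suc.prems by (auto intro: wL2_add)
    fix e
    obtain g k where "weak_deriv e v g" "sobolev m g" "weak_deriv e w k" "sobolev m k" using Suc.prems unfolding sobolev.simps by blast
    thus "\<exists>g. weak_deriv e (\<lambda>z. v z + w z) g \<and> sobolev m g"
      using Suc.prems by (intro exI[of _ "\<lambda>z. g z + k z"] conjI weak_deriv_add Suc.IH) (auto intro: sobolev_wL2)
  qed
qed (auto intro: wL2_add)

lemma sobolev_mult: "sobolev m v \<Longrightarrow> poly_fun q \<Longrightarrow> sobolev m (\<lambda>z. q z * v z)"
proof (induction m arbitrary: v q)
  case (Suc m)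
  show ?case unfolding sobolev.simps
  proof (intro conjI allI)
    show "(\<lambda>z. q z * v z) \<in> wL2 h" using Suc.prems by (auto intro: wL2_cont_mult continuous_on_poly_fun)
    fix e
    obtain g where "weak_deriv e v g" "sobolev m g" using Suc.prems unfolding sobolev.simps by blast
    thus "\<exists>g. weak_deriv e (\<lambda>z. q z * v z) g \<and> sobolev m g"
      using Suc.prems sobolev_lower[OF Suc.prems(1)]
      by (intro exI[of _ "\<lambda>z. q z * g z + dir_deriv e q z * v z"] conjI weak_deriv_mult sobolev_add Suc.IH) (auto intro: sobolev_wL2)
  qed
qed (auto intro: wL2_cont_mult continuous_on_poly_fun)

lemma sobolev_cmult: "sobolev m v \<Longrightarrow> sobolev m (\<lambda>z. c * v z)"
  by (rule sobolev_mult) auto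

lemma partial_eq_dir_deriv: "partial_x = dir_deriv (1, 0)" "partial_y = dir_deriv (0, 1)"
  by (auto simp: fun_eq_iff partial_x_def partial_y_def dir_deriv_def)

lemma smooth_dir_deriv_pow: "smooth f \<Longrightarrow> smooth ((dir_deriv e ^^ i) f)"
  by (induction i) (auto intro!: smooth_dir_deriv)

lemma dir_deriv_pow_commute: "smooth f \<Longrightarrow> (dir_deriv e ^^ i) (dir_deriv e' f) = dir_deriv e' ((dir_deriv e ^^ i) f)"
proof (induction i)
  case (Suc i)
  thus ?case using dir_deriv_commute[OF smooth_dir_deriv_pow[OF Suc.prems, of i e], of e e'] by simp
qed auto

text \<open>The generalised claim \<open>main\<close> says that the (i, j) derivative of
  \<open>u\<close> keeps m - i - j weak derivatives. These are taken from the next multi-indices of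
  \<open>u\<close>; commuting derivatives of test functions identify them as weak derivatives of
  \<open>g\<close>.\<close>

lemma wSobolev_imp_sobolev:
  assumes u: "u \<in> wSobolev m h" shows "sobolev m u"
proof -
  have ex: "\<exists>g \<in> wL2 h. is_distr_deriv (interior triangle) i j u g" if "i + j \<le> m" for i j
    using u that by (simp add: wSobolev_def)
  have main: "sobolev r g" if "i + j + r \<le> m" "g \<in> wL2 h" "is_distr_deriv (interior triangle) i j u g" for r i j g
    using that
  proof (induction r arbitrary: i j g)
    case (Suc r)
    obtain gx where gx: "gx \<in> wL2 h" "is_distr_deriv (interior triangle) (Suc i) j u gx"
      using ex[of "Suc i" j] Suc.prems by auto
    obtain gy where gy: "gy \<in> wL2 h" "is_distr_deriv (interior triangle) i (Suc j) u gy"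
      using ex[of i "Suc j"] Suc.prems by auto
    have "weak_deriv (1, 0) g gx" unfolding weak_deriv_def
    proof (intro allI impI)
      fix \<phi> assume t: "test_function (interior triangle) \<phi>"
      have "(dir_deriv (0, 1) ^^ j) (dir_deriv (1, 0) \<phi>) = dir_deriv (1, 0) ((dir_deriv (0, 1) ^^ j) \<phi>)"
        by (rule dir_deriv_pow_commute[OF test_function_smooth[OF t]])
      hence *: "(dir_deriv (1, 0) ^^ i) ((dir_deriv (0, 1) ^^ j) (dir_deriv (1, 0) \<phi>)) = (dir_deriv (1, 0) ^^ Suc i) ((dir_deriv (0, 1) ^^ j) \<phi>)"
        by (simp add: funpow_swap1)
      have "(- 1) ^ (i + j) * (LINT z:interior triangle|lebesgue. g z * dir_deriv (1, 0) \<phi> z)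
          = (- 1) ^ (Suc i + j) * (LINT z:interior triangle|lebesgue. gx z * \<phi> z)"
      proof -
        have "(LINT z:interior triangle|lebesgue. u z * (dir_deriv (1, 0) ^^ i) ((dir_deriv (0, 1) ^^ j) (dir_deriv (1, 0) \<phi>)) z)
            = (- 1) ^ (i + j) * (LINT z:interior triangle|lebesgue. g z * dir_deriv (1, 0) \<phi> z)"
          using Suc.prems(3) test_function_dir_deriv[OF t] unfolding is_distr_deriv_def partial_eq_dir_deriv by blast
        moreover have "(LINT z:interior triangle|lebesgue. u z * (dir_deriv (1, 0) ^^ Suc i) ((dir_deriv (0, 1) ^^ j) \<phi>) z)
            = (- 1) ^ (Suc i + j) * (LINT z:interior triangle|lebesgue. gx z * \<phi> z)"
          using gx(2) t unfolding is_distr_deriv_def partial_eq_dir_deriv by blast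
        ultimately show ?thesis using * by simp
      qed
      hence "(- 1) ^ (i + j) * (LINT z:interior triangle|lebesgue. g z * dir_deriv (1, 0) \<phi> z)
          = (- 1) ^ (i + j) * - (LINT z:interior triangle|lebesgue. gx z * \<phi> z)" by simp
      thus "(LINT z:interior triangle|lebesgue. g z * dir_deriv (1, 0) \<phi> z) = - (LINT z:interior triangle|lebesgue. gx z * \<phi> z)"
        by (subst (asm) mult_cancel_left) simp
    qed
    moreover have "weak_deriv (0, 1) g gy" unfolding weak_deriv_def
    proof (intro allI impI)
      fix \<phi> assume t: "test_function (interior triangle) \<phi>"
      have *: "(dir_deriv (1, 0) ^^ i) ((dir_deriv (0, 1) ^^ j) (dir_deriv (0, 1) \<phi>)) = (dir_deriv (1, 0) ^^ i) ((dir_deriv (0, 1) ^^ Suc j) \<phi>)"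
        by (simp add: funpow_swap1)
      have "(- 1) ^ (i + j) * (LINT z:interior triangle|lebesgue. g z * dir_deriv (0, 1) \<phi> z)
          = (- 1) ^ (i + Suc j) * (LINT z:interior triangle|lebesgue. gy z * \<phi> z)"
      proof -
        have "(LINT z:interior triangle|lebesgue. u z * (dir_deriv (1, 0) ^^ i) ((dir_deriv (0, 1) ^^ j) (dir_deriv (0, 1) \<phi>)) z)
            = (- 1) ^ (i + j) * (LINT z:interior triangle|lebesgue. g z * dir_deriv (0, 1) \<phi> z)"
          using Suc.prems(3) test_function_dir_deriv[OF t] unfolding is_distr_deriv_def partial_eq_dir_deriv by blast
        moreover have "(LINT z:interior triangle|lebesgue. u z * (dir_deriv (1, 0) ^^ i) ((dir_deriv (0, 1) ^^ Suc j) \<phi>) z)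
            = (- 1) ^ (i + Suc j) * (LINT z:interior triangle|lebesgue. gy z * \<phi> z)"
          using gy(2) t unfolding is_distr_deriv_def partial_eq_dir_deriv by blast
        ultimately show ?thesis using * by simp
      qed
      hence "(- 1) ^ (i + j) * (LINT z:interior triangle|lebesgue. g z * dir_deriv (0, 1) \<phi> z)
          = (- 1) ^ (i + j) * - (LINT z:interior triangle|lebesgue. gy z * \<phi> z)" by simp
      thus "(LINT z:interior triangle|lebesgue. g z * dir_deriv (0, 1) \<phi> z) = - (LINT z:interior triangle|lebesgue. gy z * \<phi> z)"
        by (subst (asm) mult_cancel_left) simp
    qed
    moreover have "sobolev r gx" "sobolev r gy"
      using Suc.IH[of "Suc i" j gx] Suc.IH[of i "Suc j" gy] Suc.prems gx gy by auto
    ultimately show ?case unfolding sobolev.simps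
    proof (intro conjI allI)
      fix e :: "real \<times> real"
      assume wx: "weak_deriv (1, 0) g gx" and wy: "weak_deriv (0, 1) g gy" and sobolev: "sobolev r gx" "sobolev r gy"
      have e: "e = fst e *\<^sub>R (1, 0) + snd e *\<^sub>R (0, 1)" by (cases e) simp
      have "weak_deriv e g (\<lambda>z. fst e * gx z + snd e * gy z)"
        by (subst (1) e, rule weak_deriv_direction) (use wx wy gx gy Suc.prems in auto)
      thus "\<exists>g'. weak_deriv e g g' \<and> sobolev r g'" using sobolev by (intro exI[of _ "\<lambda>z. fst e * gx z + snd e * gy z"] conjI sobolev_add sobolev_cmult)
    qed (use Suc.prems in auto)
  qed auto
  have "is_distr_deriv (interior triangle) 0 0 u u"
    using ex[of 0 0] by (auto simp: is_distr_deriv_def)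
  moreover have "u \<in> wL2 h" using u by (simp add: wSobolev_def)
  ultimately show ?thesis using main[of 0 0 m u] by simp
qed

text \<open>A direction \<open>e\<close>, a coefficient \<open>\<rho>\<close> vanishing on the edges that \<open>e\<close> crosses, and
  \<open>\<kappa> = \<partial>\<^sub>e (h \<rho>) / h\<close>.\<close>

definition admissible :: "real \<times> real \<Rightarrow> (real \<times> real \<Rightarrow> real) \<Rightarrow> (real \<times> real \<Rightarrow> real) \<Rightarrow> bool" where
  "admissible e \<rho> \<kappa> \<longleftrightarrow> poly_fun \<rho> \<and> poly_fun \<kappa> \<and> (\<forall>z. dir_deriv e (\<lambda>z. h z * \<rho> z) z = h z * \<kappa> z) \<and>
     (\<forall>z\<in>triangle. \<bar>\<rho> z * fst e\<bar> \<le> fst z \<and> \<bar>\<rho> z * snd e\<bar> \<le> snd z \<and> \<bar>\<rho> z * (fst e + snd e)\<bar> \<le> 1 - fst z - snd z)"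

text \<open>Dominated convergence, used for the cutoffs with \<open>M = 1\<close> and for \<rho>
  times their derivatives with \<open>M = 0\<close>.\<close>

lemma set_integral_multiplier_limit:
  assumes F: "set_integrable lebesgue triangle F"
    and m: "\<And>n. m n \<in> borel_measurable lebesgue" "\<And>n z. z \<in> triangle \<Longrightarrow> \<bar>m n z\<bar> \<le> B"
    and lim: "\<And>z. z \<in> interior triangle \<Longrightarrow> (\<lambda>n. m n z) \<longlonglongrightarrow> M"
  shows "set_integrable lebesgue (interior triangle) (\<lambda>z. F z * m n z)"
    and "(\<lambda>n. LINT z:interior triangle|lebesgue. F z * m n z) \<longlonglongrightarrow> M * (LINT z:triangle|lebesgue. F z :: real)"
proof -
  note [measurable] = m(1)
  have iF: "integrable lebesgue (\<lambda>z. indicator triangle z * F z)" using F by (simp add: set_integrable_def)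
  hence [measurable]: "(\<lambda>z. indicator triangle z * F z) \<in> borel_measurable lebesgue" by auto
  have [measurable]: "interior triangle \<in> sets lebesgue" by simp
  have meas: "(\<lambda>z. indicator (interior triangle) z *\<^sub>R (F z * m n z)) \<in> borel_measurable lebesgue" for n
  proof -
    have "(\<lambda>z. indicator (interior triangle) z *\<^sub>R (F z * m n z)) =
        (\<lambda>z. (indicator triangle z * F z) * m n z * indicator (interior triangle) z)"
      using interior_subset[of triangle] by (auto simp: indicator_def fun_eq_iff)
    also have "\<dots> \<in> borel_measurable lebesgue" by measurable
    finally show ?thesis .
  qed
  have measM: "(\<lambda>z. indicator (interior triangle) z * (F z * M)) \<in> borel_measurable lebesgue"
  proof -
    have "(\<lambda>z. indicator (interior triangle) z * (F z * M)) =
        (\<lambda>z. (indicator triangle z * F z) * M * indicator (interior triangle) z)"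
      using interior_subset[of triangle] by (auto simp: indicator_def fun_eq_iff)
    also have "\<dots> \<in> borel_measurable lebesgue" by measurable
    finally show ?thesis .
  qed
  have bd: "norm (indicator (interior triangle) z *\<^sub>R (F z * m n z)) \<le> B * \<bar>indicator triangle z * F z\<bar>" for n z
    using m(2)[of z n] interior_subset[of triangle] mult_left_mono[of "\<bar>m n z\<bar>" B "\<bar>F z\<bar>"]
    by (auto simp: indicator_def abs_mult mult.commute)
  have iB: "integrable lebesgue (\<lambda>z. B * \<bar>indicator triangle z * F z\<bar>)"
    using iF by (intro integrable_mult_right integrable_abs)
  show "set_integrable lebesgue (interior triangle) (\<lambda>z. F z * m n z)"
    unfolding set_integrable_def
    by (intro Bochner_Integration.integrable_bound[OF iB meas] AE_I2)
       (rule order.trans[OF bd], simp)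
  have "(\<lambda>n. LINT z|lebesgue. indicator (interior triangle) z *\<^sub>R (F z * m n z)) \<longlonglongrightarrow>
      (LINT z|lebesgue. indicator (interior triangle) z * (F z * M))"
  proof (rule integral_dominated_convergence[OF measM meas iB])
    show "AE z in lebesgue. (\<lambda>n. indicator (interior triangle) z *\<^sub>R (F z * m n z)) \<longlonglongrightarrow> indicator (interior triangle) z * (F z * M)"
      by (rule AE_I2) (auto simp: indicator_def intro!: tendsto_intros lim)
    show "AE z in lebesgue. norm (indicator (interior triangle) z *\<^sub>R (F z * m n z)) \<le> B * \<bar>indicator triangle z * F z\<bar>" for n
      using bd by (intro AE_I2)
  qed
  moreover have "(LINT z|lebesgue. indicator (interior triangle) z * (F z * M)) = M * (LINT z:triangle|lebesgue. F z)"
  proof -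
    have "(LINT z:interior triangle|lebesgue. F z) = (LINT z:triangle|lebesgue. F z)"
      by (rule set_integral_interior_triangle) (use iF in \<open>auto simp: set_borel_measurable_def\<close>)
    moreover have "(\<lambda>z. indicator (interior triangle) z * (F z * M)) = (\<lambda>z. M * (indicator (interior triangle) z *\<^sub>R F z))"
      by (auto simp: mult_ac)
    ultimately show ?thesis unfolding set_lebesgue_integral_def by simp
  qed
  ultimately show "(\<lambda>n. LINT z:interior triangle|lebesgue. F z * m n z) \<longlonglongrightarrow> M * (LINT z:triangle|lebesgue. F z)"
    by (simp add: set_lebesgue_integral_def)
qed

lemma cutoff_tendsto:
  assumes "z \<in> interior triangle"
  shows "(\<lambda>n. cutoff n z) \<longlonglongrightarrow> 1" and "(\<lambda>n. dir_deriv e (cutoff n) z) \<longlonglongrightarrow> 0"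
proof -
  have z: "fst z > 0" "snd z > 0" "1 - fst z - snd z > 0" using assms by (auto simp: interior_triangle)
  note L = cutoff_limits[OF z(1)] cutoff_limits[OF z(2)] cutoff_limits[OF z(3)]
  have "(\<lambda>n. cutoff n z) \<longlonglongrightarrow> 1 * 1 * 1" unfolding cutoff_def by (intro tendsto_mult L)
  thus "(\<lambda>n. cutoff n z) \<longlonglongrightarrow> 1" by simp
  have "(\<lambda>n. fst e * (real (Suc n) * bump' (fst z * real (Suc n) - 1)) * bump (snd z * real (Suc n) - 1) * bump ((1 - fst z - snd z) * real (Suc n) - 1)
   + snd e * bump (fst z * real (Suc n) - 1) * (real (Suc n) * bump' (snd z * real (Suc n) - 1)) * bump ((1 - fst z - snd z) * real (Suc n) - 1)
   - (fst e + snd e) * bump (fst z * real (Suc n) - 1) * bump (snd z * real (Suc n) - 1) * (real (Suc n) * bump' ((1 - fst z - snd z) * real (Suc n) - 1)))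
   \<longlonglongrightarrow> fst e * 0 * 1 * 1 + snd e * 1 * 0 * 1 - (fst e + snd e) * 1 * 1 * 0"
    by (intro tendsto_diff tendsto_add tendsto_mult tendsto_const L)
  thus "(\<lambda>n. dir_deriv e (cutoff n) z) \<longlonglongrightarrow> 0"
    unfolding dir_deriv_cutoff by (simp add: algebra_simps del: flat_poly.simps of_nat_Suc)
qed

lemma bump_product_bound:
  assumes "0 \<le> t" "\<bar>c\<bar> \<le> t"
  shows "\<bar>c * (real (Suc n) * (bump' (t * real (Suc n) - 1) * (bump a * bump b)))\<bar> \<le> 3"
proof -
  have "\<bar>c * (real (Suc n) * (bump' (t * real (Suc n) - 1) * (bump a * bump b)))\<bar>
      = \<bar>c\<bar> * real (Suc n) * \<bar>bump' (t * real (Suc n) - 1)\<bar> * (bump a * bump b)"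
    using bump_bounds by (simp add: abs_mult del: flat_poly.simps of_nat_Suc)
  also have "\<dots> \<le> t * real (Suc n) * \<bar>bump' (t * real (Suc n) - 1)\<bar> * 1"
    using assms bump_bounds by (intro mult_mono mult_le_one) (auto simp del: flat_poly.simps of_nat_Suc)
  also have "\<dots> = \<bar>t / (1 / real (Suc n)) * bump' (t / (1 / real (Suc n)) - 1)\<bar>"
    using assms by (simp add: abs_mult del: flat_poly.simps of_nat_Suc)
  also have "\<dots> \<le> 3" using assms by (intro bump'_bound) auto
  finally show ?thesis .
qed

text \<open>The inequalities in \<open>admissible\<close> bound \<rho> times the rate of change of
  each barycentric coordinate along \<open>e\<close> by that coordinate. The blow-up of the cutoff
  is thereby absorbed, with a bound 3 for each of the three coordinates.\<close>

lemma admissible_cutoff_bound: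
  assumes a: "admissible e \<rho> \<kappa>" and z: "z \<in> triangle"
  shows "\<bar>\<rho> z * dir_deriv e (cutoff n) z\<bar> \<le> 9"
proof -
  let ?r = "real (Suc n)"
  let ?x = "fst z * ?r - 1" and ?y = "snd z * ?r - 1" and ?s = "(1 - fst z - snd z) * ?r - 1"
  have b: "\<bar>\<rho> z * fst e\<bar> \<le> fst z" "\<bar>\<rho> z * snd e\<bar> \<le> snd z" "\<bar>\<rho> z * (fst e + snd e)\<bar> \<le> 1 - fst z - snd z"
    using a z by (auto simp: admissible_def)
  have nn: "fst z \<ge> 0" "snd z \<ge> 0" "1 - fst z - snd z \<ge> 0" using z by (auto simp: triangle_iff)
  have "\<rho> z * dir_deriv e (cutoff n) z = (\<rho> z * fst e) * (?r * (bump' ?x * (bump ?y * bump ?s)))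
      + (\<rho> z * snd e) * (?r * (bump' ?y * (bump ?x * bump ?s)))
      - (\<rho> z * (fst e + snd e)) * (?r * (bump' ?s * (bump ?x * bump ?y)))"
    unfolding dir_deriv_cutoff by (simp add: algebra_simps del: flat_poly.simps of_nat_Suc)
  thus ?thesis
    using bump_product_bound[OF nn(1) b(1), of n ?y ?s] bump_product_bound[OF nn(2) b(2), of n ?x ?s]
      bump_product_bound[OF nn(3) b(3), of n ?x ?y] by linarith
qed

text \<open>Integration by parts against the cutoffs: no boundary term survives because
  \<open>\<rho> * dir_deriv e (cutoff n)\<close> is bounded and tends to \<open>0\<close>.\<close>

lemma weak_integration_by_parts:
  assumes a: "admissible e \<rho> \<kappa>" and v: "v \<in> wL2 h" and g: "g \<in> wL2 h" and w: "weak_deriv e v g" and f: "poly_fun f"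
  shows "ip v (\<lambda>z. \<kappa> z * f z + \<rho> z * dir_deriv e f z) = - ip g (\<lambda>z. \<rho> z * f z)"
proof -
  have \<rho>: "poly_fun \<rho>" and \<kappa>: "poly_fun \<kappa>" and h\<rho>: "\<And>z. dir_deriv e (\<lambda>z. h z * \<rho> z) z = h z * \<kappa> z"
    using a by (auto simp: admissible_def)
  let ?F1 = "\<lambda>z. h z * v z * (\<kappa> z * f z + \<rho> z * dir_deriv e f z)"
  let ?F2 = "\<lambda>z. h z * v z * f z"
  let ?F3 = "\<lambda>z. h z * g z * (\<rho> z * f z)"
  have F: "set_integrable lebesgue triangle ?F1" "set_integrable lebesgue triangle ?F2" "set_integrable lebesgue triangle ?F3"
    using v g f \<rho> \<kappa> by (auto intro!: wL2_integrable wL2_poly_fun poly_fun_add poly_fun_mult poly_fun_dir_deriv)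
  have cm: "cutoff n \<in> borel_measurable lebesgue" "(\<lambda>z. \<rho> z * dir_deriv e (cutoff n) z) \<in> borel_measurable lebesgue" for n
    by (rule continuous_lebesgue_measurable[OF smooth_continuous[OF smooth_cutoff]],
        rule continuous_lebesgue_measurable[OF continuous_on_mult[OF continuous_on_poly_fun[OF \<rho>] smooth_continuous[OF smooth_dir_deriv[OF smooth_cutoff]]]])
  note L1 = set_integral_multiplier_limit[OF F(1) cm(1) cutoff_bounds cutoff_tendsto(1)]
  note L3 = set_integral_multiplier_limit[OF F(3) cm(1) cutoff_bounds cutoff_tendsto(1)]
  have t0: "(\<lambda>n. \<rho> z * dir_deriv e (cutoff n) z) \<longlonglongrightarrow> 0" if "z \<in> interior triangle" for z
    using tendsto_mult[OF tendsto_const[of "\<rho> z"] cutoff_tendsto(2)[OF that, of e]] by simp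
  note L2 = set_integral_multiplier_limit[OF F(2) cm(2) admissible_cutoff_bound[OF a] t0]
  have eq: "(LINT z:interior triangle|lebesgue. ?F1 z * cutoff n z) + (LINT z:interior triangle|lebesgue. ?F2 z * (\<rho> z * dir_deriv e (cutoff n) z))
      = - (LINT z:interior triangle|lebesgue. ?F3 z * cutoff n z)" for n
  proof -
    \<comment> \<open>The test function is h \<rho> f times the cutoff. As the derivative of h
      \<rho> is h \<kappa>, every resulting term retains the factor \<open>h\<close>, and all
      integrals are weighted ones.\<close>
    let ?q = "\<lambda>z. h z * \<rho> z * f z"
    have q: "poly_fun ?q" "poly_fun (\<lambda>z. h z * \<rho> z)" using poly_fun_h \<rho> f by auto
    have t: "test_function (interior triangle) (\<lambda>z. ?q z * cutoff n z)"
      by (intro test_function_mult test_function_cutoff smooth_poly_fun q)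
    have "dir_deriv e (\<lambda>z. ?q z * cutoff n z) z = ?q z * dir_deriv e (cutoff n) z + (h z * \<rho> z * dir_deriv e f z + h z * \<kappa> z * f z) * cutoff n z" for z
      using dir_deriv_mult[OF differentiable_poly_fun[OF q(1)] smooth_differentiable[OF smooth_cutoff]]
        dir_deriv_mult[OF differentiable_poly_fun[OF q(2)] differentiable_poly_fun[OF f]] h\<rho> by simp
    hence "(\<lambda>z. v z * dir_deriv e (\<lambda>z. ?q z * cutoff n z) z) = (\<lambda>z. ?F1 z * cutoff n z + ?F2 z * (\<rho> z * dir_deriv e (cutoff n) z))"
      by (simp add: fun_eq_iff algebra_simps)
    moreover have "(\<lambda>z. g z * (?q z * cutoff n z)) = (\<lambda>z. ?F3 z * cutoff n z)"
      by (simp add: fun_eq_iff mult_ac)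
    ultimately show ?thesis using wdD[OF w t] set_integral_add(2)[OF L1(1) L2(1), of n] by simp
  qed
  have "(\<lambda>n. - (LINT z:interior triangle|lebesgue. ?F3 z * cutoff n z)) \<longlonglongrightarrow>
      1 * (LINT z:triangle|lebesgue. ?F1 z) + 0 * (LINT z:triangle|lebesgue. ?F2 z)"
    unfolding eq[symmetric] by (intro tendsto_add L1(2) L2(2))
  moreover have "(\<lambda>n. - (LINT z:interior triangle|lebesgue. ?F3 z * cutoff n z)) \<longlonglongrightarrow> - (1 * (LINT z:triangle|lebesgue. ?F3 z))"
    by (intro tendsto_minus L3(2))
  ultimately have "(LINT z:triangle|lebesgue. ?F1 z) = - (LINT z:triangle|lebesgue. ?F3 z)"
    using LIMSEQ_unique by fastforce
  thus ?thesis by (simp add: w_inner_def)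
qed

section \<open>The second-order operator as a sum over edges\<close>

text \<open>The divergence form multiplied out by means of \<kappa>, so that nothing is divided by
  the weight and polynomials are mapped to polynomials.\<close>

definition edge_op :: "real \<times> real \<Rightarrow> (real \<times> real \<Rightarrow> real) \<Rightarrow> (real \<times> real \<Rightarrow> real) \<Rightarrow> (real \<times> real \<Rightarrow> real) \<Rightarrow> real \<times> real \<Rightarrow> real" where
  "edge_op e \<rho> \<kappa> q z = \<rho> z * dir_deriv e (dir_deriv e q) z + \<kappa> z * dir_deriv e q z"

text \<open>Two integrations by parts: with \<open>f = dir_deriv e q\<close> the result is
  \<open>- ip g (\<rho> * dir_deriv e q)\<close>, and with \<open>f = q\<close> this is traded for
  \<open>k\<close> and a term in \<kappa>.\<close>

lemma edge_op_weak:
  assumes a: "admissible e \<rho> \<kappa>" and L: "v \<in> wL2 h" "g \<in> wL2 h" "k \<in> wL2 h"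
    and w: "weak_deriv e v g" "weak_deriv e g k" and q: "poly_fun q"
  shows "ip v (edge_op e \<rho> \<kappa> q) = ip (\<lambda>z. \<rho> z * k z + \<kappa> z * g z) q"
proof -
  have \<rho>: "poly_fun \<rho>" and \<kappa>: "poly_fun \<kappa>" using a by (auto simp: admissible_def)
  have c: "continuous_on triangle \<rho>" "continuous_on triangle \<kappa>" using \<rho> \<kappa> by (auto intro: continuous_on_poly_fun)
  have "ip v (edge_op e \<rho> \<kappa> q) = - ip g (\<lambda>z. \<rho> z * dir_deriv e q z)"
    using weak_integration_by_parts[OF a L(1,2) w(1) poly_fun_dir_deriv[OF q]] by (simp add: edge_op_def[abs_def] add.commute)
  moreover have "ip g (\<lambda>z. \<kappa> z * q z) + ip g (\<lambda>z. \<rho> z * dir_deriv e q z) = - ip k (\<lambda>z. \<rho> z * q z)"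
    using weak_integration_by_parts[OF a L(2,3) w(2) q] L q \<rho> \<kappa> by (simp add: ip_add_right wL2_poly_fun poly_fun_mult poly_fun_dir_deriv)
  moreover have "ip (\<lambda>z. \<rho> z * k z + \<kappa> z * g z) q = ip k (\<lambda>z. \<rho> z * q z) + ip g (\<lambda>z. \<kappa> z * q z)"
    using L q c by (simp add: ip_add_left wL2_cont_mult wL2_poly_fun ip_mult_assoc)
  ultimately show ?thesis by simp
qed

abbreviation "\<rho>\<^sub>1 \<equiv> \<lambda>z::real\<times>real. fst z * (1 - fst z - snd z)"
abbreviation "\<rho>\<^sub>2 \<equiv> \<lambda>z::real\<times>real. snd z * (1 - fst z - snd z)"
abbreviation "\<rho>\<^sub>3 \<equiv> \<lambda>z::real\<times>real. fst z * snd z"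
abbreviation "\<kappa>\<^sub>1 \<equiv> \<lambda>z::real\<times>real. real \<alpha> * (1 - fst z - snd z) - (real p + 1) * fst z"
abbreviation "\<kappa>\<^sub>2 \<equiv> \<lambda>z::real\<times>real. real \<beta> * (1 - fst z - snd z) - (real p + 1) * snd z"
abbreviation "\<kappa>\<^sub>3 \<equiv> \<lambda>z::real\<times>real. real \<alpha> * snd z - real \<beta> * fst z"

lemma dir_deriv_monomial:
  "dir_deriv e (\<lambda>z. fst z ^ i * snd z ^ j * (1 - fst z - snd z) ^ k) z =
     real i * fst z ^ (i - 1) * fst e * snd z ^ j * (1 - fst z - snd z) ^ k
   + fst z ^ i * (real j * snd z ^ (j - 1) * snd e) * (1 - fst z - snd z) ^ k
   - fst z ^ i * snd z ^ j * (real k * (1 - fst z - snd z) ^ (k - 1) * (fst e + snd e))"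
  by (rule trans[OF dir_deriv_eqI], (rule derivative_eq_intros refl)+) (simp add: algebra_simps)

lemma admissible_edges:
  "admissible (1, 0) \<rho>\<^sub>1 \<kappa>\<^sub>1" "admissible (0, 1) \<rho>\<^sub>2 \<kappa>\<^sub>2" "admissible (1, -1) \<rho>\<^sub>3 \<kappa>\<^sub>3"
proof -
  \<comment> \<open>With \<alpha> and \<beta> as successors the truncated exponents disappear; each
    \<rho> then raises two of the three exponents by one.\<close>
  obtain a b where ab: "\<alpha> = Suc a" "\<beta> = Suc b" using \<alpha> \<beta> by (metis Suc_le_D One_nat_def)
  have hz: "h z = fst z ^ a * snd z ^ b * (1 - fst z - snd z) ^ p" for z
    unfolding h_eq by (simp add: ab)
  have m: "x * y \<le> x" if "0 \<le> x" "y \<le> 1" for x y :: real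
    using that mult_left_mono[of y 1 x] by simp
  have m': "y * x \<le> x" if "0 \<le> x" "y \<le> 1" for x y :: real
    using m[OF that] by (simp add: mult.commute)
  have "dir_deriv (1, 0) (\<lambda>z. h z * \<rho>\<^sub>1 z) z = h z * \<kappa>\<^sub>1 z" for z
  proof -
    have eq: "(\<lambda>z. h z * \<rho>\<^sub>1 z) = (\<lambda>z. fst z ^ Suc a * snd z ^ b * (1 - fst z - snd z) ^ Suc p)"
      by (auto simp: fun_eq_iff hz)
    show ?thesis unfolding eq unfolding dir_deriv_monomial hz by (simp add: ab algebra_simps)
  qed
  thus "admissible (1, 0) \<rho>\<^sub>1 \<kappa>\<^sub>1" unfolding admissible_def
    by (auto simp: triangle_iff intro!: m m' poly_fun_mult poly_fun_diff)
  have "dir_deriv (0, 1) (\<lambda>z. h z * \<rho>\<^sub>2 z) z = h z * \<kappa>\<^sub>2 z" for z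
  proof -
    have eq: "(\<lambda>z. h z * \<rho>\<^sub>2 z) = (\<lambda>z. fst z ^ a * snd z ^ Suc b * (1 - fst z - snd z) ^ Suc p)"
      by (auto simp: fun_eq_iff hz)
    show ?thesis unfolding eq unfolding dir_deriv_monomial hz by (simp add: ab algebra_simps)
  qed
  thus "admissible (0, 1) \<rho>\<^sub>2 \<kappa>\<^sub>2" unfolding admissible_def
    by (auto simp: triangle_iff intro!: m m' poly_fun_mult poly_fun_diff)
  have "dir_deriv (1, -1) (\<lambda>z. h z * \<rho>\<^sub>3 z) z = h z * \<kappa>\<^sub>3 z" for z
  proof -
    have eq: "(\<lambda>z. h z * \<rho>\<^sub>3 z) = (\<lambda>z. fst z ^ Suc a * snd z ^ Suc b * (1 - fst z - snd z) ^ p)"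
      by (auto simp: fun_eq_iff hz)
    show ?thesis unfolding eq unfolding dir_deriv_monomial hz by (simp add: ab algebra_simps)
  qed
  thus "admissible (1, -1) \<rho>\<^sub>3 \<kappa>\<^sub>3" unfolding admissible_def
    by (auto simp: triangle_iff intro!: m m' poly_fun_mult poly_fun_diff)
qed

definition apk_op :: "(real \<times> real \<Rightarrow> real) \<Rightarrow> real \<times> real \<Rightarrow> real" where
  "apk_op q z = edge_op (1, 0) \<rho>\<^sub>1 \<kappa>\<^sub>1 q z + edge_op (0, 1) \<rho>\<^sub>2 \<kappa>\<^sub>2 q z + edge_op (1, -1) \<rho>\<^sub>3 \<kappa>\<^sub>3 q z"

lemma poly_fun_edge_op: "admissible e \<rho> \<kappa> \<Longrightarrow> poly_fun q \<Longrightarrow> poly_fun (edge_op e \<rho> \<kappa> q)"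
  unfolding edge_op_def[abs_def] admissible_def by (auto intro!: poly_fun_add poly_fun_mult poly_fun_dir_deriv)

lemma poly_fun_apk_op: "poly_fun q \<Longrightarrow> poly_fun (apk_op q)"
  unfolding apk_op_def[abs_def] using admissible_edges by (intro poly_fun_add poly_fun_edge_op) auto

lemma ip_apk_op_right: "v \<in> wL2 h \<Longrightarrow> poly_fun q \<Longrightarrow> ip v (apk_op q) =
    ip v (edge_op (1, 0) \<rho>\<^sub>1 \<kappa>\<^sub>1 q) + ip v (edge_op (0, 1) \<rho>\<^sub>2 \<kappa>\<^sub>2 q) + ip v (edge_op (1, -1) \<rho>\<^sub>3 \<kappa>\<^sub>3 q)"
  unfolding apk_op_def[abs_def] using admissible_edges
  by (simp add: ip_add_right wL2_add wL2_poly_fun poly_fun_edge_op)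

text \<open>The case of \<open>edge_op_weak\<close> in which the weak derivatives of
  \<open>q\<close> are the classical ones.\<close>

lemma apk_op_symmetric:
  assumes q: "poly_fun q" and r: "poly_fun r"
  shows "ip q (apk_op r) = ip (apk_op q) r"
proof -
  have "ip q (edge_op e \<rho> \<kappa> r) = ip (edge_op e \<rho> \<kappa> q) r" if "admissible e \<rho> \<kappa>" for e \<rho> \<kappa>
    using edge_op_weak[OF that _ _ _ weak_deriv_poly_fun[OF q] weak_deriv_poly_fun[OF poly_fun_dir_deriv[OF q]] r] q
    by (simp add: wL2_poly_fun poly_fun_dir_deriv edge_op_def[abs_def])
  thus ?thesis using q r admissible_edges
    by (simp add: ip_apk_op_right ip_commute[of "apk_op q"] wL2_poly_fun) (simp add: ip_commute)
qed

lemma apk_op_weak: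
  assumes "sobolev (Suc (Suc m)) v"
  shows "\<exists>g. sobolev m g \<and> (\<forall>q. poly_fun q \<longrightarrow> ip v (apk_op q) = ip g q)"
proof -
  have v: "v \<in> wL2 h" using sobolev_wL2[OF assms] .
  have ex: "\<exists>g. sobolev m g \<and> (\<forall>q. poly_fun q \<longrightarrow> ip v (edge_op e \<rho> \<kappa> q) = ip g q)" if a: "admissible e \<rho> \<kappa>" for e \<rho> \<kappa>
  proof -
    obtain g where g: "weak_deriv e v g" "sobolev (Suc m) g" using assms unfolding sobolev.simps(2)[of "Suc m"] by blast
    obtain k where k: "weak_deriv e g k" "sobolev m k" using g(2) unfolding sobolev.simps(2)[of m] by blast
    have "sobolev m (\<lambda>z. \<rho> z * k z + \<kappa> z * g z)"
      using a k sobolev_lower[OF g(2)] by (intro sobolev_add sobolev_mult) (auto simp: admissible_def)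
    thus ?thesis using edge_op_weak[OF a v sobolev_wL2[OF g(2)] sobolev_wL2[OF k(2)] g(1) k(1)] by blast
  qed
  obtain g1 where g1: "sobolev m g1" "\<And>q. poly_fun q \<Longrightarrow> ip v (edge_op (1, 0) \<rho>\<^sub>1 \<kappa>\<^sub>1 q) = ip g1 q"
    using ex[OF admissible_edges(1)] by blast
  obtain g2 where g2: "sobolev m g2" "\<And>q. poly_fun q \<Longrightarrow> ip v (edge_op (0, 1) \<rho>\<^sub>2 \<kappa>\<^sub>2 q) = ip g2 q"
    using ex[OF admissible_edges(2)] by blast
  obtain g3 where g3: "sobolev m g3" "\<And>q. poly_fun q \<Longrightarrow> ip v (edge_op (1, -1) \<rho>\<^sub>3 \<kappa>\<^sub>3 q) = ip g3 q"
    using ex[OF admissible_edges(3)] by blast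
  have "ip v (apk_op q) = ip (\<lambda>z. g1 z + g2 z + g3 z) q" if "poly_fun q" for q
    using that v g1 g2 g3 by (simp add: ip_apk_op_right ip_add_left wL2_add sobolev_wL2 wL2_poly_fun)
  moreover have "sobolev m (\<lambda>z. g1 z + g2 z + g3 z)" using g1 g2 g3 by (intro sobolev_add)
  ultimately show ?thesis by blast
qed

text \<open>\<open>g\<close> is the k-th power of the operator applied to \<open>v\<close> in the
  weak sense. It is chosen before \<open>q\<close> and \<mu>, so a single \<open>g\<close> serves
  all eigenfunctions.\<close>

lemma weak_eigenfunction_coefficients:
  assumes "sobolev (2 * k) v"
  shows "\<exists>g \<in> wL2 h. \<forall>q \<mu>. poly_fun q \<longrightarrow> (\<forall>w \<in> wL2 h. ip w (apk_op q) = \<mu> * ip w q) \<longrightarrow> \<mu> ^ k * ip v q = ip g q"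
  using assms
proof (induction k arbitrary: v)
  case 0
  thus ?case by auto
next
  case (Suc k)
  obtain g1 where g1: "sobolev (2 * k) g1" "\<And>q. poly_fun q \<Longrightarrow> ip v (apk_op q) = ip g1 q"
    using apk_op_weak[of "2 * k" v] Suc.prems by auto
  obtain g where g: "g \<in> wL2 h"
    "\<And>q \<mu>. poly_fun q \<Longrightarrow> (\<forall>w \<in> wL2 h. ip w (apk_op q) = \<mu> * ip w q) \<Longrightarrow> \<mu> ^ k * ip g1 q = ip g q"
    using Suc.IH[OF g1(1)] by blast
  have "\<mu> ^ Suc k * ip v q = ip g q"
    if q: "poly_fun q" and ev: "\<forall>w \<in> wL2 h. ip w (apk_op q) = \<mu> * ip w q" for q \<mu>
  proof -
    have "\<mu> * ip v q = ip g1 q" using ev sobolev_wL2[OF Suc.prems] g1(2)[OF q] by simp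
    thus ?thesis using g(2)[OF q ev] by (simp add: mult.assoc mult.left_commute[of \<mu> "\<mu> ^ k"])
  qed
  thus ?case using g(1) by blast
qed

end

section \<open>Orthogonality and completeness of the APK polynomials\<close>

context apk_weight
begin

abbreviation \<gamma> :: real where "\<gamma> \<equiv> real \<alpha> + real \<beta> + real p"

section \<open>Leading terms and eigenvalues\<close>

text \<open>The Euler operator, which multiplies a homogeneous polynomial by its degree; it appears
  in the commutators of \<open>apk_op\<close> with the coordinates.\<close>

definition euler :: "(real \<times> real \<Rightarrow> real) \<Rightarrow> real \<times> real \<Rightarrow> real" where
  "euler f z = fst z * dir_deriv (1, 0) f z + snd z * dir_deriv (0, 1) f z"

lemma dir_deriv_fst_mult: "poly_fun f \<Longrightarrow> dir_deriv e (\<lambda>z. fst z * f z) = (\<lambda>z. fst z * dir_deriv e f z + fst e * f z)"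
  by (simp add: fun_eq_iff dir_deriv_mult dir_deriv_fst differentiable_poly_fun)

lemma dir_deriv_snd_mult: "poly_fun f \<Longrightarrow> dir_deriv e (\<lambda>z. snd z * f z) = (\<lambda>z. snd z * dir_deriv e f z + snd e * f z)"
  by (simp add: fun_eq_iff dir_deriv_mult dir_deriv_snd differentiable_poly_fun)

lemma dir_deriv_poly_fun_add: "poly_fun f \<Longrightarrow> poly_fun g \<Longrightarrow> dir_deriv e (\<lambda>z. f z + g z) = (\<lambda>z. dir_deriv e f z + dir_deriv e g z)"
  by (simp add: fun_eq_iff dir_deriv_add differentiable_poly_fun)

lemma dir_deriv_poly_fun_cmult: "poly_fun f \<Longrightarrow> dir_deriv e (\<lambda>z. c * f z) = (\<lambda>z. c * dir_deriv e f z)"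
  by (simp add: fun_eq_iff dir_deriv_mult dir_deriv_const differentiable_poly_fun)

lemma dir_deriv_antidiagonal: "poly_fun f \<Longrightarrow> dir_deriv (1, -1) f z = dir_deriv (1, 0) f z - dir_deriv (0, 1) f z"
  using dir_deriv_linear[OF differentiable_poly_fun, of f 1 "(1, 0)" "-1" "(0, 1)" z] by simp

lemma edge_op_fst_mult: "poly_fun f \<Longrightarrow> edge_op e \<rho> \<kappa> (\<lambda>z. fst z * f z) z
    = fst z * edge_op e \<rho> \<kappa> f z + 2 * \<rho> z * fst e * dir_deriv e f z + \<kappa> z * fst e * f z"
  unfolding edge_op_def
  by (simp add: dir_deriv_fst_mult dir_deriv_poly_fun_add dir_deriv_poly_fun_cmult poly_fun_mult poly_fun_dir_deriv algebra_simps)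

lemma edge_op_snd_mult: "poly_fun f \<Longrightarrow> edge_op e \<rho> \<kappa> (\<lambda>z. snd z * f z) z
    = snd z * edge_op e \<rho> \<kappa> f z + 2 * \<rho> z * snd e * dir_deriv e f z + \<kappa> z * snd e * f z"
  unfolding edge_op_def
  by (simp add: dir_deriv_snd_mult dir_deriv_poly_fun_add dir_deriv_poly_fun_cmult poly_fun_mult poly_fun_dir_deriv algebra_simps)

text \<open>The first-order terms of the edges (1, 0) and (1, -1) combine to 2 x times the x
  derivative minus the Euler operator. The term without derivatives is
  \<open>\<kappa>\<^sub>1 + \<kappa>\<^sub>3\<close>.\<close>

lemma apk_op_fst_mult: "poly_fun f \<Longrightarrow> apk_op (\<lambda>z. fst z * f z) z
    = fst z * apk_op f z + 2 * fst z * dir_deriv (1, 0) f z - 2 * fst z * euler f z + (real \<alpha> - (\<gamma> + 1) * fst z) * f z"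
  unfolding apk_op_def by (simp add: edge_op_fst_mult dir_deriv_antidiagonal euler_def algebra_simps)

lemma apk_op_snd_mult: "poly_fun f \<Longrightarrow> apk_op (\<lambda>z. snd z * f z) z
    = snd z * apk_op f z + 2 * snd z * dir_deriv (0, 1) f z - 2 * snd z * euler f z + (real \<beta> - (\<gamma> + 1) * snd z) * f z"
  unfolding apk_op_def by (simp add: edge_op_snd_mult dir_deriv_antidiagonal euler_def algebra_simps)

lemma apk_op_add: "poly_fun f \<Longrightarrow> poly_fun g \<Longrightarrow> apk_op (\<lambda>z. f z + g z) z = apk_op f z + apk_op g z"
  unfolding apk_op_def edge_op_def by (simp add: dir_deriv_poly_fun_add poly_fun_dir_deriv algebra_simps)

lemma apk_op_const: "apk_op (\<lambda>_. c) z = 0"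
  unfolding apk_op_def edge_op_def by (simp add: dir_deriv_const)

lemma deg_less_fst': "deg_less (m - 1) g \<Longrightarrow> deg_less m (\<lambda>z. fst z * g z)"
proof (cases m)
  case 0
  moreover assume "deg_less (m - 1) g"
  ultimately have "g = (\<lambda>_. 0)" using deg_less_0 by simp
  thus ?thesis by (simp add: deg_less_zero)
qed (auto intro: deg_less_fst)

lemma deg_less_snd': "deg_less (m - 1) g \<Longrightarrow> deg_less m (\<lambda>z. snd z * g z)"
proof (cases m)
  case 0
  moreover assume "deg_less (m - 1) g"
  ultimately have "g = (\<lambda>_. 0)" using deg_less_0 by simp
  thus ?thesis by (simp add: deg_less_zero)
qed (auto intro: deg_less_snd)

lemma deg_less_const_multiple: "c = 0 \<or> n > 0 \<Longrightarrow> deg_less n (\<lambda>_. c)"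
  using deg_less_const[of "n - 1" c] deg_less_zero by (cases "c = 0") auto

text \<open>\<open>deg_less m\<close> allows degree at most m - 1, hence the factor. At
  \<open>m = 0\<close> the function is zero, and the value -1 does no harm.\<close>

lemma euler_leading: "deg_less m f \<Longrightarrow> deg_less (m - 1) (\<lambda>z. euler f z - (real m - 1) * f z)"
proof (induction m f rule: deg_less.induct)
  case (deg_less_zero n)
  show ?case by (simp add: euler_def dir_deriv_const deg_less.deg_less_zero)
next
  case (deg_less_const n c)
  show ?case by (simp add: euler_def dir_deriv_const) (rule deg_less_const_multiple, auto)
next
  case (deg_less_fst m f)
  have "(\<lambda>z. euler (\<lambda>z. fst z * f z) z - (real (Suc m) - 1) * (fst z * f z))
      = (\<lambda>z. fst z * (euler f z - (real m - 1) * f z))"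
    using deg_less_poly_fun[OF deg_less_fst.hyps] by (simp add: euler_def dir_deriv_fst_mult fun_eq_iff algebra_simps)
  thus ?case using deg_less_fst'[OF deg_less_fst.IH] by simp
next
  case (deg_less_snd m f)
  have "(\<lambda>z. euler (\<lambda>z. snd z * f z) z - (real (Suc m) - 1) * (snd z * f z))
      = (\<lambda>z. snd z * (euler f z - (real m - 1) * f z))"
    using deg_less_poly_fun[OF deg_less_snd.hyps] by (simp add: euler_def dir_deriv_snd_mult fun_eq_iff algebra_simps)
  thus ?case using deg_less_snd'[OF deg_less_snd.IH] by simp
next
  case (deg_less_add m f g)
  have "(\<lambda>z. euler (\<lambda>z. f z + g z) z - (real m - 1) * (f z + g z))
      = (\<lambda>z. (euler f z - (real m - 1) * f z) + (euler g z - (real m - 1) * g z))"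
    using deg_less_poly_fun[OF deg_less_add.hyps(1)] deg_less_poly_fun[OF deg_less_add.hyps(2)]
    by (simp add: euler_def dir_deriv_poly_fun_add fun_eq_iff algebra_simps)
  thus ?case using deg_less.deg_less_add[OF deg_less_add.IH] by simp
qed

text \<open>By the commutator formulas, multiplication by a coordinate adds 2 (m - 1) + \<gamma> + 1
  to the factor (m - 1) (m - 1 + \<gamma>), which gives m (m + \<gamma>). The remaining commutator
  terms do not raise the degree.\<close>

lemma apk_op_leading: "deg_less m f \<Longrightarrow> deg_less (m - 1) (\<lambda>z. apk_op f z + (real m - 1) * (real m - 1 + \<gamma>) * f z)"
proof (induction m f rule: deg_less.induct)
  case (deg_less_zero n)
  show ?case by (simp add: apk_op_const deg_less.deg_less_zero)
next
  case (deg_less_const n c)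
  show ?case by (simp add: apk_op_const) (rule deg_less_const_multiple, auto)
next
  case (deg_less_fst m f)
  have f: "poly_fun f" using deg_less_poly_fun[OF deg_less_fst.hyps] .
  have eq: "(\<lambda>z. apk_op (\<lambda>z. fst z * f z) z + (real (Suc m) - 1) * (real (Suc m) - 1 + \<gamma>) * (fst z * f z))
      = (\<lambda>z. fst z * (apk_op f z + (real m - 1) * (real m - 1 + \<gamma>) * f z)
           + ((- 2) * (fst z * (euler f z - (real m - 1) * f z)) + (2 * (fst z * dir_deriv (1, 0) f z) + real \<alpha> * f z)))"
    using f by (simp add: apk_op_fst_mult fun_eq_iff algebra_simps)
  have "deg_less m (\<lambda>z. fst z * (apk_op f z + (real m - 1) * (real m - 1 + \<gamma>) * f z)
           + ((- 2) * (fst z * (euler f z - (real m - 1) * f z)) + (2 * (fst z * dir_deriv (1, 0) f z) + real \<alpha> * f z)))"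
    by (intro deg_less.deg_less_add deg_less_fst' deg_less_cmult deg_less_fst.IH euler_leading deg_less_fst.hyps poly_fun_dir_deriv_deg_less)
  thus ?case unfolding eq by simp
next
  case (deg_less_snd m f)
  have f: "poly_fun f" using deg_less_poly_fun[OF deg_less_snd.hyps] .
  have eq: "(\<lambda>z. apk_op (\<lambda>z. snd z * f z) z + (real (Suc m) - 1) * (real (Suc m) - 1 + \<gamma>) * (snd z * f z))
      = (\<lambda>z. snd z * (apk_op f z + (real m - 1) * (real m - 1 + \<gamma>) * f z)
           + ((- 2) * (snd z * (euler f z - (real m - 1) * f z)) + (2 * (snd z * dir_deriv (0, 1) f z) + real \<beta> * f z)))"
    using f by (simp add: apk_op_snd_mult fun_eq_iff algebra_simps)
  have "deg_less m (\<lambda>z. snd z * (apk_op f z + (real m - 1) * (real m - 1 + \<gamma>) * f z)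
           + ((- 2) * (snd z * (euler f z - (real m - 1) * f z)) + (2 * (snd z * dir_deriv (0, 1) f z) + real \<beta> * f z)))"
    by (intro deg_less.deg_less_add deg_less_snd' deg_less_cmult deg_less_snd.IH euler_leading deg_less_snd.hyps poly_fun_dir_deriv_deg_less)
  thus ?case unfolding eq by simp
next
  case (deg_less_add m f g)
  have "(\<lambda>z. apk_op (\<lambda>z. f z + g z) z + (real m - 1) * (real m - 1 + \<gamma>) * (f z + g z))
      = (\<lambda>z. (apk_op f z + (real m - 1) * (real m - 1 + \<gamma>) * f z) + (apk_op g z + (real m - 1) * (real m - 1 + \<gamma>) * g z))"
    using deg_less_poly_fun[OF deg_less_add.hyps(1)] deg_less_poly_fun[OF deg_less_add.hyps(2)]
    by (simp add: apk_op_add fun_eq_iff algebra_simps)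
  thus ?case using deg_less.deg_less_add[OF deg_less_add.IH] by simp
qed

text \<open>The residual \<open>s\<close> has lower degree, and so has its image under the operator.
  By symmetry \<open>ip s s\<close> is a sum of inner products of \<open>q\<close> with lower
  degrees, hence 0; norm zero suffices for a conclusion stated through inner products.\<close>

lemma apk_op_eigenfunction:
  assumes q: "deg_less (Suc n) q" and orth: "\<And>r. deg_less n r \<Longrightarrow> ip q r = 0" and w: "w \<in> wL2 h"
  shows "ip w (apk_op q) = - (real n * (real n + \<gamma>)) * ip w q"
proof -
  let ?\<mu> = "real n * (real n + \<gamma>)"
  define s where "s = (\<lambda>z. apk_op q z + ?\<mu> * q z)"
  have s: "deg_less n s" using apk_op_leading[OF q] by (simp add: s_def)
  have pq: "poly_fun q" using q deg_less_poly_fun by blast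
  have ps: "poly_fun s" using s deg_less_poly_fun by blast
  have L: "q \<in> wL2 h" "s \<in> wL2 h" "apk_op q \<in> wL2 h" "(\<lambda>z. ?\<mu> * q z) \<in> wL2 h"
    using pq ps poly_fun_apk_op[OF pq] by (auto intro: wL2_poly_fun wL2_cmult)
  have "deg_less n (\<lambda>z. (apk_op s z + (real n - 1) * (real n - 1 + \<gamma>) * s z) + - ((real n - 1) * (real n - 1 + \<gamma>)) * s z)"
    by (intro deg_less.deg_less_add[OF deg_less_mono[OF apk_op_leading[OF s]] deg_less_cmult[OF s]]) simp
  moreover have "(\<lambda>z. (apk_op s z + (real n - 1) * (real n - 1 + \<gamma>) * s z) + - ((real n - 1) * (real n - 1 + \<gamma>)) * s z) = apk_op s"
    by (simp add: fun_eq_iff)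
  ultimately have "deg_less n (apk_op s)" by simp
  have "ip s s = ip (apk_op q) s + ?\<mu> * ip q s"
    using L by (subst (1) s_def) (simp add: ip_add_left ip_cmult_left)
  also have "ip (apk_op q) s = ip q (apk_op s)" using apk_op_symmetric[OF pq ps] by simp
  finally have "ip s s = 0" using orth[OF s] orth[OF \<open>deg_less n (apk_op s)\<close>] by simp
  hence "ip w s = 0" using ip_eq_0_if_null w L by blast
  moreover have "ip w s = ip w (apk_op q) + ?\<mu> * ip w q"
    using L w by (subst s_def) (simp add: ip_add_right ip_cmult_right)
  ultimately show ?thesis by simp
qed

end

subsection \<open>Beta integrals and Jacobi polynomials\<close>

text \<open>The Beta value B(i + 1, j + 1).\<close>

definition beta_nat :: "nat \<Rightarrow> nat \<Rightarrow> real" where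
  "beta_nat i j = fact i * fact j / fact (i + j + 1)"

lemma has_integral_beta:
  fixes c :: real
  assumes "c \<ge> 0"
  shows "((\<lambda>y. y ^ i * (c - y) ^ j) has_integral c ^ (i + j + 1) * beta_nat i j) {0..c}"
proof (induction j arbitrary: i)
  case 0
  have "((\<lambda>y. y ^ i) has_integral (c ^ Suc i / real (Suc i) - 0 ^ Suc i / real (Suc i))) {0..c}"
    using assms by (intro fundamental_theorem_of_calculus)
      (auto intro!: derivative_eq_intros simp: has_real_derivative_iff_has_vector_derivative[symmetric] simp del: power_Suc of_nat_Suc)
  thus ?case by (simp add: beta_nat_def)
next
  case (Suc j)
  have "((\<lambda>y. real (Suc i) * y ^ i * (c - y) ^ Suc j - y ^ Suc i * (real (Suc j) * (c - y) ^ j)) has_integral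
      (c ^ Suc i * (c - c) ^ Suc j - 0 ^ Suc i * (c - 0) ^ Suc j)) {0..c}"
    using assms by (intro fundamental_theorem_of_calculus)
      (auto intro!: derivative_eq_intros simp: has_real_derivative_iff_has_vector_derivative[symmetric] simp del: power_Suc of_nat_Suc)
  from has_integral_add[OF this has_integral_mult_right[OF Suc.IH[of "Suc i"], of "real (Suc j)"]]
  have "((\<lambda>y. real (Suc i) * (y ^ i * (c - y) ^ Suc j)) has_integral real (Suc j) * (c ^ (Suc i + j + 1) * beta_nat (Suc i) j)) {0..c}"
    by (simp add: algebra_simps del: of_nat_Suc)
  from has_integral_mult_right[OF this, of "1 / real (Suc i)"]
  have "((\<lambda>y. y ^ i * (c - y) ^ Suc j) has_integral real (Suc j) / real (Suc i) * (c ^ (Suc i + j + 1) * beta_nat (Suc i) j)) {0..c}"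
    by (simp del: power_Suc of_nat_Suc)
  moreover have "real (Suc j) / real (Suc i) * (c ^ (Suc i + j + 1) * beta_nat (Suc i) j) = c ^ (i + Suc j + 1) * beta_nat i (Suc j)"
  proof -
    have "real (Suc j) / real (Suc i) * beta_nat (Suc i) j = beta_nat i (Suc j)"
      by (simp add: beta_nat_def field_simps del: of_nat_Suc)
    moreover have "Suc i + j + 1 = i + Suc j + 1" by simp
    ultimately show ?thesis by (metis mult.left_commute)
  qed
  ultimately show ?case by (simp only:)
qed

lemma integral_beta:
  fixes c :: real
  assumes "c \<ge> 0"
  shows "(LINT y|lborel. indicator {0..c} y * (y ^ i * (c - y) ^ j)) = c ^ (i + j + 1) * beta_nat i j"
proof -
  have "set_integrable lborel {0..c} (\<lambda>y. y ^ i * (c - y) ^ j)"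
    unfolding set_integrable_def
    by (rule borel_integrable_compact) (auto intro!: continuous_intros)
  from set_borel_integral_eq_integral(2)[OF this] has_integral_beta[OF assms, of i j]
  show ?thesis by (simp add: set_lebesgue_integral_def integral_unique)
qed

text \<open>The y integral over {0..1-x} is a scaled Beta integral. It contributes the power j + k +
  1 of 1 - x, which merges with the exponent \<open>r\<close>.\<close>

lemma triangle_integral_monomial:
  "(LINT z:triangle|lebesgue. fst z ^ i * (1 - fst z) ^ r * snd z ^ j * (1 - fst z - snd z) ^ k)
     = beta_nat j k * beta_nat i (r + j + k + 1)"
proof -
  let ?f = "\<lambda>z::real\<times>real. fst z ^ i * (1 - fst z) ^ r * snd z ^ j * (1 - fst z - snd z) ^ k"
  let ?g = "\<lambda>z. indicator triangle z *\<^sub>R ?f z"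
  have int: "integrable lborel ?g"
    by (rule borel_integrable_compact[OF compact_triangle]) (auto intro!: continuous_intros)
  have "(LINT z:triangle|lebesgue. ?f z) = (LINT z|lborel. ?g z)"
    unfolding set_lebesgue_integral_def using int by (intro integral_completion) auto
  also have "\<dots> = (LINT x|lborel. LINT y|lborel. ?g (x, y))"
    using lborel_pair.integral_fst'[of ?g] int by (simp add: lborel_prod)
  also have "\<dots> = (LINT x|lborel. indicator {0..1} x * (x ^ i * (1 - x) ^ (r + j + k + 1)) * beta_nat j k)"
  proof (intro Bochner_Integration.integral_cong refl)
    fix x :: real
    show "(LINT y|lborel. ?g (x, y)) = indicator {0..1} x * (x ^ i * (1 - x) ^ (r + j + k + 1)) * beta_nat j k"
    proof (cases "x \<in> {0..1}")
      case True
      have "(\<lambda>y. ?g (x, y)) = (\<lambda>y. x ^ i * (1 - x) ^ r * (indicator {0..1 - x} y * (y ^ j * ((1 - x) - y) ^ k)))"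
        using True by (auto simp: fun_eq_iff indicator_def triangle_def)
      thus ?thesis using True integral_beta[of "1 - x" j k] by (simp add: power_add)
    next
      case False
      hence "(\<lambda>y. ?g (x, y)) = (\<lambda>y. 0)" by (auto simp: fun_eq_iff indicator_def triangle_def)
      thus ?thesis using False by simp
    qed
  qed
  also have "\<dots> = beta_nat j k * beta_nat i (r + j + k + 1)"
    using integral_beta[of 1 i "r + j + k + 1"] by simp
  finally show ?thesis .
qed

lemma set_integral_sum_real:
  fixes f :: "'i \<Rightarrow> 'a \<Rightarrow> real"
  assumes "\<And>i. set_integrable M T (f i)"
  shows "set_integrable M T (\<lambda>x. \<Sum>i\<in>S. f i x)"
    and "(LINT x:T|M. (\<Sum>i\<in>S. f i x)) = (\<Sum>i\<in>S. LINT x:T|M. f i x)"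
  using assms unfolding set_integrable_def set_lebesgue_integral_def by (simp_all add: sum_distrib_left)

lemma fact_add_eq_prod: "fact (c + i) = fact c * (\<Prod>q<i. real c + 1 + real q)"
  by (induction i) (auto simp: algebra_simps)

section \<open>Jacobi polynomials with integer parameters\<close>

text \<open>Jacobi orthogonality to x^i (1 - x)^j after integration. The factorials cancel up to
  rising factorials, polynomials in \<open>t\<close> of degrees \<open>i\<close> and
  \<open>j\<close>, so an alternating sum of order \<open>n\<close> annihilates them.\<close>

lemma jacobi_beta_sum_eq_0:
  assumes "i + j < n"
  shows "(\<Sum>t\<le>n. (-1) ^ t * real ((n + a) choose (n - t)) * real ((n + b) choose t) * beta_nat (a + i + t) (b + j + (n - t))) = 0"
proof -
  define P where "P = (\<Prod>q<i. [:real a + 1 + real q, 1:])"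
  define Q where "Q = (\<Prod>q<j. [:real b + real n + 1 + real q, -1:])"
  define K :: real where "K = fact (n + a) * fact (n + b) / (fact n * fact (a + b + i + j + n + 1))"
  have "degree P \<le> (\<Sum>q<i. 1)" unfolding P_def
    by (rule order.trans[OF degree_prod_sum_le]) (auto intro: sum_mono)
  moreover have "degree Q \<le> (\<Sum>q<j. 1)" unfolding Q_def
    by (rule order.trans[OF degree_prod_sum_le]) (auto intro: sum_mono)
  ultimately have d: "degree (P * Q) < n"
    using degree_mult_le[of P Q] assms by simp
  have summand: "(-1) ^ t * real ((n + a) choose (n - t)) * real ((n + b) choose t) * beta_nat (a + i + t) (b + j + (n - t))
      = K * ((-1) ^ t * real (n choose t) * poly (P * Q) (real t))" if t: "t \<le> n" for t
  proof -
    have c1: "real ((n + a) choose (n - t)) = fact (n + a) / (fact (n - t) * fact (a + t))"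
      using t by (subst binomial_fact) (auto simp: add.commute)
    have c2: "real ((n + b) choose t) = fact (n + b) / (fact t * fact (b + (n - t)))"
      using t by (subst binomial_fact) (auto simp: add.commute)
    have c3: "real (n choose t) = fact n / (fact t * fact (n - t))"
      using t by (subst binomial_fact) auto
    have f1: "fact (a + i + t) = fact (a + t) * poly P (real t)"
      using fact_add_eq_prod[of "a + t" i] by (simp add: P_def poly_prod add_ac)
    have f2: "fact (b + j + (n - t)) = fact (b + (n - t)) * poly Q (real t)"
      using fact_add_eq_prod[of "b + (n - t)" j] t by (simp add: Q_def poly_prod add_ac of_nat_diff algebra_simps)
    have f3: "a + i + t + (b + j + (n - t)) + 1 = a + b + i + j + n + 1" using t by simp
    have alg: "e * (A' / (u * v)) * (B' / (w * y)) * ((v * x) * (y * x') / Z) = A' * B' / (N * Z) * (e * (N / (w * u)) * (x * x'))"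
      if "u \<noteq> 0" "v \<noteq> 0" "w \<noteq> 0" "y \<noteq> 0" "Z \<noteq> 0" "N \<noteq> 0" for e A' B' u v w y x x' Z N :: real
      using that by (simp add: field_simps)
    show ?thesis unfolding c1 c2 c3 beta_nat_def f1 f2 f3 K_def poly_mult
      by (rule alg) (simp_all del: fact_Suc)
  qed
  have "(\<Sum>t\<le>n. (-1) ^ t * real ((n + a) choose (n - t)) * real ((n + b) choose t) * beta_nat (a + i + t) (b + j + (n - t)))
      = K * (\<Sum>t\<le>n. (-1) ^ t * real (n choose t) * poly (P * Q) (real t))"
    unfolding sum_distrib_left by (intro sum.cong refl summand) simp
  thus ?thesis using alternating_binomial_sum_poly[of "P * Q" n] d by simp
qed

lemma jacobi_nat:
  "jacobi n (real a) (real b) (1 - 2 * x) =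
     (\<Sum>t\<le>n. (-1) ^ t * real ((n + a) choose (n - t)) * real ((n + b) choose t) * (x ^ t * (1 - x) ^ (n - t)))"
  unfolding jacobi_def
proof (intro sum.cong refl)
  fix t assume "t \<in> {..n}"
  have eqs: "(1 - 2 * x - 1) / 2 = - x" "(1 - 2 * x + 1) / 2 = 1 - x" "(- x) ^ t = (-1) ^ t * x ^ t"
    by (auto simp: field_simps power_minus[of x])
  show "(real n + real a gchoose (n - t)) * (real n + real b gchoose t) * ((1 - 2 * x - 1) / 2) ^ t * ((1 - 2 * x + 1) / 2) ^ (n - t) =
      (-1) ^ t * real ((n + a) choose (n - t)) * real ((n + b) choose t) * (x ^ t * (1 - x) ^ (n - t))"
    unfolding eqs by (simp add: binomial_gbinomial)
qed

definition jacobi_poly :: "nat \<Rightarrow> nat \<Rightarrow> nat \<Rightarrow> real poly" where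
  "jacobi_poly n a b = (\<Sum>t\<le>n. smult (real ((n + a) choose (n - t)) * real ((n + b) choose t)) ([:0, -1:] ^ t * [:1, -1:] ^ (n - t)))"

lemma poly_jacobi_poly: "poly (jacobi_poly n a b) x = jacobi n (real a) (real b) (1 - 2 * x)"
proof -
  have "(- x) ^ t = (-1) ^ t * x ^ t" for t by (rule power_minus)
  thus ?thesis unfolding jacobi_nat jacobi_poly_def by (simp add: poly_sum poly_power mult_ac)
qed

text \<open>All the products have leading coefficient (-1)^n and their factors are nonnegative, so
  nothing cancels.\<close>

lemma jacobi_poly_degree: "degree (jacobi_poly n a b) \<le> n"
  and jacobi_poly_lead: "coeff (jacobi_poly n a b) n \<noteq> 0"
proof -
  have d: "degree ([:0, -1:] ^ t * [:1, -1:] ^ (n - t) :: real poly) = n"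
    and c: "coeff ([:0, -1:] ^ t * [:1, -1:] ^ (n - t) :: real poly) n = (-1) ^ n" if "t \<le> n" for t
  proof -
    let ?u = "[:0, -1:] ^ t :: real poly" and ?v = "[:1, -1:] ^ (n - t) :: real poly"
    have nz: "?u \<noteq> 0" "?v \<noteq> 0" by auto
    show d: "degree (?u * ?v) = n" using that nz by (simp add: degree_mult_eq degree_power_eq)
    have "lead_coeff (?u * ?v) = (-1) ^ t * (-1) ^ (n - t)" by (simp add: lead_coeff_mult lead_coeff_power)
    thus "coeff (?u * ?v) n = (-1) ^ n" using that unfolding d by (simp add: power_add[symmetric])
  qed
  show "degree (jacobi_poly n a b) \<le> n" unfolding jacobi_poly_def
    by (intro degree_sum_le) (auto intro!: order.trans[OF degree_smult_le] simp: d)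
  have "coeff (jacobi_poly n a b) n = (\<Sum>t\<le>n. real ((n + a) choose (n - t)) * real ((n + b) choose t) * (-1) ^ n)"
    unfolding jacobi_poly_def by (simp add: coeff_sum c)
  also have "\<dots> = (-1) ^ n * (\<Sum>t\<le>n. real ((n + a) choose (n - t)) * real ((n + b) choose t))"
    by (simp add: sum_distrib_left mult_ac)
  also have "(\<Sum>t\<le>n. real ((n + a) choose (n - t)) * real ((n + b) choose t)) > 0"
    by (intro sum_pos2[of _ 0]) auto
  hence "(-1) ^ n * (\<Sum>t\<le>n. real ((n + a) choose (n - t)) * real ((n + b) choose t)) \<noteq> 0" by simp
  finally show "coeff (jacobi_poly n a b) n \<noteq> 0" .
qed

text \<open>The leading term is eliminated by a multiple of the member of the same degree, one
  degree at a time.\<close>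

lemma poly_graded_span:
  fixes P :: "nat \<Rightarrow> real poly"
  assumes P: "\<And>n. degree (P n) \<le> n" "\<And>n. coeff (P n) n \<noteq> 0"
    and Z: "\<And>p q. Z p \<Longrightarrow> Z q \<Longrightarrow> Z (p + q)" "\<And>c p. Z p \<Longrightarrow> Z (smult c p)" "\<And>n. Z (P n)"
  shows "Z q"
proof -
  have "Z q" if "\<And>i. i \<ge> n \<Longrightarrow> coeff q i = 0" for n q
    using that
  proof (induction n arbitrary: q)
    case 0
    hence "q = smult 0 (P 0)" by (intro poly_eqI) auto
    thus ?case using Z by metis
  next
    case (Suc n)
    define c where "c = coeff q n / coeff (P n) n"
    have "Z (q + smult (- c) (P n))"
    proof (rule Suc.IH)
      fix i assume "i \<ge> n"
      thus "coeff (q + smult (- c) (P n)) i = 0"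
        using Suc.prems[of i] P(1)[of n] P(2)[of n] coeff_eq_0[of "P n" i]
        by (cases "i = n") (auto simp: c_def)
    qed
    hence "Z ((q + smult (- c) (P n)) + smult c (P n))" using Z by blast
    thus ?case by simp
  qed
  from this[of "Suc (degree q)"] show ?thesis by (simp add: coeff_eq_0)
qed

context apk_weight
begin

abbreviation A where "A \<equiv> apk \<alpha> \<beta> p"

section \<open>Inner products of APK polynomials\<close>

text \<open>The second APK factor with (1 - x)^l multiplied in: homogeneous of degree
  \<open>l\<close> in x + y - 1 and y, hence meaningful at x = 1 too.\<close>

definition F :: "nat \<Rightarrow> real \<times> real \<Rightarrow> real" where
  "F l z = (\<Sum>s\<le>l. real ((l + p) choose (l - s)) * real ((l + (\<beta> - 1)) choose s) *
             (fst z + snd z - 1) ^ s * snd z ^ (l - s))"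

lemma A_eq: "A m l z = poly (jacobi_poly m (\<alpha> - 1) (p + \<beta> + 2 * l)) (fst z) * F l z"
proof -
  have eqs: "real \<beta> - 1 = real (\<beta> - 1)" "real \<alpha> - 1 = real (\<alpha> - 1)" using \<alpha> \<beta> by (auto simp: of_nat_diff)
  have "A m l (fst z, snd z) = poly (jacobi_poly m (\<alpha> - 1) (p + \<beta> + 2 * l)) (fst z) * F l z"
    unfolding apk_eq_polynomial poly_jacobi_poly F_def eqs binomial_gbinomial of_nat_add ..
  thus ?thesis by simp
qed

lemma deg_less_poly_fst: "degree q \<le> n \<Longrightarrow> deg_less (Suc n) (\<lambda>z. poly q (fst z))"
proof -
  assume d: "degree q \<le> n"
  have "deg_less (Suc n) (\<lambda>z. coeff q i * fst z ^ i)" if "i \<le> degree q" for i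
    using deg_less_power[OF deg_less_coord(1), of i] that d by (intro deg_less_cmult) (auto intro: deg_less_mono)
  hence "deg_less (Suc n) (\<lambda>z. \<Sum>i\<le>degree q. coeff q i * fst z ^ i)" by (intro deg_less_sum) auto
  thus ?thesis by (simp add: poly_altdef)
qed

lemma deg_less_F: "deg_less (Suc l) (F l)"
proof -
  have lin: "deg_less (Suc (Suc 0)) (\<lambda>z. fst z + snd z - 1)"
    by (intro deg_less_diff deg_less_add deg_less_coord deg_less_const)
  have "deg_less (Suc l) (\<lambda>z. c * ((fst z + snd z - 1) ^ s * snd z ^ (l - s)))" if "s \<le> l" for s c
    using deg_less_mult'[OF deg_less_power[OF lin, of s] deg_less_power[OF deg_less_coord(2), of "l - s"]] that
    by (intro deg_less_cmult) simp
  hence "deg_less (Suc l) (\<lambda>z. \<Sum>s\<le>l. (real ((l + p) choose (l - s)) * real ((l + (\<beta> - 1)) choose s)) * ((fst z + snd z - 1) ^ s * snd z ^ (l - s)))"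
    by (intro deg_less_sum) auto
  thus ?thesis by (simp add: F_def[abs_def] mult_ac)
qed

lemma deg_less_A: "deg_less (Suc (m + l)) (A m l)"
  unfolding A_eq[abs_def] by (intro deg_less_mult' deg_less_poly_fst jacobi_poly_degree deg_less_F)

lemma poly_fun_A [intro, simp]: "poly_fun (A m l)"
  using deg_less_A deg_less_poly_fun by blast

text \<open>After the y integration the exponent of 1 - x no longer depends on \<open>s\<close>, so
  the double sum separates into two one-dimensional Jacobi sums.\<close>

lemma ip_A_monomial:
  "ip (A m l) (\<lambda>z. fst z ^ i * (1 - fst z) ^ r * snd z ^ j) =
     (\<Sum>s\<le>l. (-1) ^ s * real ((l + p) choose (l - s)) * real ((l + (\<beta> - 1)) choose s) * beta_nat (p + 0 + s) (\<beta> - 1 + j + (l - s))) *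
     (\<Sum>t\<le>m. (-1) ^ t * real ((m + (\<alpha> - 1)) choose (m - t)) * real ((m + (p + \<beta> + 2 * l)) choose t) *
        beta_nat (\<alpha> - 1 + i + t) (p + \<beta> + l + j + r + (m - t)))"
proof -
  define c where "c s = (-1) ^ s * real ((l + p) choose (l - s)) * real ((l + (\<beta> - 1)) choose s)" for s
  define d where "d t = (-1) ^ t * real ((m + (\<alpha> - 1)) choose (m - t)) * real ((m + (p + \<beta> + 2 * l)) choose t)" for t
  let ?M = "\<lambda>s t z. fst z ^ (\<alpha> - 1 + i + t) * (1 - fst z) ^ (r + (m - t)) * snd z ^ (\<beta> - 1 + j + (l - s)) * (1 - fst z - snd z) ^ (p + s) :: real"
  have eq: "h z * A m l z * (fst z ^ i * (1 - fst z) ^ r * snd z ^ j) = (\<Sum>s\<le>l. \<Sum>t\<le>m. c s * d t * ?M s t z)" for z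
  proof -
    have "F l z = (\<Sum>s\<le>l. c s * ((1 - fst z - snd z) ^ s * snd z ^ (l - s)))"
      unfolding F_def c_def
    proof (intro sum.cong refl)
      fix s
      have "(fst z + snd z - 1) ^ s = (-1) ^ s * (1 - fst z - snd z) ^ s"
        using power_minus[of "1 - fst z - snd z" s] by (simp add: algebra_simps)
      thus "real (l + p choose (l - s)) * real (l + (\<beta> - 1) choose s) * (fst z + snd z - 1) ^ s * snd z ^ (l - s) =
         (- 1) ^ s * real (l + p choose (l - s)) * real (l + (\<beta> - 1) choose s) * ((1 - fst z - snd z) ^ s * snd z ^ (l - s))"
        by simp
    qed
    hence Aeq: "A m l z = (\<Sum>s\<le>l. \<Sum>t\<le>m. (c s * ((1 - fst z - snd z) ^ s * snd z ^ (l - s))) * (d t * (fst z ^ t * (1 - fst z) ^ (m - t))))"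
      unfolding A_eq poly_jacobi_poly jacobi_nat d_def by (simp add: sum_product mult.commute)
    show ?thesis unfolding h_eq Aeq
      by (simp only: sum_distrib_left sum_distrib_right power_add mult_ac)
  qed
  have int: "set_integrable lebesgue triangle (\<lambda>z. c s * d t * ?M s t z)" for s t
  proof -
    have i: "integrable lborel (\<lambda>z. indicator triangle z *\<^sub>R (c s * d t * ?M s t z))"
      by (rule borel_integrable_compact[OF compact_triangle]) (auto intro!: continuous_intros)
    show ?thesis unfolding set_integrable_def
      by (rule integrable_completion[THEN iffD2, OF borel_measurable_integrable[OF i] i])
  qed
  have "ip (A m l) (\<lambda>z. fst z ^ i * (1 - fst z) ^ r * snd z ^ j) =
      (LINT z:triangle|lebesgue. (\<Sum>s\<le>l. \<Sum>t\<le>m. c s * d t * ?M s t z))"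
    unfolding w_inner_def eq ..
  also have "\<dots> = (\<Sum>s\<le>l. LINT z:triangle|lebesgue. (\<Sum>t\<le>m. c s * d t * ?M s t z))"
    by (rule set_integral_sum_real(2), rule set_integral_sum_real(1), rule int)
  also have "\<dots> = (\<Sum>s\<le>l. \<Sum>t\<le>m. LINT z:triangle|lebesgue. c s * d t * ?M s t z)"
    by (intro sum.cong refl set_integral_sum_real(2) int)
  also have "\<dots> = (\<Sum>s\<le>l. \<Sum>t\<le>m. c s * d t * (beta_nat (p + s) (\<beta> - 1 + j + (l - s)) * beta_nat (\<alpha> - 1 + i + t) (p + \<beta> + l + j + r + (m - t))))"
  proof (intro sum.cong refl)
    fix s t assume s: "s \<in> {..l}"
    have e: "r + (m - t) + (\<beta> - 1 + j + (l - s)) + (p + s) + 1 = p + \<beta> + l + j + r + (m - t)"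
      using s \<beta> by simp
    have "beta_nat (\<beta> - 1 + j + (l - s)) (p + s) = beta_nat (p + s) (\<beta> - 1 + j + (l - s))"
      by (simp add: beta_nat_def add_ac)
    thus "(LINT z:triangle|lebesgue. c s * d t * ?M s t z) = c s * d t * (beta_nat (p + s) (\<beta> - 1 + j + (l - s)) * beta_nat (\<alpha> - 1 + i + t) (p + \<beta> + l + j + r + (m - t)))"
      using triangle_integral_monomial[of "\<alpha> - 1 + i + t" "r + (m - t)" "\<beta> - 1 + j + (l - s)" "p + s", unfolded e] by simp
  qed
  also have "\<dots> = (\<Sum>s\<le>l. c s * beta_nat (p + 0 + s) (\<beta> - 1 + j + (l - s))) * (\<Sum>t\<le>m. d t * beta_nat (\<alpha> - 1 + i + t) (p + \<beta> + l + j + r + (m - t)))"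
    by (simp add: sum_product mult_ac)
  finally show ?thesis unfolding c_def d_def .
qed

lemma A_orth_low_snd_power:
  assumes "j < l" shows "ip (A m l) (\<lambda>z. fst z ^ i * (1 - fst z) ^ r * snd z ^ j) = 0"
  unfolding ip_A_monomial using jacobi_beta_sum_eq_0[of 0 j l p "\<beta> - 1"] assms by simp

text \<open>For j < l the first sum vanishes. For j \<ge> l the exponent of 1 - x exceeds the Jacobi
  parameter by j - l, and the second sum vanishes because i + (j - l) < m.\<close>

lemma A_orth_monomial:
  assumes "i + j < m + l" shows "ip (A m l) (\<lambda>z. fst z ^ i * snd z ^ j) = 0"
proof (cases "j < l")
  case True
  thus ?thesis using A_orth_low_snd_power[OF True, of m i 0] by simp
next
  case False
  have e: "p + \<beta> + l + j + 0 + (m - t) = p + \<beta> + 2 * l + (j - l) + (m - t)" for t using False by simp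
  have "ip (A m l) (\<lambda>z. fst z ^ i * (1 - fst z) ^ 0 * snd z ^ j) = 0"
    unfolding ip_A_monomial e
    using jacobi_beta_sum_eq_0[of i "j - l" m "\<alpha> - 1" "p + \<beta> + 2 * l"] assms False by simp
  thus ?thesis by simp
qed

text \<open>The prefactor x^a y^b collects the coordinates peeled off during the induction.\<close>

lemma deg_less_orthogonal:
  assumes w: "w \<in> wL2 h" and Z: "\<And>i j. i + j < N \<Longrightarrow> ip w (\<lambda>z. fst z ^ i * snd z ^ j) = 0"
  shows "deg_less n f \<Longrightarrow> a + b + n \<le> N \<Longrightarrow> ip w (\<lambda>z. fst z ^ a * snd z ^ b * f z) = 0"
proof (induction n f arbitrary: a b rule: deg_less.induct)
  case (deg_less_zero n)
  then show ?case by (simp add: w_inner_def)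
next
  case (deg_less_const n c)
  have "ip w (\<lambda>z. fst z ^ a * snd z ^ b * c) = c * ip w (\<lambda>z. fst z ^ a * snd z ^ b)"
    using ip_cmult_right[of w c "\<lambda>z. fst z ^ a * snd z ^ b"] by (simp add: mult.commute)
  thus ?case using Z[of a b] deg_less_const.prems by simp
next
  case (deg_less_fst n f)
  then show ?case using deg_less_fst.IH[of "Suc a" b] by (simp add: mult_ac)
next
  case (deg_less_snd n f)
  then show ?case using deg_less_snd.IH[of a "Suc b"] by (simp add: mult_ac)
next
  case (deg_less_add n f g)
  have "poly_fun f" "poly_fun g" using deg_less_add.hyps deg_less_poly_fun by auto
  hence "(\<lambda>z. fst z ^ a * snd z ^ b * f z) \<in> wL2 h" "(\<lambda>z. fst z ^ a * snd z ^ b * g z) \<in> wL2 h"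
    by (intro wL2_poly_fun poly_fun_mult poly_fun_power; simp)+
  thus ?case using deg_less_add w by (simp add: distrib_left ip_add_right)
qed

lemma A_orth_lower_degree:
  assumes "deg_less (m + l) r" shows "ip (A m l) r = 0"
  using deg_less_orthogonal[where N = "m + l" and a = 0 and b = 0, OF wL2_poly_fun[OF poly_fun_A[of m l]] A_orth_monomial assms] by simp

abbreviation null :: "(real \<times> real \<Rightarrow> real) \<Rightarrow> (real \<times> real \<Rightarrow> real) \<Rightarrow> bool" where
  "null w f \<equiv> poly_fun f \<and> ip w f = 0"

lemma null_cmult: "null w f \<Longrightarrow> null w (\<lambda>z. c * f z)"
  by (auto simp: ip_cmult_right intro: poly_fun_mult)

lemma null_sum: "w \<in> wL2 h \<Longrightarrow> (\<And>i. i \<in> S \<Longrightarrow> null w (f i)) \<Longrightarrow> null w (\<lambda>z. \<Sum>i\<in>S. f i z)"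
  by (auto simp: ip_sum_right wL2_poly_fun intro!: poly_fun_sum)

text \<open>Settles equal total degrees, where comparison of degrees gives nothing. In
  \<open>A m l\<close> only powers of y up to \<open>l\<close> occur, with coefficients built from x
  and 1 - x, and \<open>A m' l'\<close> is orthogonal to each such term.\<close>

lemma A_orth_smaller_second_index:
  assumes "l < l'" shows "ip (A m' l') (A m l) = 0"
proof -
  define c where "c s = real ((l + p) choose (l - s)) * real ((l + (\<beta> - 1)) choose s)" for s
  define d where "d t = (-1) ^ t * real ((m + (\<alpha> - 1)) choose (m - t)) * real ((m + (p + \<beta> + 2 * l)) choose t)" for t
  let ?M = "\<lambda>t s q z. fst z ^ t * (1 - fst z) ^ (m - t + (s - q)) * snd z ^ (l - s + q) :: real"
  have F: "F l z = (\<Sum>s\<le>l. \<Sum>q\<le>s. c s * (real (s choose q) * (-1) ^ (s - q)) * ((1 - fst z) ^ (s - q) * snd z ^ (l - s + q)))" for z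
    unfolding F_def c_def
  proof (intro sum.cong refl)
    fix s
    have "(fst z + snd z - 1) ^ s = (snd z + (- (1 - fst z))) ^ s" by (simp add: algebra_simps)
    also have "\<dots> = (\<Sum>q\<le>s. real (s choose q) * snd z ^ q * ((-1) ^ (s - q) * (1 - fst z) ^ (s - q)))"
      unfolding binomial_ring by (subst power_minus) simp
    finally show "real (l + p choose (l - s)) * real (l + (\<beta> - 1) choose s) * (fst z + snd z - 1) ^ s * snd z ^ (l - s) =
        (\<Sum>q\<le>s. real (l + p choose (l - s)) * real (l + (\<beta> - 1) choose s) * (real (s choose q) * (- 1) ^ (s - q)) * ((1 - fst z) ^ (s - q) * snd z ^ (l - s + q)))"
      by (simp add: sum_distrib_left sum_distrib_right power_add mult_ac)
  qed
  have eq: "A m l = (\<lambda>z. \<Sum>t\<le>m. \<Sum>s\<le>l. \<Sum>q\<le>s. (d t * (c s * (real (s choose q) * (-1) ^ (s - q)))) * ?M t s q z)"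
  proof
    fix z
    have "A m l z = (\<Sum>t\<le>m. d t * (fst z ^ t * (1 - fst z) ^ (m - t))) * F l z"
      unfolding A_eq poly_jacobi_poly jacobi_nat d_def ..
    also have "\<dots> = (\<Sum>t\<le>m. d t * (fst z ^ t * (1 - fst z) ^ (m - t)) * F l z)" by (rule sum_distrib_right)
    finally show "A m l z = (\<Sum>t\<le>m. \<Sum>s\<le>l. \<Sum>q\<le>s. (d t * (c s * (real (s choose q) * (-1) ^ (s - q)))) * ?M t s q z)"
      unfolding F sum_distrib_left by (simp only: power_add mult_ac)
  qed
  have M0: "null (A m' l') (?M t s q)" if "s \<le> l" "q \<le> s" for t s q
    using A_orth_low_snd_power[of "l - s + q" l' m' t "m - t + (s - q)"] that assms
    by (intro conjI poly_fun_mult poly_fun_power poly_fun_diff) auto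
  have "null (A m' l') (A m l)"
    unfolding eq by (intro null_sum null_cmult wL2_poly_fun poly_fun_A M0) auto
  thus ?thesis by simp
qed

lemma A_orthogonal:
  assumes "(m, l) \<noteq> (m', l')" shows "ip (A m l) (A m' l') = 0"
proof -
  consider "m' + l' < m + l" | "m + l < m' + l'" | "l < l'" | "l' < l" using assms by force
  thus ?thesis
  proof cases
    case 1
    thus ?thesis using A_orth_lower_degree[OF deg_less_mono[OF deg_less_A]] by simp
  next
    case 2
    thus ?thesis using A_orth_lower_degree[OF deg_less_mono[OF deg_less_A], of m l m' l'] by (simp add: ip_commute)
  next
    case 3
    thus ?thesis using A_orth_smaller_second_index ip_commute by metis
  next
    case 4
    thus ?thesis using A_orth_smaller_second_index by metis
  qed
qed

lemma A_coefficient_decay: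
  assumes "sobolev (2 * k) u"
  shows "\<exists>g \<in> wL2 h. \<forall>m l. (- (real (m + l) * (real (m + l) + \<gamma>))) ^ k * ip u (A m l) = ip g (A m l)"
proof -
  obtain g where g: "g \<in> wL2 h" "\<And>q \<mu>. poly_fun q \<Longrightarrow> (\<forall>w \<in> wL2 h. ip w (apk_op q) = \<mu> * ip w q) \<Longrightarrow> \<mu> ^ k * ip u q = ip g q"
    using weak_eigenfunction_coefficients[OF assms] by blast
  have "(- (real (m + l) * (real (m + l) + \<gamma>))) ^ k * ip u (A m l) = ip g (A m l)" for m l
    using apk_op_eigenfunction[OF deg_less_A A_orth_lower_degree] by (intro g(2)) auto
  thus ?thesis using g(1) by blast
qed

section \<open>Completeness\<close>

text \<open>For fixed \<open>l\<close>, exact degrees in x give all products of \<open>F l\<close>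
  with polynomials in x. Strong induction on \<open>l\<close> then replaces \<open>F l\<close> by
  y^l: that power has the positive coefficient \<open>\<Sum>s\<le>l. c s\<close>, and the other
  terms have smaller powers of y.\<close>

lemma orthogonal_to_A_imp_poly_fun:
  assumes w: "w \<in> wL2 h" and orth: "\<And>m l. ip w (A m l) = 0" and f: "poly_fun f"
  shows "ip w f = 0"
proof -
  have pf: "poly_fun (\<lambda>z. poly q (fst z))" for q :: "real poly"
    using deg_less_poly_fst[of q "degree q"] deg_less_poly_fun by blast
  have pF: "poly_fun (F l)" for l using deg_less_F deg_less_poly_fun by blast
  have ZF: "ip w (\<lambda>z. poly q (fst z) * F l z) = 0" for q l
  proof (rule poly_graded_span[of "\<lambda>m. jacobi_poly m (\<alpha> - 1) (p + \<beta> + 2 * l)" "\<lambda>q. ip w (\<lambda>z. poly q (fst z) * F l z) = 0"])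
    fix q1 q2 :: "real poly" assume "ip w (\<lambda>z. poly q1 (fst z) * F l z) = 0" "ip w (\<lambda>z. poly q2 (fst z) * F l z) = 0"
    thus "ip w (\<lambda>z. poly (q1 + q2) (fst z) * F l z) = 0"
      using w pf pF by (simp add: distrib_right ip_add_right wL2_poly_fun poly_fun_mult)
  next
    fix c q assume "ip w (\<lambda>z. poly q (fst z) * F l z) = 0"
    thus "ip w (\<lambda>z. poly (smult c q) (fst z) * F l z) = 0"
      using ip_cmult_right[of w c "\<lambda>z. poly q (fst z) * F l z"] by (simp add: mult.assoc)
  qed (use jacobi_poly_degree jacobi_poly_lead orth in \<open>simp_all add: A_eq[abs_def]\<close>)
  have Zy: "ip w (\<lambda>z. poly q (fst z) * snd z ^ l) = 0" for q l
  proof (induction l arbitrary: q rule: less_induct)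
    case (less l)
    define c where "c s = real ((l + p) choose (l - s)) * real ((l + (\<beta> - 1)) choose s)" for s
    let ?q = "\<lambda>s i. q * [:-1, 1:] ^ (s - i)"
    have "F l z = (\<Sum>s\<le>l. c s) * snd z ^ l + (\<Sum>s\<le>l. \<Sum>i<s. c s * real (s choose i) * ((fst z - 1) ^ (s - i) * snd z ^ (l - s + i)))" for z
    proof -
      have "c s * (fst z + snd z - 1) ^ s * snd z ^ (l - s)
         = c s * snd z ^ l + (\<Sum>i<s. c s * real (s choose i) * ((fst z - 1) ^ (s - i) * snd z ^ (l - s + i)))" if "s \<le> l" for s
      proof -
        have "(fst z + snd z - 1) ^ s = (snd z + (fst z - 1)) ^ s" by (simp add: algebra_simps)
        also have "\<dots> = (\<Sum>i<s. real (s choose i) * snd z ^ i * (fst z - 1) ^ (s - i)) + snd z ^ s"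
          unfolding binomial_ring by (simp add: lessThan_Suc_atMost[symmetric])
        finally have E: "(fst z + snd z - 1) ^ s = (\<Sum>i<s. real (s choose i) * snd z ^ i * (fst z - 1) ^ (s - i)) + snd z ^ s" .
        have y: "snd z ^ s * snd z ^ (l - s) = snd z ^ l" using that by (simp flip: power_add)
        have "c s * (fst z + snd z - 1) ^ s * snd z ^ (l - s) = c s * (snd z ^ s * snd z ^ (l - s))
            + (\<Sum>i<s. c s * real (s choose i) * ((fst z - 1) ^ (s - i) * snd z ^ (l - s + i)))"
          unfolding E by (simp only: distrib_left distrib_right sum_distrib_left sum_distrib_right power_add mult_ac add.commute)
        thus ?thesis unfolding y .
      qed
      thus ?thesis unfolding F_def c_def[symmetric] by (simp add: sum.distrib sum_distrib_right)
    qed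
    hence eq: "(\<lambda>z. poly q (fst z) * F l z) = (\<lambda>z. (\<Sum>s\<le>l. c s) * (poly q (fst z) * snd z ^ l)
        + (\<Sum>s\<le>l. \<Sum>i<s. c s * real (s choose i) * (poly (?q s i) (fst z) * snd z ^ (l - s + i))))"
      by (simp add: fun_eq_iff distrib_left sum_distrib_left mult_ac)
    have pm: "poly_fun (\<lambda>z. poly q (fst z) * snd z ^ j)" for q j by (intro poly_fun_mult pf poly_fun_power) auto
    define R where "R z = (\<Sum>s\<le>l. \<Sum>i<s. c s * real (s choose i) * (poly (?q s i) (fst z) * snd z ^ (l - s + i)))" for z
    have R0: "null w (\<lambda>z. poly (?q s i) (fst z) * snd z ^ (l - s + i))" if "s \<le> l" "i < s" for s i
      using that by (intro conjI pm less.IH) auto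
    have "null w R" unfolding R_def[abs_def]
      by (intro null_sum null_cmult w R0) auto
    moreover have "poly_fun (\<lambda>z. (\<Sum>s\<le>l. c s) * (poly q (fst z) * snd z ^ l))" by (intro poly_fun_mult[OF poly_fun_const pm])
    moreover have "ip w (\<lambda>z. (\<Sum>s\<le>l. c s) * (poly q (fst z) * snd z ^ l) + R z) = 0"
      using ZF[of q l] unfolding eq R_def .
    ultimately have "(\<Sum>s\<le>l. c s) * ip w (\<lambda>z. poly q (fst z) * snd z ^ l) = 0"
      using w by (simp add: ip_add_right wL2_poly_fun ip_cmult_right)
    moreover have "(\<Sum>s\<le>l. c s) > 0" unfolding c_def by (intro sum_pos2[of _ 0]) auto
    ultimately show ?case by simp
  qed
  obtain n where "deg_less n f" using f by (auto simp: poly_fun_def)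
  moreover have "ip w (\<lambda>z. fst z ^ i * snd z ^ j) = 0" for i j
    using Zy[of "monom 1 i" j] by (simp add: poly_monom)
  ultimately show ?thesis using deg_less_orthogonal[OF w, of n n f 0 0] by simp
qed

text \<open>Positivity of \<open>h\<close> in the open triangle settles interior points by a small
  ball; the boundary follows by density.\<close>

lemma continuous_null_imp_zero:
  assumes w: "continuous_on triangle w" and null: "ip w w = 0" and z: "z \<in> triangle"
  shows "w z = 0"
proof -
  have int: "w z = 0" if z: "z \<in> interior triangle" for z
  proof (rule ccontr)
    assume nz: "w z \<noteq> 0"
    let ?f = "\<lambda>z. h z * (w z)\<^sup>2"
    have c: "continuous_on (interior triangle) ?f"
      using w interior_subset by (intro continuous_intros continuous_on_poly_fun[OF poly_fun_h]) (auto intro: continuous_on_subset)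
    have fz: "?f z > 0" using nz h_pos[OF z] by simp
    have "isCont ?f z" using c z by (simp add: continuous_on_eq_continuous_at)
    then obtain d where d: "d > 0" "\<And>y. dist y z < d \<Longrightarrow> dist (?f y) (?f z) < ?f z / 2"
      using fz unfolding continuous_at_eps_delta by (meson half_gt_zero)
    obtain d' where d': "d' > 0" "ball z d' \<subseteq> interior triangle"
      using z open_interior openE by blast
    define r where "r = min d d'"
    have r: "r > 0" "ball z r \<subseteq> interior triangle" using d(1) d' by (auto simp: r_def)
    have low: "?f y \<ge> ?f z / 2" if "y \<in> ball z r" for y
      using d(2)[of y] that by (auto simp: r_def dist_commute dist_real_def abs_if split: if_splits)
    have "(LINT y|lebesgue. ?f z / 2 * indicator (ball z r) y) \<le> (LINT y|lebesgue. indicator triangle y *\<^sub>R (h y * w y * w y))"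
    proof (rule integral_mono)
      show "integrable lebesgue (\<lambda>y. ?f z / 2 * indicator (ball z r) y)"
        using emeasure_bounded_finite[of "ball z r"] by (intro integrable_mult_right integrable_real_indicator) auto
      show "integrable lebesgue (\<lambda>y. indicator triangle y *\<^sub>R (h y * w y * w y))"
        using wL2_integrable[OF wL2_cont[OF w] wL2_cont[OF w]] by (simp add: set_integrable_def)
      fix y
      show "?f z / 2 * indicator (ball z r) y \<le> indicator triangle y *\<^sub>R (h y * w y * w y)"
        using low[of y] r(2) interior_subset[of triangle] h_nonneg[of y]
        by (auto simp: indicator_def power2_eq_square mult.assoc)
    qed
    also have "\<dots> = 0" using null by (simp add: w_inner_def set_lebesgue_integral_def)
    finally have "?f z / 2 * measure lebesgue (ball z r) \<le> 0" by simp
    moreover have "measure lebesgue (ball z r) > 0" using content_ball_pos[OF r(1)] by simp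
    hence "?f z / 2 * measure lebesgue (ball z r) > 0" using fz by (intro mult_pos_pos) auto
    ultimately show False by linarith
  qed
  have "z \<in> closure (interior triangle)" using z by (simp add: closure_interior_triangle)
  moreover have "continuous_on (closure (interior triangle)) w" using w by (simp add: closure_interior_triangle)
  ultimately show ?thesis using continuous_constant_on_closure[of "interior triangle" w 0 z] int by blast
qed

lemma real_polynomial_function_poly_fun:
  fixes g :: "real \<times> real \<Rightarrow> real"
  assumes "real_polynomial_function g" shows "poly_fun g"
  using assms
proof (induction g rule: real_polynomial_function.induct)
  case (linear f)
  have "f z = fst z * f (1, 0) + snd z * f (0, 1)" for z
  proof -
    have "f z = f (fst z *\<^sub>R (1, 0) + snd z *\<^sub>R (0, 1))" by simp
    also have "\<dots> = fst z * f (1, 0) + snd z * f (0, 1)"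
      using linear by (simp only: linear_add[OF bounded_linear.linear] linear_scale[OF bounded_linear.linear] real_scaleR_def)
    finally show ?thesis .
  qed
  hence "f = (\<lambda>z. fst z * f (1, 0) + snd z * f (0, 1))" by blast
  moreover have "poly_fun (\<lambda>z. fst z * f (1, 0) + snd z * f (0, 1))" by (intro poly_fun_add poly_fun_mult) auto
  ultimately show ?case by simp
qed (auto intro: poly_fun_add poly_fun_mult)

text \<open>Orthogonality to all polynomials gives \<open>ip w w = ip (w - g) w\<close> for every
  polynomial \<open>g\<close>, and the Stone-Weierstrass theorem makes the right side small.\<close>

lemma A_complete:
  assumes w: "continuous_on triangle w" and orth: "\<And>m l. ip w (A m l) = 0" and z: "z \<in> triangle"
  shows "w z = 0"
proof -
  have L: "w \<in> wL2 h" using w by (rule wL2_cont)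
  have "(ip w w)\<^sup>2 \<le> e\<^sup>2 * (ip (\<lambda>_. 1) (\<lambda>_. 1) * ip w w)" if e: "e > 0" for e
  proof -
    obtain g where g: "real_polynomial_function g" "\<And>x. x \<in> triangle \<Longrightarrow> \<bar>w x - g x\<bar> < e"
      using Stone_Weierstrass_real_polynomial_function[OF compact_triangle w e] by blast
    have pg: "poly_fun g" by (rule real_polynomial_function_poly_fun[OF g(1)])
    have L': "g \<in> wL2 h" "(\<lambda>z. w z - g z) \<in> wL2 h" using pg L by (auto intro: wL2_poly_fun wL2_diff)
    have "ip w w = ip (\<lambda>z. w z - g z) w"
      using orthogonal_to_A_imp_poly_fun[OF L orth pg] L L' by (simp add: ip_diff_left ip_commute[of g w])
    hence "(ip w w)\<^sup>2 \<le> ip (\<lambda>z. w z - g z) (\<lambda>z. w z - g z) * ip w w"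
      using ip_Cauchy_Schwarz[OF L'(2) L] by simp
    also have "\<dots> \<le> (e\<^sup>2 * ip (\<lambda>_. 1) (\<lambda>_. 1)) * ip w w"
      using g(2) e by (intro mult_right_mono ip_nonneg ip_le_sup_norm L'(2)) (auto simp: less_imp_le)
    finally show ?thesis by (simp add: mult.assoc)
  qed
  hence "(ip w w)\<^sup>2 \<le> 0" by (rule nonpos_if_le_small_squares)
  hence "ip w w = 0" by simp
  thus ?thesis using continuous_null_imp_zero[OF w _ z] by simp
qed

end

section \<open>Point values of polynomials on the triangle\<close>

lemma poly_along_line:
  assumes "deg_less (Suc m) f"
  shows "\<exists>q. degree q \<le> m \<and> (\<forall>t. f (z + t *\<^sub>R e) = poly q t)"
proof -
  have "\<exists>q. (\<forall>i\<ge>n. coeff q i = 0) \<and> (\<forall>t. f (z + t *\<^sub>R e) = poly q t)" if "deg_less n f" for n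
    using that
  proof (induction n f rule: deg_less.induct)
    case (deg_less_zero n)
    show ?case by (intro exI[of _ 0]) simp
  next
    case (deg_less_const n c)
    show ?case by (intro exI[of _ "[:c:]"]) (auto simp: coeff_pCons split: nat.splits)
  next
    case (deg_less_fst n f)
    then obtain q where q: "\<forall>i\<ge>n. coeff q i = 0" "\<forall>t. f (z + t *\<^sub>R e) = poly q t" by blast
    thus ?case by (intro exI[of _ "smult (fst z) q + pCons 0 (smult (fst e) q)"])
      (auto simp: coeff_pCons algebra_simps split: nat.splits)
  next
    case (deg_less_snd n f)
    then obtain q where q: "\<forall>i\<ge>n. coeff q i = 0" "\<forall>t. f (z + t *\<^sub>R e) = poly q t" by blast
    thus ?case by (intro exI[of _ "smult (snd z) q + pCons 0 (smult (snd e) q)"])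
      (auto simp: coeff_pCons algebra_simps split: nat.splits)
  next
    case (deg_less_add n f g)
    then obtain q r where "\<forall>i\<ge>n. coeff q i = 0" "\<forall>t. f (z + t *\<^sub>R e) = poly q t"
      "\<forall>i\<ge>n. coeff r i = 0" "\<forall>t. g (z + t *\<^sub>R e) = poly r t" by blast
    thus ?case by (intro exI[of _ "q + r"]) simp
  qed
  from this[OF assms] obtain q where "\<forall>i\<ge>Suc m. coeff q i = 0" "\<forall>t. f (z + t *\<^sub>R e) = poly q t" by blast
  thus ?thesis by (intro exI[of _ q]) (auto intro: degree_le)
qed

text \<open>Directions of determinant 1 or -1, one of them parallel to an axis. This suffices for
  parallelograms at all three vertices, and the change of variables reduces to translations and
  reflections inside iterated integrals.\<close>

definition unit_frame :: "real \<times> real \<Rightarrow> real \<times> real \<Rightarrow> bool" where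
  "unit_frame e e' \<longleftrightarrow> (snd e' = 0 \<and> \<bar>fst e'\<bar> = 1 \<and> \<bar>snd e\<bar> = 1) \<or> (fst e' = 0 \<and> \<bar>snd e'\<bar> = 1 \<and> \<bar>fst e\<bar> = 1)"

lemma nn_integral_unit_frame:
  fixes g :: "real \<times> real \<Rightarrow> ennreal"
  assumes g [measurable]: "g \<in> borel_measurable borel" and f: "unit_frame e e'"
  shows "(\<integral>\<^sup>+s. \<integral>\<^sup>+t. g (z + s *\<^sub>R e + t *\<^sub>R e') \<partial>lborel \<partial>lborel) = (\<integral>\<^sup>+y. g y \<partial>lborel)"
proof -
  have aff: "(\<integral>\<^sup>+t. k (a + c * t) \<partial>lborel) = (\<integral>\<^sup>+t. k t \<partial>lborel)"
    if "\<bar>c\<bar> = 1" "k \<in> borel_measurable borel" for k :: "real \<Rightarrow> ennreal" and a c :: real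
    using nn_integral_real_affine[of k c a] that by auto
  have gp [measurable]: "g \<in> borel_measurable (lborel \<Otimes>\<^sub>M lborel)" by (simp add: lborel_prod)
  from f show ?thesis unfolding unit_frame_def
  proof (elim disjE conjE)
    assume e: "snd e' = 0" "\<bar>fst e'\<bar> = 1" "\<bar>snd e\<bar> = 1"
    have "(\<integral>\<^sup>+t. g (z + s *\<^sub>R e + t *\<^sub>R e') \<partial>lborel) = (\<integral>\<^sup>+t. g (t, snd z + snd e * s) \<partial>lborel)" for s
    proof -
      have "(\<integral>\<^sup>+t. g (z + s *\<^sub>R e + t *\<^sub>R e') \<partial>lborel) = (\<integral>\<^sup>+t. (\<lambda>x. g (x, snd z + snd e * s)) ((fst z + s * fst e) + fst e' * t) \<partial>lborel)"
        by (intro nn_integral_cong arg_cong[of _ _ g] prod_eqI) (auto simp: e algebra_simps)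
      also have "\<dots> = (\<integral>\<^sup>+t. g (t, snd z + snd e * s) \<partial>lborel)" by (rule aff[OF e(2)]) measurable
      finally show ?thesis .
    qed
    hence "(\<integral>\<^sup>+s. \<integral>\<^sup>+t. g (z + s *\<^sub>R e + t *\<^sub>R e') \<partial>lborel \<partial>lborel) = (\<integral>\<^sup>+s. (\<lambda>y. \<integral>\<^sup>+t. g (t, y) \<partial>lborel) (snd z + snd e * s) \<partial>lborel)"
      by simp
    also have "\<dots> = (\<integral>\<^sup>+y. \<integral>\<^sup>+t. g (t, y) \<partial>lborel \<partial>lborel)" by (rule aff[OF e(3)]) measurable
    also have "\<dots> = (\<integral>\<^sup>+y. g y \<partial>(lborel \<Otimes>\<^sub>M lborel))" by (rule lborel_pair.nn_integral_snd[OF gp])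
    finally show ?thesis by (simp add: lborel_prod)
  next
    assume e: "fst e' = 0" "\<bar>snd e'\<bar> = 1" "\<bar>fst e\<bar> = 1"
    have "(\<integral>\<^sup>+t. g (z + s *\<^sub>R e + t *\<^sub>R e') \<partial>lborel) = (\<integral>\<^sup>+t. g (fst z + fst e * s, t) \<partial>lborel)" for s
    proof -
      have "(\<integral>\<^sup>+t. g (z + s *\<^sub>R e + t *\<^sub>R e') \<partial>lborel) = (\<integral>\<^sup>+t. (\<lambda>x. g (fst z + fst e * s, x)) ((snd z + s * snd e) + snd e' * t) \<partial>lborel)"
        by (intro nn_integral_cong arg_cong[of _ _ g] prod_eqI) (auto simp: e algebra_simps)
      also have "\<dots> = (\<integral>\<^sup>+t. g (fst z + fst e * s, t) \<partial>lborel)" by (rule aff[OF e(2)]) measurable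
      finally show ?thesis .
    qed
    hence "(\<integral>\<^sup>+s. \<integral>\<^sup>+t. g (z + s *\<^sub>R e + t *\<^sub>R e') \<partial>lborel \<partial>lborel) = (\<integral>\<^sup>+s. (\<lambda>x. \<integral>\<^sup>+t. g (x, t) \<partial>lborel) (fst z + fst e * s) \<partial>lborel)"
      by simp
    also have "\<dots> = (\<integral>\<^sup>+x. \<integral>\<^sup>+t. g (x, t) \<partial>lborel \<partial>lborel)" by (rule aff[OF e(3)]) measurable
    also have "\<dots> = (\<integral>\<^sup>+y. g y \<partial>(lborel \<Otimes>\<^sub>M lborel))" by (rule lborel.nn_integral_fst[OF gp])
    finally show ?thesis by (simp add: lborel_prod)
  qed
qed

text \<open>The bound along \<open>e\<close> at \<open>z\<close> is followed by the bound along
  \<open>e'\<close> at each point of that line. The constant depends on the weights only, neither on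
  the point nor on the directions.\<close>

lemma point_bound_plane:
  assumes p1: "point_bound w r" and p2: "point_bound w' r'"
  shows "\<exists>C\<ge>0. \<forall>m\<ge>1. \<forall>f z e e'. deg_less (Suc m) f \<longrightarrow> ennreal ((f z)\<^sup>2) \<le> ennreal (C * real m powr (r + r')) *
     (\<integral>\<^sup>+s. \<integral>\<^sup>+t. ennreal (w s) * ennreal (w' t * (f (z + s *\<^sub>R e + t *\<^sub>R e'))\<^sup>2) \<partial>lborel \<partial>lborel)"
proof -
  obtain C where C: "C \<ge> 0" "\<And>m p. m \<ge> 1 \<Longrightarrow> degree p \<le> m \<Longrightarrow>
     ennreal ((poly p 0)\<^sup>2) \<le> ennreal (C * real m powr r) * (\<integral>\<^sup>+t. ennreal (w t * (poly p t)\<^sup>2) \<partial>lborel)"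
    and [measurable]: "w \<in> borel_measurable borel"
    using p1 unfolding point_bound_def by blast
  obtain C' where C': "C' \<ge> 0" "\<And>m p. m \<ge> 1 \<Longrightarrow> degree p \<le> m \<Longrightarrow>
     ennreal ((poly p 0)\<^sup>2) \<le> ennreal (C' * real m powr r') * (\<integral>\<^sup>+t. ennreal (w' t * (poly p t)\<^sup>2) \<partial>lborel)"
    and [measurable]: "w' \<in> borel_measurable borel"
    using p2 unfolding point_bound_def by blast
  have "ennreal ((f z)\<^sup>2) \<le> ennreal (C * C' * real m powr (r + r')) *
     (\<integral>\<^sup>+s. \<integral>\<^sup>+t. ennreal (w s) * ennreal (w' t * (f (z + s *\<^sub>R e + t *\<^sub>R e'))\<^sup>2) \<partial>lborel \<partial>lborel)"
    if m: "m \<ge> 1" and f: "deg_less (Suc m) f" for m f z e e'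
  proof -
    let ?c = "C * real m powr r" and ?c' = "C' * real m powr r'"
    have [measurable]: "f \<in> borel_measurable borel"
      by (intro borel_measurable_continuous_onI continuous_on_poly_fun deg_less_poly_fun[OF f])
    have gm [measurable]: "(\<lambda>(s, t). f (z + s *\<^sub>R e + t *\<^sub>R e')) \<in> borel_measurable (lborel \<Otimes>\<^sub>M lborel)"
      by measurable
    have inner: "ennreal ((f y)\<^sup>2) \<le> ennreal ?c' * (\<integral>\<^sup>+t. ennreal (w' t * (f (y + t *\<^sub>R e'))\<^sup>2) \<partial>lborel)" for y
    proof -
      obtain q where q: "degree q \<le> m" "\<And>t. f (y + t *\<^sub>R e') = poly q t" using poly_along_line[OF f] by blast
      have "poly q 0 = f y" using q(2)[of 0] by simp
      thus ?thesis using C'(2)[OF m q(1)] by (simp add: q(2))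
    qed
    obtain q where q: "degree q \<le> m" "\<And>t. f (z + t *\<^sub>R e) = poly q t" using poly_along_line[OF f] by blast
    have "ennreal ((f z)\<^sup>2) \<le> ennreal ?c * (\<integral>\<^sup>+s. ennreal (w s * (f (z + s *\<^sub>R e))\<^sup>2) \<partial>lborel)"
      using C(2)[OF m q(1)] q(2)[of 0] by (simp add: q(2))
    also have "(\<integral>\<^sup>+s. ennreal (w s * (f (z + s *\<^sub>R e))\<^sup>2) \<partial>lborel)
        \<le> (\<integral>\<^sup>+s. ennreal ?c' * (\<integral>\<^sup>+t. ennreal (w s) * ennreal (w' t * (f (z + s *\<^sub>R e + t *\<^sub>R e'))\<^sup>2) \<partial>lborel) \<partial>lborel)"
    proof (rule nn_integral_mono)
      fix s
      have "ennreal (w s * (f (z + s *\<^sub>R e))\<^sup>2) = ennreal (w s) * ennreal ((f (z + s *\<^sub>R e))\<^sup>2)"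
        by (rule ennreal_mult'') simp
      also have "\<dots> \<le> ennreal (w s) * (ennreal ?c' * (\<integral>\<^sup>+t. ennreal (w' t * (f (z + s *\<^sub>R e + t *\<^sub>R e'))\<^sup>2) \<partial>lborel))"
        by (intro mult_left_mono inner) simp
      also have "\<dots> = ennreal ?c' * (\<integral>\<^sup>+t. ennreal (w s) * ennreal (w' t * (f (z + s *\<^sub>R e + t *\<^sub>R e'))\<^sup>2) \<partial>lborel)"
        by (subst nn_integral_cmult) (simp_all add: mult.left_commute)
      finally show "ennreal (w s * (f (z + s *\<^sub>R e))\<^sup>2) \<le> \<dots>" .
    qed
    also have "\<dots> = ennreal ?c' * (\<integral>\<^sup>+s. \<integral>\<^sup>+t. ennreal (w s) * ennreal (w' t * (f (z + s *\<^sub>R e + t *\<^sub>R e'))\<^sup>2) \<partial>lborel \<partial>lborel)"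
      by (intro nn_integral_cmult) measurable
    finally have "ennreal ((f z)\<^sup>2) \<le> ennreal ?c * (ennreal ?c' *
        (\<integral>\<^sup>+s. \<integral>\<^sup>+t. ennreal (w s) * ennreal (w' t * (f (z + s *\<^sub>R e + t *\<^sub>R e'))\<^sup>2) \<partial>lborel \<partial>lborel))"
      by (simp add: mult_left_mono)
    also have "\<dots> = ennreal (C * C' * real m powr (r + r')) *
        (\<integral>\<^sup>+s. \<integral>\<^sup>+t. ennreal (w s) * ennreal (w' t * (f (z + s *\<^sub>R e + t *\<^sub>R e'))\<^sup>2) \<partial>lborel \<partial>lborel)"
    proof -
      have "ennreal ?c * ennreal ?c' = ennreal (?c * ?c')" using C(1) C'(1) by (intro ennreal_mult[symmetric]) auto
      also have "?c * ?c' = C * C' * real m powr (r + r')" by (simp add: powr_add)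
      finally show ?thesis by (simp only: mult.assoc[symmetric])
    qed
    finally show ?thesis .
  qed
  thus ?thesis using C(1) C'(1) by (intro exI[of _ "C * C'"]) auto
qed

context apk_weight
begin

section \<open>Nikolskii inequalities on the triangle\<close>

text \<open>The exponent refers to the square, so \<open>r = 2 * s\<close> bounds the value itself
  by m^s times the norm. The constant is uniform over \<open>S\<close>, so finitely many regions can
  be united.\<close>

definition nikolskii :: "(real \<times> real) set \<Rightarrow> real \<Rightarrow> bool" where
  "nikolskii S r \<longleftrightarrow> (\<exists>K\<ge>0. \<forall>z\<in>S. \<forall>m\<ge>1. \<forall>f. deg_less (Suc m) f \<longrightarrow> (f z)\<^sup>2 \<le> K * real m powr r * ip f f)"

lemma nikolskii_mono:
  assumes "nikolskii S r" "S' \<subseteq> S" "r \<le> r'" shows "nikolskii S' r'"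
proof -
  obtain K where K: "K \<ge> 0" "\<And>z m f. z \<in> S \<Longrightarrow> m \<ge> 1 \<Longrightarrow> deg_less (Suc m) f \<Longrightarrow> (f z)\<^sup>2 \<le> K * real m powr r * ip f f"
    using assms(1) unfolding nikolskii_def by blast
  have "(f z)\<^sup>2 \<le> K * real m powr r' * ip f f" if "z \<in> S'" "m \<ge> 1" "deg_less (Suc m) f" for z m f
  proof -
    have "K * real m powr r * ip f f \<le> K * real m powr r' * ip f f"
      using assms(3) that K(1) ip_nonneg[of f] by (intro mult_right_mono mult_left_mono powr_mono) auto
    thus ?thesis using K(2)[of z m f] that assms(2) by force
  qed
  thus ?thesis unfolding nikolskii_def using K(1) by blast
qed

lemma nikolskii_Un: "nikolskii S r \<Longrightarrow> nikolskii S' r \<Longrightarrow> nikolskii (S \<union> S') r"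
proof -
  assume "nikolskii S r" "nikolskii S' r"
  note n = this
  obtain K where K: "K \<ge> 0" "\<And>z m f. z \<in> S \<Longrightarrow> m \<ge> 1 \<Longrightarrow> deg_less (Suc m) f \<Longrightarrow> (f z)\<^sup>2 \<le> K * real m powr r * ip f f"
    using n(1) unfolding nikolskii_def by blast
  obtain K' where K': "\<And>z m f. z \<in> S' \<Longrightarrow> m \<ge> 1 \<Longrightarrow> deg_less (Suc m) f \<Longrightarrow> (f z)\<^sup>2 \<le> K' * real m powr r * ip f f"
    using n(2) unfolding nikolskii_def by blast
  have "(f z)\<^sup>2 \<le> max K K' * real m powr r * ip f f" if z: "z \<in> S \<union> S'" and m: "m \<ge> 1" "deg_less (Suc m) f" for z m f
  proof -
    have "K * real m powr r * ip f f \<le> max K K' * real m powr r * ip f f"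
      "K' * real m powr r * ip f f \<le> max K K' * real m powr r * ip f f"
      using ip_nonneg[of f] by (auto intro!: mult_right_mono)
    with z K(2)[OF _ m, of z] K'[OF _ m, of z] show ?thesis by (auto intro: order.trans)
  qed
  thus ?thesis unfolding nikolskii_def using K(1) by (intro exI[of _ "max K K'"]) auto
qed

lemma nn_integral_poly_fun_square:
  assumes "poly_fun f"
  shows "(\<integral>\<^sup>+z. ennreal (indicator triangle z * h z * (f z)\<^sup>2) \<partial>lborel) = ennreal (ip f f)"
proof -
  have i: "integrable lborel (\<lambda>z. indicator triangle z *\<^sub>R (h z * (f z)\<^sup>2))"
    by (rule borel_integrable_compact[OF compact_triangle])
       (intro continuous_intros continuous_on_poly_fun assms poly_fun_h)
  have "(\<integral>\<^sup>+z. ennreal (indicator triangle z *\<^sub>R (h z * (f z)\<^sup>2)) \<partial>lborel) = ennreal (LINT z|lborel. indicator triangle z *\<^sub>R (h z * (f z)\<^sup>2))"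
    using h_nonneg by (intro nn_integral_eq_integral i AE_I2) (auto simp: indicator_def)
  also have "(LINT z|lborel. indicator triangle z *\<^sub>R (h z * (f z)\<^sup>2)) = (LINT z|lebesgue. indicator triangle z *\<^sub>R (h z * (f z)\<^sup>2))"
    by (rule integral_completion[symmetric]) (rule borel_measurable_integrable[OF i])
  also have "\<dots> = ip f f" unfolding w_inner_def set_lebesgue_integral_def by (simp add: power2_eq_square mult.assoc)
  finally show ?thesis by (simp add: mult.assoc)
qed

lemma nikolskii_frame:
  assumes p1: "point_bound w r" and p2: "point_bound w' r'" and e: "unit_frame e e'" and c: "c \<ge> 0"
    and dom: "\<And>z s t. z \<in> S \<Longrightarrow> w s * w' t \<le> c * (indicator triangle (z + s *\<^sub>R e + t *\<^sub>R e') * h (z + s *\<^sub>R e + t *\<^sub>R e'))"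
    and nn: "\<And>s. w s \<ge> 0"
  shows "nikolskii S (r + r')"
proof -
  obtain C where C: "C \<ge> 0" "\<And>m f z. m \<ge> 1 \<Longrightarrow> deg_less (Suc m) f \<Longrightarrow> ennreal ((f z)\<^sup>2) \<le> ennreal (C * real m powr (r + r')) *
     (\<integral>\<^sup>+s. \<integral>\<^sup>+t. ennreal (w s) * ennreal (w' t * (f (z + s *\<^sub>R e + t *\<^sub>R e'))\<^sup>2) \<partial>lborel \<partial>lborel)"
    using point_bound_plane[OF p1 p2] by blast
  have "(f z)\<^sup>2 \<le> C * c * real m powr (r + r') * ip f f" if z: "z \<in> S" and m: "m \<ge> 1" and f: "deg_less (Suc m) f" for z m f
  proof -
    let ?g = "\<lambda>y. ennreal c * ennreal (indicator triangle y * h y * (f y)\<^sup>2)"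
    have pf: "poly_fun f" using f deg_less_poly_fun by blast
    have [measurable]: "f \<in> borel_measurable borel" "h \<in> borel_measurable borel"
      by (intro borel_measurable_continuous_onI continuous_on_poly_fun pf poly_fun_h)+
    have "(\<integral>\<^sup>+s. \<integral>\<^sup>+t. ennreal (w s) * ennreal (w' t * (f (z + s *\<^sub>R e + t *\<^sub>R e'))\<^sup>2) \<partial>lborel \<partial>lborel)
        \<le> (\<integral>\<^sup>+s. \<integral>\<^sup>+t. ?g (z + s *\<^sub>R e + t *\<^sub>R e') \<partial>lborel \<partial>lborel)"
    proof (intro nn_integral_mono)
      fix s t
      let ?y = "z + s *\<^sub>R e + t *\<^sub>R e'"
      have "w s * (w' t * (f ?y)\<^sup>2) \<le> c * (indicator triangle ?y * h ?y * (f ?y)\<^sup>2)"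
        using mult_right_mono[OF dom[OF z, of s t], of "(f ?y)\<^sup>2"] by (simp add: mult.assoc)
      thus "ennreal (w s) * ennreal (w' t * (f ?y)\<^sup>2) \<le> ?g ?y"
        using c nn[of s] by (simp add: ennreal_mult'[symmetric] ennreal_leI)
    qed
    also have "\<dots> = (\<integral>\<^sup>+y. ?g y \<partial>lborel)" by (rule nn_integral_unit_frame[OF _ e]) measurable
    also have "\<dots> = ennreal c * ennreal (ip f f)"
      by (subst nn_integral_cmult) (auto simp: nn_integral_poly_fun_square[OF pf])
    finally have "ennreal ((f z)\<^sup>2) \<le> ennreal (C * real m powr (r + r')) * (ennreal c * ennreal (ip f f))"
      using C(2)[OF m f] by (meson mult_left_mono order.trans zero_le)
    also have "\<dots> = ennreal (C * c * real m powr (r + r') * ip f f)"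
    proof -
      have "ennreal c * ennreal (ip f f) = ennreal (c * ip f f)" using c ip_nonneg[of f] by (intro ennreal_mult[symmetric]) auto
      moreover have "ennreal (C * real m powr (r + r')) * ennreal (c * ip f f) = ennreal (C * real m powr (r + r') * (c * ip f f))"
        using C(1) c ip_nonneg[of f] by (intro ennreal_mult[symmetric]) auto
      moreover have "C * real m powr (r + r') * (c * ip f f) = C * c * real m powr (r + r') * ip f f" by simp
      ultimately show ?thesis by (simp only:)
    qed
    finally show ?thesis using C(1) c ip_nonneg[of f] by (subst (asm) ennreal_le_iff) auto
  qed
  thus ?thesis unfolding nikolskii_def using C(1) c by (intro exI[of _ "C * c"]) auto
qed

text \<open>With indicators and densities separated, domination by \<open>h\<close> has to be
  checked only on the parallelogram. The factor 1 in the two-sided weight serves to match this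
  shape.\<close>

lemma nikolskii_frame_on:
  assumes p1: "point_bound (\<lambda>s. indicator X s * \<omega> s) r" and p2: "point_bound (\<lambda>t. indicator X' t * \<omega>' t) r'"
    and e: "unit_frame e e'" and c: "c \<ge> 0" and nn: "\<And>s. s \<in> X \<Longrightarrow> \<omega> s \<ge> 0"
    and dom: "\<And>z s t. z \<in> S \<Longrightarrow> s \<in> X \<Longrightarrow> t \<in> X' \<Longrightarrow>
      z + s *\<^sub>R e + t *\<^sub>R e' \<in> triangle \<and> \<omega> s * \<omega>' t \<le> c * h (z + s *\<^sub>R e + t *\<^sub>R e')"
  shows "nikolskii S (r + r')"
proof (rule nikolskii_frame[OF p1 p2 e c])
  fix z s t assume z: "z \<in> S"
  let ?y = "z + s *\<^sub>R e + t *\<^sub>R e'"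
  have "0 \<le> c * (indicator triangle ?y * h ?y)"
    using c h_nonneg[of ?y] by (auto simp: indicator_def)
  thus "indicator X s * \<omega> s * (indicator X' t * \<omega>' t) \<le> c * (indicator triangle ?y * h ?y)"
    using dom[OF z, of s t] by (cases "s \<in> X \<and> t \<in> X'") auto
qed (auto simp: indicator_def nn)

lemma pow_ratio: "x ^ a \<le> (1 / d) ^ b * (x' ^ a * y ^ b)"
  if "0 \<le> x" "x \<le> x'" "0 < d" "d \<le> y" for x x' y d :: real
proof -
  have "1 ^ b \<le> (y / d) ^ b" using that by (intro power_mono) auto
  hence "1 \<le> (1 / d) ^ b * y ^ b" by (simp add: power_divide)
  moreover have "x ^ a \<le> x' ^ a" using that by (intro power_mono) auto
  ultimately have "x ^ a * 1 \<le> x' ^ a * ((1 / d) ^ b * y ^ b)" using that by (intro mult_mono) auto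
  thus ?thesis by (simp add: mult_ac)
qed

lemma pow_ratio2: "x ^ a * u ^ b \<le> (1 / d) ^ c * (x' ^ a * u' ^ b * y ^ c)"
  if "0 \<le> x" "x \<le> x'" "0 \<le> u" "u \<le> u'" "0 < d" "d \<le> y" for x x' y d u u' :: real
proof -
  have "x ^ a * u ^ b \<le> x ^ a * ((1 / d) ^ c * (u' ^ b * y ^ c))"
    using that by (intro mult_left_mono pow_ratio) auto
  also have "\<dots> \<le> x' ^ a * ((1 / d) ^ c * (u' ^ b * y ^ c))"
    using that by (intro mult_right_mono power_mono) auto
  finally show ?thesis by (simp add: mult_ac)
qed

text \<open>Two steps of length at most 1/12 lower the third barycentric coordinate by at most 1/6,
  so it stays above 1/6, whence \<open>6 ^ p\<close>. The other two coordinates grow to at least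
  \<open>t\<close> and \<open>s\<close>.\<close>

lemma nikolskii_origin: "nikolskii {z \<in> triangle. 1 - fst z - snd z \<ge> 1 / 3} (2 * (real \<alpha> + real \<beta>))"
proof -
  have "nikolskii {z \<in> triangle. 1 - fst z - snd z \<ge> 1 / 3} ((2 * real (\<beta> - 1) + 2) + (2 * real (\<alpha> - 1) + 2))"
  proof (rule nikolskii_frame_on[OF point_bound_power_weight[of "1/12" "\<beta> - 1"] point_bound_power_weight[of "1/12" "\<alpha> - 1"]])
    show "unit_frame (0, 1) (1, 0)" by (simp add: unit_frame_def)
    show "(0::real) \<le> 6 ^ p" by simp
    fix z :: "real \<times> real" and s t :: real
    assume z: "z \<in> {z \<in> triangle. 1 - fst z - snd z \<ge> 1 / 3}" and st: "s \<in> {0..1/12}" "t \<in> {0..1/12}"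
    let ?y = "z + s *\<^sub>R (0, 1) + t *\<^sub>R (1, 0)"
    have y: "?y \<in> triangle" using z st by (auto simp: triangle_iff)
    have "t ^ (\<alpha> - 1) * s ^ (\<beta> - 1) \<le> (1 / (1/6)) ^ p * ((fst z + t) ^ (\<alpha> - 1) * (snd z + s) ^ (\<beta> - 1) * (1 - (fst z + t) - (snd z + s)) ^ p)"
      using st z by (intro pow_ratio2) (auto simp: triangle_iff)
    thus "?y \<in> triangle \<and> s ^ (\<beta> - 1) * t ^ (\<alpha> - 1) \<le> 6 ^ p * h ?y" using st y by (simp add: h_eq mult.commute)
  qed auto
  moreover have "(2 * real (\<beta> - 1) + 2) + (2 * real (\<alpha> - 1) + 2) = 2 * (real \<alpha> + real \<beta>)"
    using \<alpha> \<beta> by (simp add: of_nat_diff)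
  ultimately show ?thesis by (simp only:)
qed

text \<open>The direction (-1, 1) raises only y and (-1, 0) raises only 1 - x - y, both at the
  expense of x.\<close>

lemma nikolskii_right: "nikolskii {z \<in> triangle. fst z \<ge> 1 / 3} (2 * (real \<beta> + real p + 1))"
proof -
  have "nikolskii {z \<in> triangle. fst z \<ge> 1 / 3} ((2 * real (\<beta> - 1) + 2) + (2 * real p + 2))"
  proof (rule nikolskii_frame_on[OF point_bound_power_weight[of "1/12" "\<beta> - 1"] point_bound_power_weight[of "1/12" p]])
    show "unit_frame (-1, 1) (-1, 0)" by (simp add: unit_frame_def)
    show "(0::real) \<le> 6 ^ (\<alpha> - 1)" by simp
    fix z :: "real \<times> real" and s t :: real
    assume z: "z \<in> {z \<in> triangle. fst z \<ge> 1 / 3}" and st: "s \<in> {0..1/12}" "t \<in> {0..1/12}"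
    let ?y = "z + s *\<^sub>R (-1, 1) + t *\<^sub>R (-1, 0)"
    have y: "?y \<in> triangle" using z st by (auto simp: triangle_iff)
    have "s ^ (\<beta> - 1) * t ^ p \<le> (1 / (1/6)) ^ (\<alpha> - 1) * ((snd z + s) ^ (\<beta> - 1) * (1 - (fst z - s - t) - (snd z + s)) ^ p * (fst z - s - t) ^ (\<alpha> - 1))"
      using st z by (intro pow_ratio2) (auto simp: triangle_iff)
    thus "?y \<in> triangle \<and> s ^ (\<beta> - 1) * t ^ p \<le> 6 ^ (\<alpha> - 1) * h ?y" using st y by (simp add: h_eq mult_ac)
  qed auto
  moreover have "(2 * real (\<beta> - 1) + 2) + (2 * real p + 2) = 2 * (real \<beta> + real p + 1)"
    using \<beta> by (simp add: of_nat_diff)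
  ultimately show ?thesis by (simp only:)
qed

lemma nikolskii_top: "nikolskii {z \<in> triangle. snd z \<ge> 1 / 3} (2 * (real \<alpha> + real p + 1))"
proof -
  have "nikolskii {z \<in> triangle. snd z \<ge> 1 / 3} ((2 * real (\<alpha> - 1) + 2) + (2 * real p + 2))"
  proof (rule nikolskii_frame_on[OF point_bound_power_weight[of "1/12" "\<alpha> - 1"] point_bound_power_weight[of "1/12" p]])
    show "unit_frame (1, -1) (0, -1)" by (simp add: unit_frame_def)
    show "(0::real) \<le> 6 ^ (\<beta> - 1)" by simp
    fix z :: "real \<times> real" and s t :: real
    assume z: "z \<in> {z \<in> triangle. snd z \<ge> 1 / 3}" and st: "s \<in> {0..1/12}" "t \<in> {0..1/12}"
    let ?y = "z + s *\<^sub>R (1, -1) + t *\<^sub>R (0, -1)"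
    have y: "?y \<in> triangle" using z st by (auto simp: triangle_iff)
    have "s ^ (\<alpha> - 1) * t ^ p \<le> (1 / (1/6)) ^ (\<beta> - 1) * ((fst z + s) ^ (\<alpha> - 1) * (1 - (fst z + s) - (snd z - s - t)) ^ p * (snd z - s - t) ^ (\<beta> - 1))"
      using st z by (intro pow_ratio2) (auto simp: triangle_iff)
    thus "?y \<in> triangle \<and> s ^ (\<alpha> - 1) * t ^ p \<le> 6 ^ (\<beta> - 1) * h ?y" using st y by (simp add: h_eq mult_ac)
  qed auto
  moreover have "(2 * real (\<alpha> - 1) + 2) + (2 * real p + 2) = 2 * (real \<alpha> + real p + 1)"
    using \<alpha> by (simp add: of_nat_diff)
  ultimately show ?thesis by (simp only:)
qed

text \<open>Barycentric coordinates sum to 1, so one of them is at least 1/3 and the three corner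
  regions cover the triangle.\<close>

lemma nikolskii_triangle:
  assumes "real \<alpha> + real \<beta> \<le> M" "real \<beta> + real p + 1 \<le> M" "real \<alpha> + real p + 1 \<le> M"
  shows "nikolskii triangle (2 * M)"
proof -
  have "nikolskii ({z \<in> triangle. 1 - fst z - snd z \<ge> 1 / 3} \<union> ({z \<in> triangle. fst z \<ge> 1 / 3} \<union> {z \<in> triangle. snd z \<ge> 1 / 3})) (2 * M)"
    using assms by (intro nikolskii_Un nikolskii_mono[OF nikolskii_origin] nikolskii_mono[OF nikolskii_right] nikolskii_mono[OF nikolskii_top]) auto
  thus ?thesis by (rule nikolskii_mono) auto
qed

text \<open>Along the edge the point is interior and costs 1; across it the weight y^(\<beta>-1)
  costs 2 \<beta>. The choice of \<open>d\<close> keeps the other two coordinates above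
  \<open>d\<close>.\<close>

lemma nikolskii_lower_edge:
  assumes x: "0 < x" "x < 1"
  shows "nikolskii {(x, 0)} (2 * real \<beta> + 1)"
proof -
  define d where "d = min x (1 - x) / 4"
  have d: "d > 0" "4 * d \<le> x" "4 * d \<le> 1 - x" using x by (auto simp: d_def)
  have "nikolskii {(x, 0)} ((2 * real (\<beta> - 1) + 2) + 1)"
  proof (rule nikolskii_frame_on[OF point_bound_power_weight[OF d(1), of "\<beta> - 1"] point_bound_two_sided[OF d(1)]])
    show "unit_frame (0, 1) (1, 0)" by (simp add: unit_frame_def)
    show "0 \<le> (1 / d) ^ (\<alpha> - 1) * (1 / d) ^ p" using d by simp
    fix z :: "real \<times> real" and s t :: real
    assume z: "z \<in> {(x, 0)}" and st: "s \<in> {0..d}" "t \<in> {-d..d}"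
    let ?y = "z + s *\<^sub>R (0, 1) + t *\<^sub>R (1, 0)"
    have y: "?y \<in> triangle" using z st d by (auto simp: triangle_iff)
    have "s ^ (\<beta> - 1) * 1 ^ 0 \<le> (1 / d) ^ (\<alpha> - 1) * (s ^ (\<beta> - 1) * 1 ^ 0 * (x + t) ^ (\<alpha> - 1))"
      using st d by (intro pow_ratio2) auto
    also have "\<dots> \<le> (1 / d) ^ (\<alpha> - 1) * (((1 / d) ^ p * (s ^ (\<beta> - 1) * (1 - (x + t) - s) ^ p)) * (x + t) ^ (\<alpha> - 1))"
      using st d by (intro mult_left_mono mult_right_mono) (auto intro!: pow_ratio)
    finally show "?y \<in> triangle \<and> s ^ (\<beta> - 1) * 1 \<le> ((1 / d) ^ (\<alpha> - 1) * (1 / d) ^ p) * h ?y" using st y z by (simp add: h_eq mult_ac)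
  qed auto
  moreover have "(2 * real (\<beta> - 1) + 2) + 1 = 2 * real \<beta> + 1" using \<beta> by (simp add: of_nat_diff)
  ultimately show ?thesis by (simp only:)
qed

lemma nikolskii_hypotenuse:
  assumes x: "0 < x" "x < 1"
  shows "nikolskii {(x, 1 - x)} (2 * real p + 3)"
proof -
  define d where "d = min x (1 - x) / 4"
  have d: "d > 0" "4 * d \<le> x" "4 * d \<le> 1 - x" using x by (auto simp: d_def)
  have "nikolskii {(x, 1 - x)} (1 + (2 * real p + 2))"
  proof (rule nikolskii_frame_on[OF point_bound_two_sided[OF d(1)] point_bound_power_weight[OF d(1), of p]])
    show "unit_frame (1, -1) (-1, 0)" by (simp add: unit_frame_def)
    show "0 \<le> (1 / d) ^ (\<alpha> - 1) * (1 / d) ^ (\<beta> - 1)" using d by simp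
    fix z :: "real \<times> real" and s t :: real
    assume z: "z \<in> {(x, 1 - x)}" and st: "s \<in> {-d..d}" "t \<in> {0..d}"
    let ?y = "z + s *\<^sub>R (1, -1) + t *\<^sub>R (-1, 0)"
    have y: "?y \<in> triangle" using z st d by (auto simp: triangle_iff)
    have "t ^ p * 1 ^ 0 \<le> (1 / d) ^ (\<alpha> - 1) * (t ^ p * 1 ^ 0 * (x + s - t) ^ (\<alpha> - 1))"
      using st d by (intro pow_ratio2) auto
    also have "\<dots> \<le> (1 / d) ^ (\<alpha> - 1) * (((1 / d) ^ (\<beta> - 1) * (t ^ p * (1 - x - s) ^ (\<beta> - 1))) * (x + s - t) ^ (\<alpha> - 1))"
      using st d by (intro mult_left_mono mult_right_mono) (auto intro!: pow_ratio)
    finally show "?y \<in> triangle \<and> 1 * t ^ p \<le> ((1 / d) ^ (\<alpha> - 1) * (1 / d) ^ (\<beta> - 1)) * h ?y" using st y z by (simp add: h_eq mult_ac)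
  qed auto
  thus ?thesis by (simp add: add_ac)
qed

text \<open>Two unweighted directions give the exponent 2, and the stated 3 is still below 7/2,
  twice the 7/4 of the interior rate.\<close>

lemma nikolskii_interior:
  assumes z: "z \<in> interior triangle"
  shows "nikolskii {z} 3"
proof -
  define d where "d = min (fst z) (min (snd z) (1 - fst z - snd z)) / 4"
  have d: "d > 0" "4 * d \<le> fst z" "4 * d \<le> snd z" "4 * d \<le> 1 - fst z - snd z"
    using z by (auto simp: d_def interior_triangle)
  have "nikolskii {z} (1 + 1)"
  proof (rule nikolskii_frame_on[OF point_bound_two_sided[OF d(1)] point_bound_two_sided[OF d(1)]])
    show "unit_frame (0, 1) (1, 0)" by (simp add: unit_frame_def)
    show "0 \<le> (1 / d) ^ (\<alpha> - 1) * (1 / d) ^ (\<beta> - 1) * (1 / d) ^ p" using d by simp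
    fix z' :: "real \<times> real" and s t :: real
    assume z': "z' \<in> {z}" and st: "s \<in> {-d..d}" "t \<in> {-d..d}"
    let ?y = "z' + s *\<^sub>R (0, 1) + t *\<^sub>R (1, 0)"
    have y: "?y \<in> triangle" using z' st d by (auto simp: triangle_iff)
    have one: "1 \<le> ((1 / d) ^ n * v ^ n)" if "d \<le> v" for v n
      using pow_ratio[of 1 1 d v 0 n] that d by simp
    have "1 * 1 * 1 \<le> ((1 / d) ^ (\<alpha> - 1) * (fst z + t) ^ (\<alpha> - 1)) * ((1 / d) ^ (\<beta> - 1) * (snd z + s) ^ (\<beta> - 1)) * ((1 / d) ^ p * (1 - (fst z + t) - (snd z + s)) ^ p)"
      using st d by (intro mult_mono one) (auto intro!: mult_nonneg_nonneg)
    thus "?y \<in> triangle \<and> 1 * 1 \<le> ((1 / d) ^ (\<alpha> - 1) * (1 / d) ^ (\<beta> - 1) * (1 / d) ^ p) * h ?y" using st y z' by (simp add: h_eq mult_ac)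
  qed auto
  thus ?thesis by (rule nikolskii_mono) auto
qed

end

section \<open>Error of the filtered expansion\<close>

text \<open>The short interval is relatively open in the long one, so derivatives within either
  agree. This joins the vanishing derivatives, stated on {0..1}, to the additional smoothness near
  0.\<close>

lemma nderiv_within_restrict:
  assumes "\<epsilon> > 0" "{0..<\<epsilon>} \<subseteq> {0..1}" "t \<in> {0..<\<epsilon>}"
  shows "nderiv_within {0..<\<epsilon>} j \<sigma> t = nderiv_within {0..1} j \<sigma> t"
  using assms(3)
proof (induction j arbitrary: t)
  case (Suc j)
  have eq: "at t within {0..1} = at t within {0..<\<epsilon>}"
    by (rule at_within_nhd[of _ "{..<\<epsilon>}"]) (use Suc.prems assms(2) in auto)
  have "vector_derivative (nderiv_within {0..<\<epsilon>} j \<sigma>) (at t within {0..<\<epsilon>})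
      = vector_derivative (nderiv_within {0..1} j \<sigma>) (at t within {0..<\<epsilon>})"
    by (rule vector_derivative_cong_eq) (use Suc in \<open>auto intro!: always_eventually\<close>)
  thus ?case by (simp add: eq)
qed auto

text \<open>A filter of order \<open>r\<close> has r - 1 vanishing derivatives; the power t^r comes
  from the bounded r-th derivative near 0, by mean values descending through the orders. Away from 0
  the filter is bounded and t^r is bounded below.\<close>

lemma modal_filter_bound:
  assumes \<sigma>: "modal_filter r \<sigma>" and \<epsilon>: "\<epsilon> > 0" "{0..<\<epsilon>} \<subseteq> {0..1}" and Ck: "Ck_on r {0..<\<epsilon>} \<sigma>"
  shows "\<exists>C\<ge>0. \<forall>t\<in>{0..1}. \<bar>1 - \<sigma> t\<bar> \<le> C * t ^ r"
proof -
  define f where "f j = nderiv_within {0..<\<epsilon>} j \<sigma>" for j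
  have r: "r \<ge> 1" and \<sigma>0: "\<sigma> 0 = 1" and cont\<sigma>: "continuous_on {0..1} \<sigma>"
    using \<sigma> by (auto simp: modal_filter_def Ck_on_def)
  have f0: "f j 0 = 0" if "1 \<le> j" "j < r" for j
    using nderiv_within_restrict[OF \<epsilon>, of 0 j \<sigma>] that \<sigma> \<epsilon> by (simp add: f_def modal_filter_def)
  define e where "e = \<epsilon> / 2"
  have e: "0 < e" "e < \<epsilon>" using \<epsilon> by (auto simp: e_def)
  have "continuous_on {0..e} (f r)"
    using Ck e by (auto simp: Ck_on_def f_def intro: continuous_on_subset)
  hence "bounded (f r ` {0..e})" by (intro compact_imp_bounded compact_continuous_image) auto
  then obtain B where B: "\<forall>x \<in> f r ` {0..e}. norm x \<le> B" by (auto simp: bounded_iff)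
  have der: "(f j has_derivative (\<lambda>x. x * f (Suc j) t)) (at t within {0..b})" if "j < r" "t \<in> {0..b}" "b \<le> e" for j t b
  proof -
    have "f j differentiable (at t within {0..<\<epsilon>})"
      using Ck that e unfolding Ck_on_def f_def differentiable_on_def by auto
    hence "(f j has_vector_derivative f (Suc j) t) (at t within {0..<\<epsilon>})"
      by (simp add: vector_derivative_works f_def)
    hence "(f j has_vector_derivative f (Suc j) t) (at t within {0..b})"
      by (rule has_vector_derivative_within_subset) (use that e in auto)
    thus ?thesis by (simp add: has_vector_derivative_def)
  qed
  \<comment> \<open>At \<open>i = 0\<close> the derivative of order \<open>r\<close> is bounded
    itself and nothing is subtracted. For 0 < i < r the value at 0 vanishes, and for
    \<open>i = r\<close> it is \<open>\<sigma> 0 = 1\<close>.\<close>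
  have taylor: "\<bar>f (r - i) t - (if i = 0 then 0 else f (r - i) 0)\<bar> \<le> B * t ^ i" if "i \<le> r" "t \<in> {0..e}" for i t
    using that
  proof (induction i arbitrary: t)
    case 0
    thus ?case using B by auto
  next
    case (Suc i)
    let ?j = "r - Suc i"
    have j: "?j < r" "Suc ?j = r - i" using Suc.prems by auto
    have "\<exists>x\<in>{0..t}. f ?j t - f ?j 0 = (t - 0) * f (Suc ?j) x"
      by (rule mvt_very_simple) (use der[OF j(1)] Suc.prems in auto)
    then obtain x where x: "x \<in> {0..t}" "f ?j t - f ?j 0 = t * f (r - i) x" using j by auto
    have "f (r - i) 0 = 0" if "i \<noteq> 0" using f0[of "r - i"] that Suc.prems by auto
    hence "\<bar>f (r - i) x\<bar> \<le> B * x ^ i"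
      using Suc.IH[of x] Suc.prems x(1) by (cases "i = 0") auto
    also have "\<dots> \<le> B * t ^ i"
      using x(1) B e by (intro mult_left_mono power_mono) (auto intro: order.trans[of 0 "norm (f r 0)"])
    finally have "t * \<bar>f (r - i) x\<bar> \<le> t * (B * t ^ i)" using Suc.prems by (intro mult_left_mono) auto
    thus ?case using x Suc.prems by (simp add: abs_mult mult_ac)
  qed
  have near: "\<bar>1 - \<sigma> t\<bar> \<le> B * t ^ r" if "t \<in> {0..e}" for t
    using taylor[of r t] that r \<sigma>0 by (simp add: f_def abs_minus_commute)
  have "bounded (\<sigma> ` {0..1})" using cont\<sigma> by (intro compact_imp_bounded compact_continuous_image) auto
  then obtain D where D: "\<forall>x \<in> \<sigma> ` {0..1}. norm x \<le> D" by (auto simp: bounded_iff)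
  have "\<bar>\<sigma> 0\<bar> \<le> D" using D by auto
  hence D0: "D \<ge> 0" by (rule order.trans[OF abs_ge_zero])
  define C where "C = max \<bar>B\<bar> ((1 + D) / e ^ r)"
  have "\<bar>1 - \<sigma> t\<bar> \<le> C * t ^ r" if t: "t \<in> {0..1}" for t
  proof (cases "t \<le> e")
    case True
    have "B * t ^ r \<le> C * t ^ r" using t by (intro mult_right_mono) (auto simp: C_def)
    thus ?thesis using near[of t] True t by auto
  next
    case False
    have "\<bar>\<sigma> t\<bar> \<le> D" using D t by auto
    hence "\<bar>1 - \<sigma> t\<bar> \<le> (1 + D) * 1" by (simp add: abs_le_iff)
    also have "\<dots> \<le> (1 + D) * (t / e) ^ r"
      using False e D0 by (intro mult_left_mono one_le_power) auto
    also have "\<dots> = (1 + D) / e ^ r * t ^ r" by (simp add: power_divide)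
    also have "\<dots> \<le> C * t ^ r" using t by (intro mult_right_mono) (auto simp: C_def)
    finally show ?thesis .
  qed
  moreover have "C \<ge> 0" by (simp add: C_def le_max_iff_disj)
  ultimately show ?thesis by blast
qed

lemma sum_two_sided_geometric:
  fixes \<rho> E :: real
  assumes \<rho>: "0 < \<rho>" "\<rho> < 1" and E: "E \<ge> 0"
    and le: "\<And>j. j \<le> L \<Longrightarrow> x j \<le> E * \<rho> ^ (L - j)" and gt: "\<And>j. j > L \<Longrightarrow> x j \<le> E * \<rho> ^ (j - Suc L)"
  shows "(\<Sum>j<J. x j) \<le> 2 * E / (1 - \<rho>)"
proof -
  have geo: "(\<Sum>i<n. \<rho> ^ i) \<le> 1 / (1 - \<rho>)" for n
    using sum_gp_strict[of \<rho> n] \<rho> by (simp add: divide_right_mono)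
  define g where "g j = (if j \<le> L then E * \<rho> ^ (L - j) else E * \<rho> ^ (j - Suc L))" for j
  have g0: "g j \<ge> 0" for j using \<rho> E by (simp add: g_def)
  have "(\<Sum>j<J. x j) \<le> (\<Sum>j<J. g j)" using le gt by (intro sum_mono) (auto simp: g_def)
  also have "\<dots> \<le> (\<Sum>j<Suc L + J. g j)" using g0 by (intro sum_mono2) auto
  also have "\<dots> = (\<Sum>j<Suc L. g j) + (\<Sum>i<J. g (Suc L + i))"
    by (induction J) (auto simp: add_ac)
  also have "(\<Sum>j<Suc L. g j) = (\<Sum>i<Suc L. E * \<rho> ^ i)"
    by (rule sum.reindex_bij_witness[of _ "\<lambda>i. L - i" "\<lambda>i. L - i"]) (auto simp: g_def)
  also have "\<dots> \<le> E * (1 / (1 - \<rho>))" unfolding sum_distrib_left[symmetric] using E geo by (intro mult_left_mono)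
  also have "(\<Sum>i<J. g (Suc L + i)) = (\<Sum>i<J. E * \<rho> ^ i)" by (auto simp: g_def)
  also have "\<dots> \<le> E * (1 / (1 - \<rho>))" unfolding sum_distrib_left[symmetric] using E geo by (intro mult_left_mono)
  finally show ?thesis by (simp add: field_simps)
qed

section \<open>Dyadic blocks of the expansion\<close>

text \<open>Pairs are ordered (l, m) as in \<open>filtered_sum\<close>, while \<open>A\<close> takes
  \<open>m\<close> first. The blocks \<open>dyadic\<close> start at degree 1, so the constant term
  is always split off.\<close>

definition below :: "nat \<Rightarrow> (nat \<times> nat) set" where "below n = {(l, m). l + m < n}"
definition dyadic :: "nat \<Rightarrow> (nat \<times> nat) set" where "dyadic j = {(l, m). 2 ^ j \<le> l + m \<and> l + m < 2 ^ Suc j}"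

lemma finite_below: "finite (below n)"
  by (rule finite_subset[of _ "{..n} \<times> {..n}"]) (auto simp: below_def)

lemma finite_dyadic: "finite (dyadic j)"
  by (rule finite_subset[OF _ finite_below[of "2 ^ Suc j"]]) (auto simp: below_def dyadic_def)

lemma sum_below_dyadic:
  fixes f :: "nat \<times> nat \<Rightarrow> real"
  shows "sum f (below (2 ^ J)) = f (0, 0) + (\<Sum>j<J. sum f (dyadic j))"
proof (induction J)
  case 0
  have "below 1 = {(0, 0)}" by (auto simp: below_def)
  thus ?case by simp
next
  case (Suc J)
  have "below (2 ^ Suc J) = below (2 ^ J) \<union> dyadic J" by (auto simp: below_def dyadic_def)
  moreover have "below (2 ^ J) \<inter> dyadic J = {}" by (auto simp: below_def dyadic_def)
  ultimately have "sum f (below (2 ^ Suc J)) = sum f (below (2 ^ J)) + sum f (dyadic J)"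
    using finite_below finite_dyadic by (simp add: sum.union_disjoint)
  thus ?case using Suc.IH by simp
qed

context apk_weight
begin

definition apk_comb :: "(nat \<times> nat) set \<Rightarrow> (nat \<times> nat \<Rightarrow> real) \<Rightarrow> real \<times> real \<Rightarrow> real" where
  "apk_comb S d z = (\<Sum>i\<in>S. d i * A (snd i) (fst i) z)"

lemma wL2_A: "A m l \<in> wL2 h"
  by (rule wL2_poly_fun) simp

lemma poly_fun_apk_comb: "poly_fun (apk_comb S d)"
  unfolding apk_comb_def[abs_def] by (intro poly_fun_sum poly_fun_mult) auto

lemma wL2_apk_comb: "apk_comb S d \<in> wL2 h"
  by (rule wL2_poly_fun[OF poly_fun_apk_comb])

lemma ip_apk_comb_A:
  assumes "finite S"
  shows "ip (apk_comb S d) (A m l) = (if (l, m) \<in> S then d (l, m) * ip (A m l) (A m l) else 0)"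
proof -
  have "ip (apk_comb S d) (A m l) = (\<Sum>i\<in>S. d i * ip (A (snd i) (fst i)) (A m l))"
    unfolding apk_comb_def[abs_def] by (subst ip_sum_left) (auto simp: ip_cmult_left wL2_A intro: wL2_cmult)
  also have "\<dots> = (\<Sum>i\<in>S. if i = (l, m) then d (l, m) * ip (A m l) (A m l) else 0)"
  proof (intro sum.cong refl)
    fix i assume "i \<in> S"
    show "d i * ip (A (snd i) (fst i)) (A m l) = (if i = (l, m) then d (l, m) * ip (A m l) (A m l) else 0)"
      using A_orthogonal[of "snd i" "fst i" m l] by (cases i) auto
  qed
  also have "\<dots> = (if (l, m) \<in> S then d (l, m) * ip (A m l) (A m l) else 0)"
    using assms by simp
  finally show ?thesis .
qed

lemma ip_apk_comb_right:
  assumes "v \<in> wL2 h" shows "ip v (apk_comb S d) = (\<Sum>i\<in>S. d i * ip v (A (snd i) (fst i)))"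
  unfolding apk_comb_def[abs_def] using assms
  by (subst ip_sum_right) (auto simp: ip_cmult_right wL2_A intro: wL2_cmult)

lemma ip_apk_comb_self:
  assumes "finite S"
  shows "ip (apk_comb S d) (apk_comb S d) = (\<Sum>i\<in>S. (d i)\<^sup>2 * ip (A (snd i) (fst i)) (A (snd i) (fst i)))"
  unfolding ip_apk_comb_right[OF wL2_apk_comb]
  by (intro sum.cong refl) (auto simp: ip_apk_comb_A[OF assms] power2_eq_square)

text \<open>If a norm were 0, the quotient would be 0 by convention and the identities
  \<open>1\<close> and \<open>2\<close> would still hold, so positivity of the norms never has to be
  established.\<close>

lemma Bessel:
  assumes g: "g \<in> wL2 h" and S: "finite S"
  shows "(\<Sum>i\<in>S. (ip g (A (snd i) (fst i)))\<^sup>2 / ip (A (snd i) (fst i)) (A (snd i) (fst i))) \<le> ip g g"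
proof -
  define d where "d i = ip g (A (snd i) (fst i)) / ip (A (snd i) (fst i)) (A (snd i) (fst i))" for i
  let ?B = "\<Sum>i\<in>S. (ip g (A (snd i) (fst i)))\<^sup>2 / ip (A (snd i) (fst i)) (A (snd i) (fst i))"
  have 1: "ip g (apk_comb S d) = ?B"
    unfolding ip_apk_comb_right[OF g] by (intro sum.cong refl) (simp add: d_def power2_eq_square)
  have 2: "ip (apk_comb S d) (apk_comb S d) = ?B"
    unfolding ip_apk_comb_self[OF S] by (intro sum.cong refl) (simp add: d_def power2_eq_square)
  have "0 \<le> ip (\<lambda>z. g z - apk_comb S d z) (\<lambda>z. g z - apk_comb S d z)" by (rule ip_nonneg)
  also have "\<dots> = ip g g - 2 * ip g (apk_comb S d) + ip (apk_comb S d) (apk_comb S d)"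
    using g wL2_apk_comb by (simp add: ip_diff_left ip_diff_right wL2_diff ip_commute[of "apk_comb S d" g])
  finally show ?thesis unfolding 1 2 by simp
qed

end

text \<open>\<open>g\<close> represents the k-th power of the operator applied to \<open>u\<close>.
  From here on the weak differentiability of \<open>u\<close> enters only through
  \<open>coefficients\<close>.\<close>

locale apk_expansion = apk_weight +
  fixes k :: nat and u g :: "real \<times> real \<Rightarrow> real"
  assumes u_cont: "continuous_on triangle u"
    and g: "g \<in> wL2 h"
    and coefficients: "\<And>m l. (- (real (m + l) * (real (m + l) + \<gamma>))) ^ k * ip u (A m l) = ip g (A m l)"
begin

definition c :: "nat \<times> nat \<Rightarrow> real" where "c i = apk_coeff \<alpha> \<beta> p u (snd i) (fst i)"

lemma u_wL2: "u \<in> wL2 h"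
  by (rule wL2_cont[OF u_cont])

lemma c_times_norm: "c (l, m) * ip (A m l) (A m l) = ip u (A m l)"
  using ip_eq_0_if_null[OF _ u_wL2 wL2_A, of m l]
  by (cases "ip (A m l) (A m l) = 0") (simp_all add: c_def apk_coeff_def)

text \<open>In degrees at least \<open>a\<close> the eigenvalue has modulus at least a^2, so passing
  from \<open>g\<close> to \<open>u\<close> gains a^(-4k) in the squared norm; Bessel's inequality
  for \<open>g\<close> sums the block.\<close>

lemma ip_block_le:
  assumes S: "finite S" and a: "a \<ge> 1" "\<And>l m. (l, m) \<in> S \<Longrightarrow> a \<le> l + m"
    and \<tau>: "\<And>l m. (l, m) \<in> S \<Longrightarrow> \<bar>\<tau> (l + m)\<bar> \<le> b"
  shows "ip (apk_comb S (\<lambda>i. \<tau> (fst i + snd i) * c i)) (apk_comb S (\<lambda>i. \<tau> (fst i + snd i) * c i)) \<le> b\<^sup>2 / real a ^ (4 * k) * ip g g"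
proof -
  have "ip (apk_comb S (\<lambda>i. \<tau> (fst i + snd i) * c i)) (apk_comb S (\<lambda>i. \<tau> (fst i + snd i) * c i))
      = (\<Sum>i\<in>S. (\<tau> (fst i + snd i) * c i)\<^sup>2 * ip (A (snd i) (fst i)) (A (snd i) (fst i)))"
    by (rule ip_apk_comb_self[OF S])
  also have "\<dots> \<le> (\<Sum>i\<in>S. b\<^sup>2 / real a ^ (4 * k) * ((ip g (A (snd i) (fst i)))\<^sup>2 / ip (A (snd i) (fst i)) (A (snd i) (fst i))))"
  proof (rule sum_mono)
    fix i assume i: "i \<in> S"
    obtain l m where lm: "i = (l, m)" by (cases i)
    let ?n = "ip (A m l) (A m l)" and ?\<mu> = "real (m + l) * (real (m + l) + \<gamma>)"
    have n: "real a \<le> real (m + l)" using a(2)[of l m] i lm by simp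
    have "real a * real a \<le> ?\<mu>" using n by (intro mult_mono) auto
    hence "(real a * real a) ^ (2 * k) \<le> ?\<mu> ^ (2 * k)" by (intro power_mono) auto
    moreover have "(real a * real a) ^ (2 * k) = real a ^ (4 * k)"
      by (simp add: power_mult_distrib power_add[symmetric])
    ultimately have \<mu>: "real a ^ (4 * k) \<le> ?\<mu> ^ (2 * k)" by simp
    have a0: "real a ^ (4 * k) > 0" using a(1) by simp
    have "(ip g (A m l))\<^sup>2 = ?\<mu> ^ (2 * k) * (ip u (A m l))\<^sup>2"
    proof -
      have "(ip g (A m l))\<^sup>2 = ((- ?\<mu>) ^ k)\<^sup>2 * (ip u (A m l))\<^sup>2"
        unfolding coefficients[symmetric] by (simp only: power_mult_distrib)
      also have "((- ?\<mu>) ^ k)\<^sup>2 = ((- ?\<mu>)\<^sup>2) ^ k" by (simp only: power_mult[symmetric] mult.commute)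
      also have "\<dots> = ?\<mu> ^ (2 * k)" by (simp only: power2_minus power_mult[symmetric] mult.commute)
      finally show ?thesis .
    qed
    hence "real a ^ (4 * k) * (ip u (A m l))\<^sup>2 \<le> (ip g (A m l))\<^sup>2"
      using \<mu> by (simp add: mult_right_mono)
    hence "(ip u (A m l))\<^sup>2 \<le> 1 / real a ^ (4 * k) * (ip g (A m l))\<^sup>2"
      using a0 by (simp add: field_simps)
    hence cb: "(ip u (A m l))\<^sup>2 / ?n \<le> 1 / real a ^ (4 * k) * (ip g (A m l))\<^sup>2 / ?n"
      using ip_nonneg by (rule divide_right_mono)
    have cn: "(c (l, m))\<^sup>2 * ?n = (ip u (A m l))\<^sup>2 / ?n"
      by (simp add: c_def apk_coeff_def power2_eq_square)
    have b: "(\<tau> (l + m))\<^sup>2 \<le> b\<^sup>2" using \<tau>[of l m] i lm power_mono[of "\<bar>\<tau> (l + m)\<bar>" b 2] by simp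
    have "(\<tau> (l + m) * c (l, m))\<^sup>2 * ?n = (\<tau> (l + m))\<^sup>2 * ((ip u (A m l))\<^sup>2 / ?n)"
      unfolding cn[symmetric] by (simp add: power_mult_distrib)
    also have "\<dots> \<le> b\<^sup>2 * (1 / real a ^ (4 * k) * (ip g (A m l))\<^sup>2 / ?n)"
      using b cb ip_nonneg[of "A m l"] by (intro mult_mono) auto
    finally show "(\<tau> (fst i + snd i) * c i)\<^sup>2 * ip (A (snd i) (fst i)) (A (snd i) (fst i))
      \<le> b\<^sup>2 / real a ^ (4 * k) * ((ip g (A (snd i) (fst i)))\<^sup>2 / ip (A (snd i) (fst i)) (A (snd i) (fst i)))"
      by (simp add: lm)
  qed
  also have "\<dots> \<le> b\<^sup>2 / real a ^ (4 * k) * ip g g"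
    unfolding sum_distrib_left[symmetric] using Bessel[OF g S] by (intro mult_left_mono) auto
  finally show ?thesis .
qed

text \<open>The Nikolskii bound is taken at degree 2^(j+1), the norm bound at the least degree 2^j.
  The multiplier \<tau> is left free: constant 1 for convergence, the filter defect for the
  error.\<close>

lemma dyadic_block_bound:
  assumes nikolskii: "nikolskii S (2 * s)"
  shows "\<exists>C\<ge>0. \<forall>z\<in>S. \<forall>j \<tau> b. b \<ge> 0 \<longrightarrow> (\<forall>n. 2 ^ j \<le> n \<longrightarrow> n < 2 ^ Suc j \<longrightarrow> \<bar>\<tau> n\<bar> \<le> b) \<longrightarrow>
     \<bar>apk_comb (dyadic j) (\<lambda>i. \<tau> (fst i + snd i) * c i) z\<bar> \<le> C * b * (2 ^ j) powr (s - 2 * real k)"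
proof -
  obtain K where K: "K \<ge> 0" "\<And>z m f. z \<in> S \<Longrightarrow> m \<ge> 1 \<Longrightarrow> deg_less (Suc m) f \<Longrightarrow> (f z)\<^sup>2 \<le> K * real m powr (2 * s) * ip f f"
    using nikolskii unfolding nikolskii_def by blast
  define C where "C = sqrt (K * 2 powr (2 * s) * ip g g)"
  have "\<bar>apk_comb (dyadic j) (\<lambda>i. \<tau> (fst i + snd i) * c i) z\<bar> \<le> C * b * (2 ^ j) powr (s - 2 * real k)"
    if z: "z \<in> S" and b: "b \<ge> 0" and \<tau>: "\<And>n. 2 ^ j \<le> n \<Longrightarrow> n < 2 ^ Suc j \<Longrightarrow> \<bar>\<tau> n\<bar> \<le> b" for z j b and \<tau> :: "nat \<Rightarrow> real"
  proof -
    let ?P = "apk_comb (dyadic j) (\<lambda>i. \<tau> (fst i + snd i) * c i)" and ?q = "(2::real) ^ j"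
    have pdP: "deg_less (Suc (2 ^ Suc j)) ?P"
      unfolding apk_comb_def[abs_def]
      by (intro deg_less_sum deg_less_cmult deg_less_mono[OF deg_less_A]) (auto simp: dyadic_def)
    have "(?P z)\<^sup>2 \<le> K * real (2 ^ Suc j) powr (2 * s) * ip ?P ?P" by (rule K(2)[OF z _ pdP]) simp
    also have "\<dots> \<le> K * real (2 ^ Suc j) powr (2 * s) * (b\<^sup>2 / real (2 ^ j) ^ (4 * k) * ip g g)"
      using K(1) \<tau> by (intro mult_left_mono ip_block_le finite_dyadic) (auto simp: dyadic_def)
    also have "real (2 ^ Suc j) powr (2 * s) = 2 powr (2 * s) * (?q powr s)\<^sup>2"
      by (simp add: powr_mult power2_eq_square powr_add[symmetric])
    also have "1 / real (2 ^ j) ^ (4 * k) = (?q powr (- 2 * real k))\<^sup>2"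
    proof -
      have "(?q powr (- 2 * real k))\<^sup>2 = ?q powr (- real (4 * k))" by (simp add: power2_eq_square powr_add[symmetric])
      also have "\<dots> = 1 / ?q ^ (4 * k)" by (simp only: powr_minus_divide powr_realpow zero_less_power zero_less_numeral)
      finally show ?thesis by simp
    qed
    hence "b\<^sup>2 / real (2 ^ j) ^ (4 * k) = b\<^sup>2 * (?q powr (- 2 * real k))\<^sup>2"
      by (metis mult.right_neutral times_divide_eq_right)
    also have "K * (2 powr (2 * s) * (?q powr s)\<^sup>2) * (b\<^sup>2 * (?q powr (- 2 * real k))\<^sup>2 * ip g g)
       = (K * 2 powr (2 * s) * ip g g) * (b * (?q powr s * ?q powr (- 2 * real k)))\<^sup>2"
      by (simp only: power_mult_distrib mult_ac)
    also have "K * 2 powr (2 * s) * ip g g = C\<^sup>2"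
      using K(1) ip_nonneg[of g] by (simp add: C_def)
    also have "?q powr s * ?q powr (- 2 * real k) = ?q powr (s - 2 * real k)"
      by (simp add: powr_add[symmetric])
    finally have "(?P z)\<^sup>2 \<le> (C * (b * ?q powr (s - 2 * real k)))\<^sup>2" by (simp add: power_mult_distrib)
    moreover have "C \<ge> 0" using K(1) ip_nonneg[of g] by (simp add: C_def)
    ultimately show ?thesis using b by (simp add: abs_le_square_iff[symmetric] abs_mult mult.assoc)
  qed
  moreover have "C \<ge> 0" using K(1) ip_nonneg[of g] by (simp add: C_def)
  ultimately show ?thesis by blast
qed

lemma apk_comb_below_dyadic: "apk_comb (below (2 ^ J)) d z = d (0, 0) * A 0 0 z + (\<Sum>j<J. apk_comb (dyadic j) d z)"
  unfolding apk_comb_def by (subst sum_below_dyadic) simp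

text \<open>The expansion converges uniformly, and completeness identifies its sum with \<open>u\<close>.\<close>

lemma expansion_tendsto:
  assumes M: "nikolskii triangle (2 * M)" "M < 2 * real k" and z: "z \<in> triangle"
  shows "(\<lambda>J. apk_comb (below (2 ^ J)) c z) \<longlonglongrightarrow> u z"
proof -
  obtain C where C: "C \<ge> 0" "\<And>z j \<tau> b. z \<in> triangle \<Longrightarrow> b \<ge> 0 \<Longrightarrow> (\<forall>n. 2 ^ j \<le> n \<longrightarrow> n < 2 ^ Suc j \<longrightarrow> \<bar>\<tau> n\<bar> \<le> b) \<Longrightarrow>
     \<bar>apk_comb (dyadic j) (\<lambda>i. \<tau> (fst i + snd i) * c i) z\<bar> \<le> C * b * (2 ^ j) powr (M - 2 * real k)"
    using dyadic_block_bound[OF M(1)] by blast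
  define \<rho> :: real where "\<rho> = 2 powr (M - 2 * real k)"
  have \<rho>: "0 < \<rho>" "\<rho> < 1" using M(2) by (auto simp: \<rho>_def powr_less_one)
  have bd: "norm (apk_comb (dyadic j) c z) \<le> C * \<rho> ^ j" if "z \<in> triangle" for z j
  proof -
    have "((2::real) ^ j) powr (M - 2 * real k) = \<rho> ^ j"
      by (simp add: \<rho>_def powr_realpow[symmetric] powr_powr mult.commute)
    thus ?thesis using C(2)[OF that, of 1 j "\<lambda>_. 1"] by simp
  qed
  define v where "v z = c (0, 0) * A 0 0 z + (\<Sum>j. apk_comb (dyadic j) c z)" for z
  have sm: "summable (\<lambda>j. C * \<rho> ^ j)" using \<rho> by (intro summable_mult summable_geometric) auto
  have "uniform_limit triangle (\<lambda>J z. \<Sum>j<J. apk_comb (dyadic j) c z) (\<lambda>z. \<Sum>j. apk_comb (dyadic j) c z) sequentially"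
    by (rule Weierstrass_m_test[OF bd sm])
  hence ul: "uniform_limit triangle (\<lambda>J z. apk_comb (below (2 ^ J)) c z) v sequentially"
    unfolding apk_comb_below_dyadic v_def[abs_def]
    by (intro uniform_limit_add uniform_limit_const)
  have vc: "continuous_on triangle v"
    by (rule uniform_limit_theorem[OF _ ul]) (auto intro!: always_eventually continuous_on_poly_fun poly_fun_apk_comb)
  have "ip (\<lambda>z. u z - v z) (A m l) = 0" for m l
  proof -
    let ?X = "ip (\<lambda>z. u z - v z) (A m l)" and ?D = "ip (\<lambda>_. 1) (\<lambda>_. 1) * ip (A m l) (A m l)"
    have "?X\<^sup>2 \<le> e\<^sup>2 * ?D" if e: "e > 0" for e
    proof -
      obtain J0 where J0: "\<And>J z. J \<ge> J0 \<Longrightarrow> z \<in> triangle \<Longrightarrow> dist (apk_comb (below (2 ^ J)) c z) (v z) < e"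
        using uniform_limitD[OF ul e] unfolding eventually_sequentially by blast
      \<comment> \<open>Since 2^J exceeds l + m, the partial sum has the same inner product with
        \<open>A m l\<close> as \<open>u\<close>. So \<open>u\<close> may be replaced by a partial
        sum uniformly close to \<open>v\<close>.\<close>
      define J where "J = J0 + (l + m)"
      have "l + m < 2 ^ J" using less_exp[of J] unfolding J_def by linarith
      hence in_below: "(l, m) \<in> below (2 ^ J)" by (simp add: below_def)
      let ?P = "apk_comb (below (2 ^ J)) c"
      have "ip ?P (A m l) = ip u (A m l)"
        using ip_apk_comb_A[OF finite_below, of "2 ^ J" c m l] in_below c_times_norm by simp
      hence "?X = ip (\<lambda>z. ?P z - v z) (A m l)"
        using u_wL2 wL2_cont[OF vc] wL2_apk_comb wL2_A by (simp add: ip_diff_left)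
      hence "?X\<^sup>2 \<le> ip (\<lambda>z. ?P z - v z) (\<lambda>z. ?P z - v z) * ip (A m l) (A m l)"
        using ip_Cauchy_Schwarz[of "\<lambda>z. ?P z - v z" "A m l"] wL2_diff[OF wL2_apk_comb wL2_cont[OF vc]] wL2_A by simp
      also have "\<dots> \<le> (e\<^sup>2 * ip (\<lambda>_. 1) (\<lambda>_. 1)) * ip (A m l) (A m l)"
        using J0[of J] e by (intro mult_right_mono ip_nonneg ip_le_sup_norm wL2_diff[OF wL2_apk_comb wL2_cont[OF vc]])
          (auto simp: J_def dist_real_def less_imp_le)
      finally show ?thesis by (simp add: mult.assoc)
    qed
    hence "?X\<^sup>2 \<le> 0" by (rule nonpos_if_le_small_squares)
    thus ?thesis by simp
  qed
  hence "u z - v z = 0"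
    using u_cont vc z by (intro A_complete[of "\<lambda>z. u z - v z"] continuous_intros) auto
  thus ?thesis using tendsto_uniform_limitI[OF ul z] by simp
qed

lemma filtered_sum_eq_apk_comb: "filtered_sum \<alpha> \<beta> p \<sigma> u N z = apk_comb (below (Suc N)) (\<lambda>i. \<sigma> (real (fst i + snd i) / real N) * c i) z"
  unfolding filtered_sum_def apk_comb_def c_def below_def
  by (intro sum.cong) (auto simp: less_Suc_eq_le)

lemma filtered_sum_error:
  assumes M: "nikolskii triangle (2 * M)" "M < 2 * real k"
    and S: "nikolskii S (2 * s)" "S \<subseteq> triangle" and s: "1 < s" "s < 2 * real k"
    and \<sigma>: "C\<^sub>\<sigma> \<ge> 0" "\<And>t. t \<in> {0..1} \<Longrightarrow> \<bar>1 - \<sigma> t\<bar> \<le> C\<^sub>\<sigma> * t ^ (2 * k - 1)"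
  shows "\<exists>K. \<forall>z\<in>S. \<forall>N\<ge>1. \<bar>u z - filtered_sum \<alpha> \<beta> p \<sigma> u N z\<bar> \<le> K * real N powr (s - 2 * real k)"
proof -
  obtain C where C: "C \<ge> 0" "\<And>z j \<tau> b. z \<in> S \<Longrightarrow> b \<ge> 0 \<Longrightarrow> (\<forall>n. 2 ^ j \<le> n \<longrightarrow> n < 2 ^ Suc j \<longrightarrow> \<bar>\<tau> n\<bar> \<le> b) \<Longrightarrow>
     \<bar>apk_comb (dyadic j) (\<lambda>i. \<tau> (fst i + snd i) * c i) z\<bar> \<le> C * b * (2 ^ j) powr (s - 2 * real k)"
    using dyadic_block_bound[OF S(1)] by blast
  have k: "k \<ge> 1" using s by (cases k) auto
  define r where "r = 2 * k - 1"
  have r: "real r = 2 * real k - 1" "r \<ge> 1" using k by (auto simp: r_def)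
  \<comment> \<open>The block \<open>j = L\<close> may contain degrees above N, where the multiplier
    is 1; the maximum with 1 covers them. The power of 2 accounts for n < 2 * 2^j.\<close>
  define D where "D = max C\<^sub>\<sigma> 1 * 2 ^ r"
  have D: "D \<ge> 1" unfolding D_def using one_le_power[of "2::real" r] by (intro mult_ge1_I) auto
  \<comment> \<open>The smaller of the two decay exponents, s - 1 below N and 2k - s above N, so
    that one ratio \<rho> serves both sides.\<close>
  define \<delta> where "\<delta> = min (s - 1) (2 * real k - s)"
  have \<delta>: "\<delta> > 0" "\<delta> \<le> s - 1" "\<delta> \<le> 2 * real k - s" using s by (auto simp: \<delta>_def)
  define \<rho> :: real where "\<rho> = 2 powr (- \<delta>)"
  have \<rho>: "0 < \<rho>" "\<rho> < 1" using \<delta> by (auto simp: \<rho>_def powr_less_one)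
  define K where "K = 2 * (C * D) / (1 - \<rho>)"
  have "\<bar>u z - filtered_sum \<alpha> \<beta> p \<sigma> u N z\<bar> \<le> K * real N powr (s - 2 * real k)" if z: "z \<in> S" and N: "N \<ge> 1" for z N
  proof -
    define \<tau> where "\<tau> n = 1 - (if n \<le> N then \<sigma> (real n / real N) else 0)" for n
    let ?d = "\<lambda>i. \<tau> (fst i + snd i) * c i"
    obtain L where L: "2 ^ L \<le> N" "N < 2 ^ Suc L"
      using ex_power_ivl1[of 2 N] N by auto
    have Lr: "(2::real) ^ L \<le> real N" "real N < 2 ^ Suc L"
      using L by (metis of_nat_le_iff of_nat_numeral of_nat_power, metis of_nat_less_iff of_nat_numeral of_nat_power)
    have Npos: "real N > 0" using N by simp
    let ?E = "C * D * real N powr (s - 2 * real k)"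
    have E: "?E \<ge> 0" using C(1) D by simp
    have low: "\<bar>apk_comb (dyadic j) ?d z\<bar> \<le> ?E * \<rho> ^ (L - j)" if j: "j \<le> L" for j
    proof -
      let ?q = "(2::real) ^ j"
      let ?b = "D * (?q / real N) ^ r"
      have q0: "?q > 0" by simp
      have tau: "\<bar>\<tau> n\<bar> \<le> ?b" if n: "2 ^ j \<le> n" "n < 2 ^ Suc j" for n
      proof -
        have nr: "real n \<le> 2 * ?q" using n(2) by (metis less_imp_le of_nat_le_iff of_nat_numeral of_nat_power power_Suc)
        have "\<bar>\<tau> n\<bar> \<le> max C\<^sub>\<sigma> 1 * (real n / real N) ^ r"
        proof (cases "n \<le> N")
          case True
          hence "\<bar>\<tau> n\<bar> \<le> C\<^sub>\<sigma> * (real n / real N) ^ r" using \<sigma>(2)[of "real n / real N"] N by (simp add: \<tau>_def r_def)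
          also have "\<dots> \<le> max C\<^sub>\<sigma> 1 * (real n / real N) ^ r" by (intro mult_right_mono) auto
          finally show ?thesis .
        next
          case False
          have "1 * 1 \<le> max C\<^sub>\<sigma> 1 * (real n / real N) ^ r" using False Npos by (intro mult_mono one_le_power) auto
          thus ?thesis using False by (simp add: \<tau>_def)
        qed
        also have "\<dots> \<le> max C\<^sub>\<sigma> 1 * (2 * (?q / real N)) ^ r"
          using nr Npos by (intro mult_left_mono power_mono) (auto simp: field_simps)
        also have "\<dots> = ?b" by (simp only: D_def power_mult_distrib mult.assoc)
        finally show ?thesis .
      qed
      have "\<bar>apk_comb (dyadic j) ?d z\<bar> \<le> C * ?b * ?q powr (s - 2 * real k)"
        using tau D Npos by (intro C(2) z) auto
      also have "(?q / real N) ^ r = ?q powr real r / real N powr real r"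
        using Npos q0 by (simp add: power_divide powr_realpow)
      also have "C * (D * (?q powr real r / real N powr real r)) * ?q powr (s - 2 * real k)
          = C * D * real N powr (- real r) * (?q powr real r * ?q powr (s - 2 * real k))"
        by (simp add: powr_minus divide_inverse)
      also have "?q powr real r * ?q powr (s - 2 * real k) = ?q powr (s - 1)"
        using r by (simp add: powr_add[symmetric])
      also have "?q powr (s - 1) = (?q / real N) powr (s - 1) * real N powr (s - 1)"
        using Npos q0 by (simp add: powr_divide)
      also have "C * D * real N powr (- real r) * ((?q / real N) powr (s - 1) * real N powr (s - 1))
          = C * D * (real N powr (- real r) * real N powr (s - 1)) * (?q / real N) powr (s - 1)" by simp
      also have "real N powr (- real r) * real N powr (s - 1) = real N powr (s - 2 * real k)"
        using r by (simp add: powr_add[symmetric])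
      also have "(?q / real N) powr (s - 1) \<le> \<rho> ^ (L - j)"
      proof -
        have "?q / real N \<le> ?q / 2 ^ L" using Lr q0 Npos by (intro divide_left_mono mult_pos_pos) auto
        also have "?q / 2 ^ L = 1 / 2 ^ (L - j)" using j by (simp add: power_diff)
        finally have x: "?q / real N \<le> 1 / 2 ^ (L - j)" .
        hence "(?q / real N) powr (s - 1) \<le> (1 / 2 ^ (L - j)) powr (s - 1)"
          using s Npos by (intro powr_mono2) auto
        also have "\<dots> \<le> (1 / 2 ^ (L - j)) powr \<delta>"
          using \<delta> by (intro powr_mono') auto
        also have "\<dots> = \<rho> ^ (L - j)"
          by (simp add: \<rho>_def powr_divide powr_minus_divide powr_realpow[symmetric] powr_powr powr_power mult.commute power_one_over[symmetric] power_divide)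
        finally show ?thesis .
      qed
      finally show ?thesis using E by (simp add: mult_left_mono)
    qed
    \<comment> \<open>Only N < 2^(L+1) is known, so the decay is counted from
      \<open>Suc L\<close>.\<close>
    have high: "\<bar>apk_comb (dyadic j) ?d z\<bar> \<le> ?E * \<rho> ^ (j - Suc L)" if j: "j > L" for j
    proof -
      let ?q = "(2::real) ^ j"
      have q0: "?q > 0" by simp
      have NN: "N < n" if "2 ^ j \<le> n" for n
        using that L(2) power_increasing[of "Suc L" j "2::nat"] j by linarith
      have "\<bar>apk_comb (dyadic j) ?d z\<bar> \<le> C * 1 * ?q powr (s - 2 * real k)"
      proof (intro C(2) z allI impI)
        show "\<bar>\<tau> n\<bar> \<le> 1" if "2 ^ j \<le> n" for n using NN[OF that] by (simp add: \<tau>_def)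
      qed simp
      also have "\<dots> \<le> C * D * ?q powr (s - 2 * real k)"
        using C(1) D by (intro mult_right_mono mult_left_mono) auto
      also have "?q powr (s - 2 * real k) = (real N / ?q) powr (2 * real k - s) * real N powr (s - 2 * real k)"
      proof -
        have "real N powr (2 * real k - s) * real N powr (s - 2 * real k) = 1"
          using Npos by (simp add: powr_add[symmetric])
        moreover have "?q powr (s - 2 * real k) = 1 / ?q powr (2 * real k - s)"
          using powr_minus_divide[of ?q "2 * real k - s"] by simp
        ultimately show ?thesis using Npos q0 by (simp add: powr_divide)
      qed
      also have "C * D * ((real N / ?q) powr (2 * real k - s) * real N powr (s - 2 * real k)) = ?E * (real N / ?q) powr (2 * real k - s)"
        by simp
      also have "(real N / ?q) powr (2 * real k - s) \<le> \<rho> ^ (j - Suc L)"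
      proof -
        have "real N / ?q \<le> 2 ^ Suc L / ?q" using Lr q0 by (intro divide_right_mono) auto
        also have "2 ^ Suc L / ?q = 1 / 2 ^ (j - Suc L)" using j by (simp add: power_diff del: power_Suc)
        finally have x: "real N / ?q \<le> 1 / 2 ^ (j - Suc L)" .
        hence "(real N / ?q) powr (2 * real k - s) \<le> (1 / 2 ^ (j - Suc L)) powr (2 * real k - s)"
          using s Npos by (intro powr_mono2) auto
        also have "\<dots> \<le> (1 / 2 ^ (j - Suc L)) powr \<delta>"
          using \<delta> by (intro powr_mono') auto
        also have "\<dots> = \<rho> ^ (j - Suc L)"
          by (simp add: \<rho>_def powr_divide powr_minus_divide powr_realpow[symmetric] powr_powr powr_power mult.commute power_one_over[symmetric] power_divide)
        finally show ?thesis .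
      qed
      finally show ?thesis using E by (simp add: mult_left_mono)
    qed
    have "(\<lambda>J. apk_comb (below (2 ^ J)) c z - filtered_sum \<alpha> \<beta> p \<sigma> u N z) \<longlonglongrightarrow> u z - filtered_sum \<alpha> \<beta> p \<sigma> u N z"
      using z S(2) by (intro tendsto_diff expansion_tendsto[OF M] tendsto_const) auto
    hence "(\<lambda>J. \<bar>apk_comb (below (2 ^ J)) c z - filtered_sum \<alpha> \<beta> p \<sigma> u N z\<bar>) \<longlonglongrightarrow> \<bar>u z - filtered_sum \<alpha> \<beta> p \<sigma> u N z\<bar>"
      by (rule tendsto_rabs)
    moreover have "\<bar>apk_comb (below (2 ^ J)) c z - filtered_sum \<alpha> \<beta> p \<sigma> u N z\<bar> \<le> K * real N powr (s - 2 * real k)" if J: "J > L" for J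
    proof -
      have NJ: "Suc N \<le> 2 ^ J" using L(2) power_increasing[of "Suc L" J "2::nat"] J by linarith
      have "filtered_sum \<alpha> \<beta> p \<sigma> u N z = (\<Sum>i\<in>below (2 ^ J). (if fst i + snd i \<le> N then \<sigma> (real (fst i + snd i) / real N) else 0) * c i * A (snd i) (fst i) z)"
        unfolding filtered_sum_eq_apk_comb apk_comb_def
        by (rule sum.mono_neutral_cong_left) (use NJ in \<open>auto simp: below_def finite_below[unfolded below_def]\<close>)
      hence "apk_comb (below (2 ^ J)) c z - filtered_sum \<alpha> \<beta> p \<sigma> u N z = apk_comb (below (2 ^ J)) ?d z"
        by (simp add: apk_comb_def \<tau>_def sum_subtractf[symmetric] algebra_simps)
      also have "\<dots> = ?d (0, 0) * A 0 0 z + (\<Sum>j<J. apk_comb (dyadic j) ?d z)" by (rule apk_comb_below_dyadic)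
      \<comment> \<open>The filter bound at t = 0, with positive exponent, forces
        \<open>\<sigma> 0 = 1\<close>; the constant term lies in no dyadic block and has to
        vanish.\<close>
      also have "?d (0, 0) = 0" using \<sigma>(2)[of 0, folded r_def] r(2) by (simp add: \<tau>_def power_0_left)
      finally have "\<bar>apk_comb (below (2 ^ J)) c z - filtered_sum \<alpha> \<beta> p \<sigma> u N z\<bar> \<le> (\<Sum>j<J. \<bar>apk_comb (dyadic j) ?d z\<bar>)"
        using sum_abs[of "\<lambda>j. apk_comb (dyadic j) ?d z" "{..<J}"] by simp
      also have "\<dots> \<le> 2 * ?E / (1 - \<rho>)" by (rule sum_two_sided_geometric[OF \<rho> E low high])
      finally show ?thesis by (simp add: K_def)
    qed
    hence "eventually (\<lambda>J. \<bar>apk_comb (below (2 ^ J)) c z - filtered_sum \<alpha> \<beta> p \<sigma> u N z\<bar> \<le> K * real N powr (s - 2 * real k)) sequentially"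
      unfolding eventually_sequentially by (intro exI[of _ "Suc L"]) auto
    ultimately show ?thesis by (rule tendsto_upperbound) simp
  qed
  thus ?thesis by blast
qed

end

section \<open>The rates at the individual points\<close>

theorem theorem4p1:
  fixes \<alpha> \<beta> p \<gamma> k :: nat
    and h u :: "real \<times> real \<Rightarrow> real"
    and \<sigma> :: "real \<Rightarrow> real"
    and \<epsilon> :: real
  assumes "\<alpha> \<ge> 1" and "\<beta> \<ge> 1" and "k \<ge> 1"
    and "\<gamma> = \<alpha> + \<beta> + p"
    and "h = tri_weight \<alpha> \<beta> p"
    and "real k > Max {3/4 + 3/4 * real \<alpha> + real p / 2,
                       5/4 + (real p + real \<beta>) / 2,
                       1/4 + 3/4 * real \<alpha> + real \<beta> / 2}"
    and "u \<in> wSobolev (2 * k) h" and "continuous_on triangle u"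
    and "modal_filter (2 * k - 1) \<sigma>"
    and "\<epsilon> > 0" and "{0..<\<epsilon>} \<subseteq> {0..1}" and "Ck_on (2 * k - 1) {0..<\<epsilon>} \<sigma>"
  shows
    "(\<forall>(x, y) \<in> interior triangle. \<exists>K1. \<forall>N\<ge>1.
        \<bar>u (x, y) - filtered_sum \<alpha> \<beta> p \<sigma> u N (x, y)\<bar>
          \<le> K1 * real N powr (- (2 * real k - 7/4))) \<and>
     (\<forall>y \<in> {0..1}.
        (real p > real \<beta> - 1 \<longrightarrow> (\<exists>K2. \<forall>N\<ge>1.
           \<bar>u (0, y) - filtered_sum \<alpha> \<beta> p \<sigma> u N (0, y)\<bar>
             \<le> K2 * real N powr (- (2 * real k - 3/2 * real \<alpha> - real p - 1/2)))) \<and>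
        (real p \<le> real \<beta> - 1 \<longrightarrow> (\<exists>K3. \<forall>N\<ge>1.
           \<bar>u (0, y) - filtered_sum \<alpha> \<beta> p \<sigma> u N (0, y)\<bar>
             \<le> K3 * real N powr (- (2 * real k - 3/2 * real \<alpha> - real \<beta> + 1/2))))) \<and>
     (\<forall>x \<in> {0<..<1}. \<exists>K4. \<forall>N\<ge>1.
        \<bar>u (x, 0) - filtered_sum \<alpha> \<beta> p \<sigma> u N (x, 0)\<bar>
          \<le> K4 * real N powr (- (2 * real k - 3/4 - real \<beta>))) \<and>
     (\<forall>x \<in> {0<..<1}. \<exists>K5. \<forall>N\<ge>1.
        \<bar>u (x, 1 - x) - filtered_sum \<alpha> \<beta> p \<sigma> u N (x, 1 - x)\<bar>
          \<le> K5 * real N powr (- (2 * real k - 7/4 - real p))) \<and>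
     (\<exists>K6. \<forall>N\<ge>1.
        \<bar>u (1, 0) - filtered_sum \<alpha> \<beta> p \<sigma> u N (1, 0)\<bar>
          \<le> K6 * real N powr (- (2 * real k + real \<alpha> - real \<gamma> - 3/2)))"
proof -
  \<comment> \<open>The three lower bounds on \<open>k\<close>, doubled. They yield
    \<open>M < 2 * k\<close> and make each claimed power of \<open>N\<close> negative.\<close>
  have k1: "2 * real k > 3/2 + 3/2 * real \<alpha> + real p" "2 * real k > 5/2 + real p + real \<beta>"
    "2 * real k > 1/2 + 3/2 * real \<alpha> + real \<beta>"
    using assms(6) by (simp_all add: field_simps)
  have ab: "real \<alpha> \<ge> 1" "real \<beta> \<ge> 1" using assms(1,2) by simp_all
  interpret apk_weight \<alpha> \<beta> p by unfold_locales (use assms in auto)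
  obtain g where g: "g \<in> wL2 (tri_weight \<alpha> \<beta> p)"
    "\<And>m l. (- (real (m + l) * (real (m + l) + (real \<alpha> + real \<beta> + real p)))) ^ k * ip u (A m l) = ip g (A m l)"
    using A_coefficient_decay[OF wSobolev_imp_sobolev, where k = k and u = u] assms(5,7) by blast
  interpret apk_expansion \<alpha> \<beta> p k u g
    by unfold_locales (use assms(8) g in auto)
  define M where "M = max (real \<alpha> + real \<beta>) (max (real \<beta> + real p + 1) (real \<alpha> + real p + 1))"
  have M: "nikolskii triangle (2 * M)" by (rule nikolskii_triangle) (auto simp: M_def)
  have Mk: "M < 2 * real k" using k1 ab unfolding M_def by (auto simp: max_def)
  obtain C where C: "C \<ge> 0" "\<And>t. t \<in> {0..1} \<Longrightarrow> \<bar>1 - \<sigma> t\<bar> \<le> C * t ^ (2 * k - 1)"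
    using modal_filter_bound[OF assms(9-12)] by blast
  \<comment> \<open>\<open>e\<close> is the claimed power of \<open>N\<close>, so the Nikolskii
    exponent available is \<open>s = e + 2 * k\<close>; any smaller exponent at the point can be
    raised to it.\<close>
  have rate: "\<exists>K. \<forall>N\<ge>1. \<bar>u z - filtered_sum \<alpha> \<beta> p \<sigma> u N z\<bar> \<le> K * real N powr e"
    if "nikolskii S r" "z \<in> S" "z \<in> triangle" "r \<le> 2 * (e + 2 * real k)" "1 < e + 2 * real k" "e < 0" for S r z e
  proof -
    have "nikolskii {z} (2 * (e + 2 * real k))" using that by (intro nikolskii_mono[OF that(1)]) auto
    from filtered_sum_error[OF M Mk this _ _ _ C] that show ?thesis by auto
  qed
  have interior: "\<exists>K1. \<forall>N\<ge>1. \<bar>u z - filtered_sum \<alpha> \<beta> p \<sigma> u N z\<bar> \<le> K1 * real N powr (- (2 * real k - 7/4))"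
    if "z \<in> interior triangle" for z
    using that k1 ab interior_subset[of triangle] by (intro rate[OF nikolskii_interior[OF that]]) auto
  \<comment> \<open>The left edge joins two vertices, so both corner exponents must fit below the
    rate. For y \<le> 1/2 the third coordinate is large, otherwise y is.\<close>
  have left: "\<exists>K. \<forall>N\<ge>1. \<bar>u (0, y) - filtered_sum \<alpha> \<beta> p \<sigma> u N (0, y)\<bar> \<le> K * real N powr e"
    if y: "y \<in> {0..1}" and e: "2 * (real \<alpha> + real \<beta>) \<le> 2 * (e + 2 * real k)" "2 * (real \<alpha> + real p + 1) \<le> 2 * (e + 2 * real k)" "e < 0" for y e
  proof (cases "y \<le> 1 / 2")
    case True
    thus ?thesis using y e ab by (intro rate[OF nikolskii_origin]) (auto simp: triangle_iff)
  next
    case False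
    thus ?thesis using y e ab by (intro rate[OF nikolskii_top]) (auto simp: triangle_iff)
  qed
  have left1: "\<exists>K2. \<forall>N\<ge>1. \<bar>u (0, y) - filtered_sum \<alpha> \<beta> p \<sigma> u N (0, y)\<bar>
       \<le> K2 * real N powr (- (2 * real k - 3/2 * real \<alpha> - real p - 1/2))"
    if "y \<in> {0..1}" "real p > real \<beta> - 1" for y
  proof -
    \<comment> \<open>By integrality p > \<beta> - 1 means p \<ge> \<beta>; then 3/2 \<alpha> + p +
      1/2 dominates both \<alpha> + \<beta> and \<alpha> + p + 1, as \<alpha> \<ge> 1.\<close>
    have "real \<beta> < real (p + 1)" using that(2) by simp
    hence "\<beta> < p + 1" by (simp only: of_nat_less_iff)
    hence "real p \<ge> real \<beta>" by simp
    thus ?thesis using that k1 ab by (intro left) auto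
  qed
  have left2: "\<exists>K3. \<forall>N\<ge>1. \<bar>u (0, y) - filtered_sum \<alpha> \<beta> p \<sigma> u N (0, y)\<bar>
       \<le> K3 * real N powr (- (2 * real k - 3/2 * real \<alpha> - real \<beta> + 1/2))"
    if "y \<in> {0..1}" "real p \<le> real \<beta> - 1" for y
    using that k1 ab by (intro left) auto
  have lower: "\<exists>K4. \<forall>N\<ge>1. \<bar>u (x, 0) - filtered_sum \<alpha> \<beta> p \<sigma> u N (x, 0)\<bar>
          \<le> K4 * real N powr (- (2 * real k - 3/4 - real \<beta>))" if "x \<in> {0<..<1}" for x
    using that k1 ab by (intro rate[OF nikolskii_lower_edge]) (auto simp: triangle_iff)
  have hypotenuse: "\<exists>K5. \<forall>N\<ge>1. \<bar>u (x, 1 - x) - filtered_sum \<alpha> \<beta> p \<sigma> u N (x, 1 - x)\<bar>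
          \<le> K5 * real N powr (- (2 * real k - 7/4 - real p))" if "x \<in> {0<..<1}" for x
    using that k1 ab by (intro rate[OF nikolskii_hypotenuse]) (auto simp: triangle_iff)
  \<comment> \<open>Here \<gamma> - \<alpha> = \<beta> + p, so s = \<beta> + p + 3/2, which exceeds
    the corner exponent \<beta> + p + 1.\<close>
  have vertex: "\<exists>K6. \<forall>N\<ge>1. \<bar>u (1, 0) - filtered_sum \<alpha> \<beta> p \<sigma> u N (1, 0)\<bar>
          \<le> K6 * real N powr (- (2 * real k + real \<alpha> - real \<gamma> - 3/2))"
    using k1 ab assms(4) by (intro rate[OF nikolskii_right]) (auto simp: triangle_iff)
  show ?thesis
    using interior left1 left2 lower hypotenuse vertex by blast
qed

end
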